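(* Let $1<p\le q<\infty$, $\alpha>0$, and let $g$ and $\psi$ be entire functions on $\mathbb{C}$. If $V_{(g,\psi)}:F_\alpha^p\to F_\alpha^q$ is bounded, then its essential norm satisfies $$\|V_{(g,\psi)}\|_e\simeq\Big(\limsup_{|w|\to\infty}B_{(\psi,\alpha)}(|g|^q)(w)\Big)^{1/q},$$ that is, each side is bounded by a constant multiple of the other, with constants depending only on $p,q,\alpha$.
   Context: Let $dm$ be Lebesgue measure on $\mathbb{C}$. For $0<p<\infty$ and $\alpha>0$, the Fock space $F_\alpha^p$ consists of all entire functions $f$ with $$\|f\|_{(p,\alpha)}^p=\frac{p\alpha}{2\pi}\int_{\mathbb{C}}|f(z)|^pe^{-\frac{p\alpha}{2}|z|^2}\,dm(z)<\infty.$$ For entire functions $g,\psi$, the operator $V_{(g,\psi)}$ acts on entire functions $f$ by $$V_{(g,\psi)}f(z)=\int_0^z f(\psi(w))g'(w)\,dw.$$ For $0<q<\infty$, the Berezin type integral transform is $$B_{(\psi,\alpha)}(|g|^q)(w)=\int_{\mathbb{C}}e^{\frac{q\alpha}{2}\left(2\Re\langle\psi(z),w\rangle-|z|^2-|w|^2\right)}\frac{|g'(z)|^q}{(1+|z|)^q}\,dm(z)\in[0,\infty],\quad w\in\mathbb{C},$$ where $\langle a,b\rangle=a\overline{b}$. The essential norm $\|T\|_e$ of a bounded operator $T:F_\alpha^p\to F_\alpha^q$ is its distance, in operator norm, to the set of compact operators from $F_\alpha^p$ to $F_\alpha^q$. *)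

theory Defs
  imports "HOL-Complex_Analysis.Complex_Analysis"
begin

definition fock_density :: "real \<Rightarrow> real \<Rightarrow> (complex \<Rightarrow> complex) \<Rightarrow> complex \<Rightarrow> real" where
  "fock_density p \<alpha> f z = norm (f z) powr p * exp (- (p * \<alpha> / 2) * (norm z)\<^sup>2)"

definition fock_space :: "real \<Rightarrow> real \<Rightarrow> (complex \<Rightarrow> complex) set" where
  "fock_space p \<alpha> = {f. f holomorphic_on UNIV \<and> integrable lborel (fock_density p \<alpha> f)}"

(* Meaningful on the Fock space only: the Bochner integral of a non-integrable function is 0. *)
definition fock_norm :: "real \<Rightarrow> real \<Rightarrow> (complex \<Rightarrow> complex) \<Rightarrow> real" where
  "fock_norm p \<alpha> f =
     (p * \<alpha> / (2 * pi) * (LINT z|lborel. fock_density p \<alpha> f z)) powr (1 / p)"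

(* An operator between Fock spaces is a map on all functions of which only the values on
   fock_space p \<alpha> are ever used. *)
type_synonym fock_op = "(complex \<Rightarrow> complex) \<Rightarrow> complex \<Rightarrow> complex"

definition fock_linear :: "real \<Rightarrow> real \<Rightarrow> real \<Rightarrow> fock_op \<Rightarrow> bool" where
  "fock_linear p q \<alpha> T \<longleftrightarrow>
     (\<forall>f\<in>fock_space p \<alpha>. T f \<in> fock_space q \<alpha>) \<and>
     (\<forall>f\<in>fock_space p \<alpha>. \<forall>h\<in>fock_space p \<alpha>. T (\<lambda>z. f z + h z) = (\<lambda>z. T f z + T h z)) \<and>
     (\<forall>f\<in>fock_space p \<alpha>. \<forall>c. T (\<lambda>z. c * f z) = (\<lambda>z. c * T f z))"

definition fock_bounded :: "real \<Rightarrow> real \<Rightarrow> real \<Rightarrow> fock_op \<Rightarrow> bool" where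
  "fock_bounded p q \<alpha> T \<longleftrightarrow> fock_linear p q \<alpha> T \<and>
     (\<exists>C. \<forall>f\<in>fock_space p \<alpha>. fock_norm q \<alpha> (T f) \<le> C * fock_norm p \<alpha> f)"

(* Every bounded sequence has a subsequence whose images converge in norm. *)
definition fock_compact :: "real \<Rightarrow> real \<Rightarrow> real \<Rightarrow> fock_op \<Rightarrow> bool" where
  "fock_compact p q \<alpha> T \<longleftrightarrow> fock_bounded p q \<alpha> T \<and>
     (\<forall>F :: nat \<Rightarrow> complex \<Rightarrow> complex.
        (\<forall>n. F n \<in> fock_space p \<alpha>) \<and> (\<exists>M. \<forall>n. fock_norm p \<alpha> (F n) \<le> M) \<longrightarrow>
        (\<exists>r h. strict_mono (r :: nat \<Rightarrow> nat) \<and> h \<in> fock_space q \<alpha> \<and>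
           (\<lambda>n. fock_norm q \<alpha> (\<lambda>z. T (F (r n)) z - h z)) \<longlonglongrightarrow> 0))"

definition fock_opnorm :: "real \<Rightarrow> real \<Rightarrow> real \<Rightarrow> fock_op \<Rightarrow> real" where
  "fock_opnorm p q \<alpha> T =
     (SUP f\<in>{f \<in> fock_space p \<alpha>. fock_norm p \<alpha> f \<le> 1}. fock_norm q \<alpha> (T f))"

definition fock_essnorm :: "real \<Rightarrow> real \<Rightarrow> real \<Rightarrow> fock_op \<Rightarrow> real" where
  "fock_essnorm p q \<alpha> T =
     (INF K\<in>{K. fock_compact p q \<alpha> K}. fock_opnorm p q \<alpha> (\<lambda>f z. T f z - K f z))"

definition volterra_op :: "(complex \<Rightarrow> complex) \<Rightarrow> (complex \<Rightarrow> complex) \<Rightarrow> fock_op" where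
  "volterra_op g \<psi> f z = contour_integral (linepath 0 z) (\<lambda>w. f (\<psi> w) * deriv g w)"

(* The transform written B_(\<psi>,\<alpha>)(|g|^q), which involves g through its derivative. *)
definition berezin ::
  "real \<Rightarrow> real \<Rightarrow> (complex \<Rightarrow> complex) \<Rightarrow> (complex \<Rightarrow> complex) \<Rightarrow> complex \<Rightarrow> ennreal" where
  "berezin q \<alpha> \<psi> g w =
     (\<integral>\<^sup>+ z. ennreal (exp (q * \<alpha> / 2 * (2 * Re (\<psi> z * cnj w) - (norm z)\<^sup>2 - (norm w)\<^sup>2)) *
        (norm (deriv g z) powr q / (1 + norm z) powr q)) \<partial>lborel)"

(* For positive exponents r. *)
definition ennreal_powr :: "ennreal \<Rightarrow> real \<Rightarrow> ennreal" where
  "ennreal_powr x r = (if x = \<infinity> then \<infinity> else ennreal (enn2real x powr r))"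

end

theory Submission
  imports Defs "HOL-Probability.Distributions" "HOL-Real_Asymp.Real_Asymp"
begin

text \<open>Write V for the operator. Differentiation removes the integral in V:
the norm of an entire function F with F(0) = 0 in the Fock space with exponent q is
comparable to the L^q-norm of |F'(z)| (1 + |z|)^(-1) e^(-\<alpha> |z|^2 / 2)
(\<open>deriv_mass_le_fock_mass\<close>, \<open>fock_mass_le_deriv_mass\<close>). Since (Vf)' = (f \<circ> \<psi>) g', the norm of
Vf is comparable to the L^q-norm of f for one positive measure, and for the normalized
kernel k_w at w this is exactly the Berezin transform at w (\<open>berezin_eq_deriv_mass\<close>).

Lower bound. A compact operator K sends k_w to 0 in norm along a subsequence of any sequence
w \<rightarrow> \<infinity> (\<open>fock_compact_kernel_subsequence\<close>). Duality is avoided: if K k_w tends to h,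
then h is also approximated by K applied to the means of N kernels that are far apart, and
these means have norm at most of order N^(1/p - 1), which tends to 0 because p > 1. Hence
\<parallel>V - K\<parallel> is at least a constant times the limit superior of \<parallel>V k_w\<parallel>.

Upper bound. Let f_r(z) = f(r z). For r < 1 the dilation f \<mapsto> f_r is compact on the Fock
space, by Montel's theorem and dominated convergence, so f \<mapsto> V f_r is compact
(\<open>fock_compact_dilate\<close>). In the norm of V(f - f_r) the part of the measure over
|\<psi>| \<le> R is negligible as r \<rightarrow> 1, and the part over |\<psi>| > R is controlled, as for a
Carleson measure, by the supremum of the Berezin transform over |w| > R - 1
(\<open>carleson_estimate_outside_disc\<close>); here p \<le> q enters through the inclusion of Fock spaces
(\<open>fock_mass_le_fock_norm_powr\<close>).

The estimates are phrased with integrals in [0, \<infinity>], and only the quasi-triangle inequality is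
used for the norms; the constants that this costs depend on p, q and \<alpha> alone.\<close>

section \<open>Lebesgue measure on the complex plane\<close>

lemma lborel_complex_eq_distr:
  "(lborel :: complex measure) =
     distr (lborel \<Otimes>\<^sub>M lborel) borel (\<lambda>(x, y). of_real x + \<i> * of_real y)"
proof (rule lborel_eqI)
  let ?T = "\<lambda>(x, y). of_real x + \<i> * of_real y :: complex"
  fix l u :: complex
  assume le: "\<And>b. b \<in> Basis \<Longrightarrow> l \<bullet> b \<le> u \<bullet> b"
  have le': "Re l \<le> Re u" "Im l \<le> Im u"
    using le[of 1] le[of \<i>] by (auto simp: Basis_complex_def)
  have meas: "?T \<in> borel_measurable (lborel \<Otimes>\<^sub>M lborel)"
    by measurable
  have "?T -` box l u \<inter> space (lborel \<Otimes>\<^sub>M lborel) = {Re l<..<Re u} \<times> {Im l<..<Im u}"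
    by (auto simp: in_box_complex_iff space_pair_measure)
  then have "emeasure (distr (lborel \<Otimes>\<^sub>M lborel) borel ?T) (box l u)
      = emeasure (lborel \<Otimes>\<^sub>M lborel) ({Re l<..<Re u} \<times> {Im l<..<Im u})"
    using meas by (subst emeasure_distr) auto
  also have "\<dots> = ennreal (Re u - Re l) * ennreal (Im u - Im l)"
    using le' by (subst lborel.emeasure_pair_measure_Times) auto
  also have "\<dots> = (\<Prod>b\<in>Basis. (u - l) \<bullet> b)"
    using le' by (auto simp: Basis_complex_def ennreal_mult)
  finally show "emeasure (distr (lborel \<Otimes>\<^sub>M lborel) borel ?T) (box l u)
      = (\<Prod>b\<in>Basis. (u - l) \<bullet> b)" .
qed simp

lemma nn_integral_complex_cartesian:
  assumes [measurable]: "f \<in> borel_measurable borel"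
  shows "(\<integral>\<^sup>+ z. f z \<partial>lborel) =
    (\<integral>\<^sup>+ y. \<integral>\<^sup>+ x. f (of_real x + \<i> * of_real y) \<partial>lborel \<partial>lborel)"
    and "(\<integral>\<^sup>+ z. f z \<partial>lborel) =
    (\<integral>\<^sup>+ x. \<integral>\<^sup>+ y. f (of_real x + \<i> * of_real y) \<partial>lborel \<partial>lborel)"
proof -
  have "(\<integral>\<^sup>+ z. f z \<partial>lborel) =
     (\<integral>\<^sup>+ p. f (of_real (fst p) + \<i> * of_real (snd p)) \<partial>(lborel \<Otimes>\<^sub>M lborel))"
    by (subst lborel_complex_eq_distr, subst nn_integral_distr) (auto simp: case_prod_beta)
  then show "(\<integral>\<^sup>+ z. f z \<partial>lborel) =
    (\<integral>\<^sup>+ y. \<integral>\<^sup>+ x. f (of_real x + \<i> * of_real y) \<partial>lborel \<partial>lborel)"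
    and "(\<integral>\<^sup>+ z. f z \<partial>lborel) =
    (\<integral>\<^sup>+ x. \<integral>\<^sup>+ y. f (of_real x + \<i> * of_real y) \<partial>lborel \<partial>lborel)"
    by (simp add: lborel_pair.nn_integral_snd[symmetric], simp add: lborel.nn_integral_fst[symmetric])
qed

text \<open>A shear translates every line parallel to one of the axes within itself, so it preserves area by Fubini.\<close>
lemma nn_integral_complex_shears:
  fixes f :: "complex \<Rightarrow> ennreal" and t :: real
  assumes [measurable]: "f \<in> borel_measurable borel"
  shows "(\<integral>\<^sup>+ z. f (z + of_real (t * Im z)) \<partial>lborel) = (\<integral>\<^sup>+ z. f z \<partial>lborel)" (is ?horizontal)
    and "(\<integral>\<^sup>+ z. f (z + \<i> * of_real (t * Re z)) \<partial>lborel) = (\<integral>\<^sup>+ z. f z \<partial>lborel)" (is ?vertical)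
proof -
  have shift: "(\<integral>\<^sup>+ x. h (x + c) \<partial>lborel) = (\<integral>\<^sup>+ x. h x \<partial>lborel)"
    if [measurable]: "h \<in> borel_measurable borel" for h :: "real \<Rightarrow> ennreal" and c
    using nn_integral_real_affine[of h 1 c] by (simp add: add.commute)
  show ?horizontal
    using shift[of "\<lambda>x. f (of_real x + \<i> * of_real y)" "t * y" for y]
    by (simp add: nn_integral_complex_cartesian(1) algebra_simps)
  show ?vertical
    using shift[of "\<lambda>y. f (of_real x + \<i> * of_real y)" "t * x" for x]
    by (simp add: nn_integral_complex_cartesian(2) algebra_simps)
qed

text \<open>A rotation by an angle other than \<pi> is a product of three shears; the rotation by \<pi> is the
square of the one by \<pi> / 2.\<close>
lemma nn_integral_complex_rotation:
  fixes f :: "complex \<Rightarrow> ennreal"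
  assumes [measurable]: "f \<in> borel_measurable borel" and e: "norm e = 1"
  shows "(\<integral>\<^sup>+ z. f (e * z) \<partial>lborel) = (\<integral>\<^sup>+ z. f z \<partial>lborel)"
proof -
  have generic: "(\<integral>\<^sup>+ z. h (c * z) \<partial>lborel) = (\<integral>\<^sup>+ z. h z \<partial>lborel)"
    if [measurable]: "h \<in> borel_measurable borel" and c: "norm c = 1" "Re c \<noteq> -1"
    for h :: "complex \<Rightarrow> ennreal" and c
  proof -
    \<comment> \<open>t is minus the tangent of half the rotation angle and s its sine.\<close>
    define t where "t = - Im c / (1 + Re c)"
    define s where "s = Im c"
    have nz: "1 + Re c \<noteq> 0" using c by linarith
    have sq: "(Re c)\<^sup>2 + (Im c)\<^sup>2 = 1"
      using c by (metis cmod_power2 one_power2)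
    have ts: "1 + t * s = Re c"
      using sq nz by (simp add: t_def s_def field_simps power2_eq_square)
    have tst: "t + t * (s * t) + t = - s"
    proof -
      have "t + t * (s * t) + t = t * (1 + (1 + t * s))" by (simp add: algebra_simps)
      also have "\<dots> = - s" unfolding ts using nz by (simp add: t_def s_def)
      finally show ?thesis .
    qed
    define A where "A z = z + of_real (t * Im z)" for z :: complex
    define B where "B z = z + \<i> * of_real (s * Re z)" for z :: complex
    have Re_ABA: "Re (A (B (A z))) = (1 + t * s) * Re z + (t + t * (s * t) + t) * Im z" for z
      by (simp add: A_def B_def algebra_simps)
    have Im_ABA: "Im (A (B (A z))) = s * Re z + (1 + t * s) * Im z" for z
      by (simp add: A_def B_def algebra_simps)
    have ABA: "A (B (A z)) = c * z" for z
      by (rule complex_eqI) (unfold Re_ABA Im_ABA ts tst, simp_all add: s_def)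
    have [measurable]: "A \<in> borel_measurable borel" "B \<in> borel_measurable borel"
      unfolding A_def B_def by measurable
    have "(\<integral>\<^sup>+ z. h (c * z) \<partial>lborel) = (\<integral>\<^sup>+ z. h (A (B (A z))) \<partial>lborel)"
      by (simp add: ABA)
    also have "\<dots> = (\<integral>\<^sup>+ z. h (A (B z)) \<partial>lborel)"
      using nn_integral_complex_shears(1)[of "\<lambda>z. h (A (B z))" t] by (simp add: A_def[of z for z])
    also have "\<dots> = (\<integral>\<^sup>+ z. h (A z) \<partial>lborel)"
      using nn_integral_complex_shears(2)[of "\<lambda>z. h (A z)" s] by (simp add: B_def[of z for z])
    also have "\<dots> = (\<integral>\<^sup>+ z. h z \<partial>lborel)"
      using nn_integral_complex_shears(1)[of h t] by (simp add: A_def)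
    finally show ?thesis .
  qed
  show ?thesis
  proof (cases "Re e = -1")
    case True
    then have "(Im e)\<^sup>2 = 0" using e cmod_power2[of e] by simp
    with True have "e = -1" by (simp add: complex_eq_iff)
    then show ?thesis
      using generic[of "\<lambda>z. f (\<i> * z)" \<i>] generic[of f \<i>] by (simp flip: mult.assoc)
  qed (use generic e in auto)
qed

lemma nn_integral_complex_translate:
  fixes f :: "complex \<Rightarrow> ennreal"
  assumes [measurable]: "f \<in> borel_measurable borel"
  shows "(\<integral>\<^sup>+ z. f (c + z) \<partial>lborel) = (\<integral>\<^sup>+ z. f z \<partial>lborel)"
  by (subst (2) lborel_affine[of 1 c]) (auto simp: nn_integral_density nn_integral_distr)

lemma nn_integral_complex_scale:
  fixes f :: "complex \<Rightarrow> ennreal"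
  assumes [measurable]: "f \<in> borel_measurable borel" and r: "0 < r"
  shows "(\<integral>\<^sup>+ z. f (of_real r * z) \<partial>lborel) = ennreal (1 / r\<^sup>2) * (\<integral>\<^sup>+ z. f z \<partial>lborel)"
proof -
  have "(\<integral>\<^sup>+ z. f z \<partial>lborel) = ennreal (r\<^sup>2) * (\<integral>\<^sup>+ z. f (of_real r * z) \<partial>lborel)"
    using r by (subst lborel_affine[of r 0])
      (auto simp: nn_integral_density nn_integral_distr nn_integral_cmult scaleR_conv_of_real ennreal_power)
  then have "ennreal (1 / r\<^sup>2) * (\<integral>\<^sup>+ z. f z \<partial>lborel) = ennreal (1 / r\<^sup>2 * r\<^sup>2) * (\<integral>\<^sup>+ z. f (of_real r * z) \<partial>lborel)"
    by (subst ennreal_mult) (auto simp: mult.assoc)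
  then show ?thesis using r by simp
qed

lemma nn_integral_complex_gaussian_finite:
  assumes s: "0 < s"
  shows "(\<integral>\<^sup>+ z. ennreal (exp (- s * (norm (z :: complex))\<^sup>2)) \<partial>lborel) < \<infinity>"
proof -
  have real: "(\<integral>\<^sup>+ x. ennreal (exp (- s * x\<^sup>2)) \<partial>lborel) < \<infinity>"
  proof -
    define \<sigma> where "\<sigma> = 1 / sqrt (2 * s)"
    have \<sigma>: "\<sigma> > 0" "\<sigma>\<^sup>2 = 1 / (2 * s)" using s by (simp_all add: \<sigma>_def power_divide)
    have "exp (- s * x\<^sup>2) = sqrt (2 * pi * \<sigma>\<^sup>2) * normal_density 0 \<sigma> x" for x
      using s \<sigma> by (simp add: normal_density_def field_simps)
    then have "integrable lborel (\<lambda>x. exp (- s * x\<^sup>2))"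
      using integrable_normal_density[OF \<sigma>(1), of 0] by simp
    then show ?thesis
      by (simp add: integrable_iff_bounded)
  qed
  have "(\<integral>\<^sup>+ z. ennreal (exp (- s * (norm (z :: complex))\<^sup>2)) \<partial>lborel)
    = (\<integral>\<^sup>+ y. \<integral>\<^sup>+ x. ennreal (exp (- s * y\<^sup>2)) * ennreal (exp (- s * x\<^sup>2)) \<partial>lborel \<partial>lborel)"
    by (subst nn_integral_complex_cartesian(1))
       (auto simp: cmod_power2 algebra_simps simp flip: ennreal_mult exp_add intro!: nn_integral_cong)
  also have "\<dots> = (\<integral>\<^sup>+ y. ennreal (exp (- s * y\<^sup>2)) \<partial>lborel) * (\<integral>\<^sup>+ x. ennreal (exp (- s * x\<^sup>2)) \<partial>lborel)"
    by (simp add: nn_integral_cmult nn_integral_multc)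
  also have "\<dots> < \<infinity>"
    using real by (simp add: ennreal_mult_less_top)
  finally show ?thesis .
qed

definition gauss_mass :: "real \<Rightarrow> real" where
  "gauss_mass s = enn2real (\<integral>\<^sup>+ z. ennreal (exp (- s * (norm (z :: complex))\<^sup>2)) \<partial>lborel)"

lemma nn_integral_translated_gaussian:
  assumes "0 < s"
  shows "(\<integral>\<^sup>+ z. ennreal (exp (- s * (norm (z - w :: complex))\<^sup>2)) \<partial>lborel) = ennreal (gauss_mass s)"
proof -
  have "(\<integral>\<^sup>+ z. ennreal (exp (- s * (norm (z - w))\<^sup>2)) \<partial>lborel) = (\<integral>\<^sup>+ z. ennreal (exp (- s * (norm (z :: complex))\<^sup>2)) \<partial>lborel)"
    using nn_integral_complex_translate[of "\<lambda>z. ennreal (exp (- s * (norm z)\<^sup>2))" "-w"] by simp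
  then show ?thesis
    using nn_integral_complex_gaussian_finite[OF assms] by (simp add: gauss_mass_def)
qed

lemma gauss_mass_nonneg [simp]: "0 \<le> gauss_mass s"
  by (simp add: gauss_mass_def)

section \<open>Two convexity inequalities\<close>

text \<open>Jensen's inequality for the finite measure k dM of mass at most \<kappa>. Bounding x from above by
the tangent line estimate q x \<le> a^(1-q) x^q + (q - 1) a at a = y / \<kappa> keeps every term
nonnegative, so that integrability never has to be discussed.\<close>
lemma nn_integral_jensen_powr:
  fixes x k :: "'a \<Rightarrow> real"
  assumes q: "1 \<le> q" and \<kappa>: "0 < \<kappa>" and y: "0 \<le> y"
    and [measurable]: "x \<in> borel_measurable M" "k \<in> borel_measurable M"
    and nonneg: "\<And>t. 0 \<le> x t" "\<And>t. 0 \<le> k t"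
    and mass: "(\<integral>\<^sup>+ t. ennreal (k t) \<partial>M) \<le> ennreal \<kappa>"
    and le: "ennreal y \<le> (\<integral>\<^sup>+ t. ennreal (x t * k t) \<partial>M)"
  shows "ennreal (y powr q) \<le> ennreal (\<kappa> powr (q - 1)) * (\<integral>\<^sup>+ t. ennreal (x t powr q * k t) \<partial>M)"
proof (cases "y = 0 \<or> (\<integral>\<^sup>+ t. ennreal (x t powr q * k t) \<partial>M) = \<infinity>")
  case True
  then show ?thesis
    using \<kappa> q by (auto simp: ennreal_mult_top)
next
  case False
  with y have y: "y > 0" by auto
  obtain I where I: "(\<integral>\<^sup>+ t. ennreal (x t powr q * k t) \<partial>M) = ennreal I" "0 \<le> I"
    using False by (cases "\<integral>\<^sup>+ t. ennreal (x t powr q * k t) \<partial>M") auto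
  define a where "a = y / \<kappa>"
  have a: "a > 0" using y \<kappa> by (simp add: a_def)
  have young: "q * u \<le> a powr (1 - q) * u powr q + (q - 1) * a" if u: "0 \<le> u" for u
  proof (cases "q = 1")
    case True then show ?thesis using u a by simp
  next
    case False
    with q have q1: "q > 1" by simp
    define v where "v = u / a"
    have v: "v \<ge> 0" "u = a * v" using a u by (auto simp: v_def)
    have "v * 1 \<le> v powr q / q + 1 powr (q / (q - 1)) / (q / (q - 1))"
      using q1 v by (intro Youngs_inequality) (auto simp: field_simps)
    then have "q * v \<le> q * (v powr q / q + (q - 1) / q)"
      using q1 by (intro mult_left_mono) auto
    then have "q * v \<le> v powr q + (q - 1)"
      using q1 by (simp add: distrib_left)
    then have "a * (q * v) \<le> a * (v powr q + (q - 1))"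
      using a by simp
    also have "a * (v powr q + (q - 1)) = a powr (1 - q) * (a powr q * v powr q) + (q - 1) * a"
    proof -
      have "a = a powr (1 - q) * a powr q"
        using a by (simp flip: powr_add)
      then show ?thesis
        by (metis (no_types) distrib_left mult.assoc mult.commute)
    qed
    also have "a powr q * v powr q = u powr q"
      using a v by (simp add: powr_mult)
    finally show ?thesis
      using v by (simp add: mult_ac)
  qed
  have "ennreal (q * y) = ennreal q * ennreal y"
    using q y by (simp add: ennreal_mult)
  also have "\<dots> \<le> ennreal q * (\<integral>\<^sup>+ t. ennreal (x t * k t) \<partial>M)"
    by (intro mult_left_mono le) auto
  also have "\<dots> = (\<integral>\<^sup>+ t. ennreal (q * x t * k t) \<partial>M)"
    using q nonneg by (subst nn_integral_cmult[symmetric]) (auto simp: ennreal_mult mult.assoc)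
  also have "\<dots> \<le> (\<integral>\<^sup>+ t. ennreal (a powr (1 - q)) * ennreal (x t powr q * k t) + ennreal ((q - 1) * a) * ennreal (k t) \<partial>M)"
  proof (intro nn_integral_mono)
    fix t
    have "q * x t * k t \<le> (a powr (1 - q) * x t powr q + (q - 1) * a) * k t"
      using nonneg young by (intro mult_right_mono) auto
    then have "ennreal (q * x t * k t) \<le> ennreal (a powr (1 - q) * (x t powr q * k t) + (q - 1) * a * k t)"
      by (intro ennreal_leI) (simp add: algebra_simps)
    also have "\<dots> = ennreal (a powr (1 - q) * (x t powr q * k t)) + ennreal ((q - 1) * a * k t)"
      using q a nonneg by (intro ennreal_plus) auto
    also have "\<dots> = ennreal (a powr (1 - q)) * ennreal (x t powr q * k t) + ennreal ((q - 1) * a) * ennreal (k t)"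
      using q a nonneg by (simp add: ennreal_mult)
    finally show "ennreal (q * x t * k t) \<le> ennreal (a powr (1 - q)) * ennreal (x t powr q * k t) + ennreal ((q - 1) * a) * ennreal (k t)" .
  qed
  also have "\<dots> = ennreal (a powr (1 - q)) * ennreal I + ennreal ((q - 1) * a) * (\<integral>\<^sup>+ t. ennreal (k t) \<partial>M)"
    by (simp add: nn_integral_add nn_integral_cmult I)
  also have "\<dots> \<le> ennreal (a powr (1 - q)) * ennreal I + ennreal ((q - 1) * a) * ennreal \<kappa>"
    by (intro add_mono mult_left_mono mass) auto
  also have "\<dots> = ennreal (a powr (1 - q) * I + (q - 1) * a * \<kappa>)"
    using q a \<kappa> I by (simp add: ennreal_mult ennreal_plus)
  finally have "q * y \<le> a powr (1 - q) * I + (q - 1) * a * \<kappa>"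
    using q a \<kappa> I by (subst (asm) ennreal_le_iff) auto
  moreover have "a * \<kappa> = y"
    using \<kappa> by (simp add: a_def)
  ultimately have "y \<le> a powr (1 - q) * I"
    by (simp add: mult.assoc left_diff_distrib)
  then have "a powr (q - 1) * y \<le> a powr (q - 1) * (a powr (1 - q) * I)"
    by (intro mult_left_mono) auto
  also have "\<dots> = I"
    using a by (simp flip: mult.assoc powr_add)
  finally have "a powr (q - 1) * y \<le> I" .
  then have "\<kappa> powr (q - 1) * (a powr (q - 1) * y) \<le> \<kappa> powr (q - 1) * I"
    by (intro mult_left_mono) auto
  moreover have "\<kappa> powr (q - 1) * (a powr (q - 1) * y) = y powr q"
  proof -
    have "\<kappa> powr (q - 1) * (a powr (q - 1) * y) = (\<kappa> * a) powr (q - 1) * y powr 1"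
      using \<kappa> a y by (simp add: powr_mult)
    also have "\<kappa> * a = y" using \<kappa> by (simp add: a_def)
    also have "y powr (q - 1) * y powr 1 = y powr q" by (subst powr_add[symmetric]) simp
    finally show ?thesis .
  qed
  ultimately show ?thesis
    using I by (simp flip: ennreal_mult)
qed

lemma powr_add_le:
  fixes a b q :: real
  assumes "0 \<le> a" "0 \<le> b" "0 \<le> q"
  shows "(a + b) powr q \<le> 2 powr q * (a powr q + b powr q)"
proof -
  have "(a + b) powr q \<le> (2 * max a b) powr q"
    using assms by (intro powr_mono2) auto
  also have "\<dots> = 2 powr q * max a b powr q" using assms by (simp add: powr_mult)
  also have "max a b powr q \<le> a powr q + b powr q" by (simp add: max_def)
  finally show ?thesis by simp
qed

section \<open>Sub-mean-value estimates with a Gaussian weight\<close>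

lemma ball_in_borel [measurable]: "ball z \<rho> \<in> sets borel"
  by simp

lemma norm_has_integral_le_nn_integral:
  fixes f :: "real \<Rightarrow> complex"
  assumes f: "(f has_integral I) {a..b}" and cont: "continuous_on {a..b} f"
  shows "ennreal (norm I) \<le> (\<integral>\<^sup>+ t. ennreal (norm (f t)) * indicator {a..b} t \<partial>lborel)"
proof -
  have int: "set_integrable lborel {a..b} f"
    using cont by (rule borel_integrable_atLeastAtMost')
  then have "I = (LINT t:{a..b}|lborel. f t)"
    using f by (metis has_integral_integral integrable_on_def has_integral_unique set_borel_integral_eq_integral)
  then have "ennreal (norm I) \<le> (\<integral>\<^sup>+ t. ennreal (norm (indicator {a..b} t *\<^sub>R f t)) \<partial>lborel)"
    unfolding set_lebesgue_integral_def
    by (simp only:) (rule integral_norm_bound_ennreal, use int in \<open>simp add: set_integrable_def\<close>)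
  also have "\<dots> = (\<integral>\<^sup>+ t. ennreal (norm (f t)) * indicator {a..b} t \<partial>lborel)"
    by (intro nn_integral_cong) (auto split: split_indicator)
  finally show ?thesis .
qed

text \<open>Cauchy's formula at the centre, applied on the unit circle to v \<mapsto> f(z + v u); this treats
all radii |u|, including 0, at once.\<close>
lemma circle_mean_value_le:
  fixes f :: "complex \<Rightarrow> complex"
  assumes f: "f holomorphic_on UNIV"
  shows "ennreal (2 * pi * norm (f z)) \<le>
    (\<integral>\<^sup>+ t. ennreal (norm (f (z + cis t * u))) * indicator {0..2*pi} t \<partial>lborel)"
proof -
  define g where "g v = f (z + v * u)" for v
  have g: "g holomorphic_on UNIV"
    unfolding g_def by (intro holomorphic_on_compose_gen[OF _ f, unfolded o_def] holomorphic_intros) auto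
  have "((\<lambda>v. g v / (v - 0)) has_contour_integral (2 * of_real pi * \<i> * g 0)) (part_circlepath 0 1 0 (2*pi))"
    using Cauchy_integral_circlepath_simple[of g 0 1 0] holomorphic_on_subset[OF g]
    by (auto simp: circlepath_def)
  then have "((\<lambda>t. g (0 + of_real 1 * cis t) / (0 + of_real 1 * cis t - 0) * of_real 1 * \<i> * cis t) has_integral
      (2 * of_real pi * \<i> * g 0)) {0..2*pi}"
    by (subst (asm) has_contour_integral_part_circlepath_iff) auto
  then have "((\<lambda>t. g (cis t) * \<i>) has_integral (2 * of_real pi * \<i> * g 0)) {0..2*pi}"
    by (simp add: field_simps)
  moreover have "continuous_on {0..2*pi} (\<lambda>t. g (cis t) * \<i>)"
    by (intro continuous_intros continuous_on_compose2[OF holomorphic_on_imp_continuous_on[OF g]])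
      (auto simp: cis_conv_exp intro!: continuous_intros)
  ultimately have "ennreal (norm (2 * of_real pi * \<i> * g 0))
      \<le> (\<integral>\<^sup>+ t. ennreal (norm (g (cis t) * \<i>)) * indicator {0..2*pi} t \<partial>lborel)"
    by (rule norm_has_integral_le_nn_integral)
  then show ?thesis
    by (simp add: norm_mult g_def)
qed

text \<open>The integral over a disc does not change when the disc is rotated. Averaging it over all rotations
and exchanging the integrals brings in the mean over circles, without polar coordinates.\<close>
lemma disc_mean_value_le:
  fixes f :: "complex \<Rightarrow> complex"
  assumes f: "f holomorphic_on UNIV" and \<rho>: "0 < \<rho>"
  shows "ennreal (pi * \<rho>\<^sup>2 * norm (f z)) \<le>
    (\<integral>\<^sup>+ u. ennreal (norm (f u)) * indicator (ball z \<rho>) u \<partial>lborel)"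
proof -
  have "continuous_on UNIV f" using f by (rule holomorphic_on_imp_continuous_on)
  then have [measurable]: "f \<in> borel_measurable borel"
    by (rule borel_measurable_continuous_onI)
  let ?I = "\<integral>\<^sup>+ u. ennreal (norm (f (z + u))) * indicator (ball 0 \<rho>) u \<partial>lborel"
  have rot: "(\<integral>\<^sup>+ u. ennreal (norm (f (z + cis t * u))) * indicator (ball 0 \<rho>) u \<partial>lborel) = ?I" for t
    using nn_integral_complex_rotation[of "\<lambda>u. ennreal (norm (f (z + u))) * indicator (ball 0 \<rho>) u" "cis t"]
    by (simp add: indicator_def norm_mult)
  have "ennreal (2 * pi) * ennreal (pi * \<rho>\<^sup>2 * norm (f z))
      = (\<integral>\<^sup>+ u. ennreal (2 * pi * norm (f z)) * indicator (ball (0 :: complex) \<rho>) u \<partial>lborel)"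
    using \<rho> by (subst nn_integral_cmult_indicator)
      (auto simp: emeasure_ball unit_ball_vol_2 algebra_simps simp flip: ennreal_mult)
  also have "\<dots> \<le> (\<integral>\<^sup>+ u. (\<integral>\<^sup>+ t. ennreal (norm (f (z + cis t * u))) * indicator {0..2*pi} t \<partial>lborel)
      * indicator (ball 0 \<rho>) u \<partial>lborel)"
    by (intro nn_integral_mono mult_right_mono circle_mean_value_le f) auto
  also have "\<dots> = (\<integral>\<^sup>+ u. \<integral>\<^sup>+ t. ennreal (norm (f (z + cis t * u))) * indicator (ball 0 \<rho>) u
      * indicator {0..2*pi} t \<partial>lborel \<partial>lborel)"
    by (intro nn_integral_cong, subst nn_integral_multc[symmetric]) (auto simp: cis_conv_exp mult_ac)
  also have "\<dots> = (\<integral>\<^sup>+ t. \<integral>\<^sup>+ u. ennreal (norm (f (z + cis t * u))) * indicator (ball 0 \<rho>) u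
      * indicator {0..2*pi} t \<partial>lborel \<partial>lborel)"
    unfolding cis_conv_exp by (rule lborel_pair.Fubini') measurable
  also have "\<dots> = (\<integral>\<^sup>+ t. ?I * indicator {0..2*pi} t \<partial>lborel)"
    using rot by (intro nn_integral_cong, subst nn_integral_multc) (auto simp: cis_conv_exp)
  also have "\<dots> = ennreal (2 * pi) * ?I"
    by (subst nn_integral_cmult_indicator) (auto simp: mult.commute)
  finally have "ennreal (2 * pi) * ennreal (pi * \<rho>\<^sup>2 * norm (f z)) \<le> ennreal (2 * pi) * ?I" .
  then have "ennreal (pi * \<rho>\<^sup>2 * norm (f z)) \<le> ?I"
    by (subst (asm) ennreal_mult_le_mult_iff) auto
  also have "?I = (\<integral>\<^sup>+ u. ennreal (norm (f u)) * indicator (ball z \<rho>) u \<partial>lborel)"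
    using nn_integral_complex_translate[of "\<lambda>u. ennreal (norm (f u)) * indicator (ball z \<rho>) u" z]
    by (simp add: indicator_def dist_norm)
  finally show ?thesis .
qed

lemma disc_mean_value_powr_le:
  fixes f :: "complex \<Rightarrow> complex"
  assumes f: "f holomorphic_on UNIV" and \<rho>: "0 < \<rho>" and q: "1 \<le> q"
  shows "ennreal (norm (f z) powr q) \<le>
    ennreal (1 / (pi * \<rho>\<^sup>2)) * (\<integral>\<^sup>+ u. ennreal (norm (f u) powr q) * indicator (ball z \<rho>) u \<partial>lborel)"
proof -
  have "continuous_on UNIV f" using f by (rule holomorphic_on_imp_continuous_on)
  then have [measurable]: "f \<in> borel_measurable borel"
    by (rule borel_measurable_continuous_onI)
  define \<kappa> where "\<kappa> = pi * \<rho>\<^sup>2"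
  have \<kappa>: "0 < \<kappa>" using \<rho> by (simp add: \<kappa>_def)
  have ind: "ennreal (x * indicator (ball z \<rho>) u) = ennreal x * indicator (ball z \<rho>) u" for x u
    by (simp split: split_indicator)
  have "ennreal ((\<kappa> * norm (f z)) powr q) \<le> ennreal (\<kappa> powr (q - 1)) *
    (\<integral>\<^sup>+ u. ennreal (norm (f u) powr q * indicator (ball z \<rho>) u) \<partial>lborel)"
  proof (rule nn_integral_jensen_powr[OF q \<kappa>])
    show "(\<integral>\<^sup>+ u. ennreal (indicator (ball z \<rho>) u) \<partial>lborel) \<le> ennreal \<kappa>"
      using \<rho> by (simp add: ennreal_indicator emeasure_ball unit_ball_vol_2 \<kappa>_def)
  qed (use \<kappa> disc_mean_value_le[OF f \<rho>, of z] in \<open>auto simp: ind \<kappa>_def intro!: borel_measurable_indicator\<close>)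
  then have "ennreal (\<kappa> powr (-q)) * ennreal ((\<kappa> * norm (f z)) powr q)
     \<le> ennreal (\<kappa> powr (-q)) * (ennreal (\<kappa> powr (q - 1)) *
    (\<integral>\<^sup>+ u. ennreal (norm (f u) powr q) * indicator (ball z \<rho>) u \<partial>lborel))"
    unfolding ind by (intro mult_left_mono) auto
  moreover have "\<kappa> powr (-q) * (\<kappa> * norm (f z)) powr q = norm (f z) powr q"
    using \<kappa> by (simp add: powr_mult powr_minus)
  moreover have "\<kappa> powr (-q) * \<kappa> powr (q - 1) = 1 / \<kappa>"
    using \<kappa> by (simp add: powr_minus_divide powr_diff)
  ultimately show ?thesis
    by (simp add: \<kappa>_def flip: ennreal_mult mult.assoc)
qed

definition weighted_mod :: "real \<Rightarrow> (complex \<Rightarrow> complex) \<Rightarrow> complex \<Rightarrow> real" where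
  "weighted_mod \<alpha> f z = norm (f z) * exp (- (\<alpha> / 2) * (norm z)\<^sup>2)"

lemma weighted_mod_nonneg [simp]: "0 \<le> weighted_mod \<alpha> f z"
  by (simp add: weighted_mod_def)

lemma fock_density_eq_weighted_mod: "fock_density p \<alpha> f z = weighted_mod \<alpha> f z powr p"
  by (simp add: fock_density_def weighted_mod_def powr_mult exp_powr_real algebra_simps)

text \<open>Multiplication by e^(-\<alpha> (cnj z) u) is holomorphic in u and turns the Gaussian weight centred at
0 into one centred at z, which is nearly constant on a disc about z of fixed radius.\<close>
definition twist :: "real \<Rightarrow> (complex \<Rightarrow> complex) \<Rightarrow> complex \<Rightarrow> complex \<Rightarrow> complex" where
  "twist \<alpha> f z u = f u * exp (- of_real \<alpha> * cnj z * u)"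

lemma norm_twist:
  "norm (twist \<alpha> f z u) = weighted_mod \<alpha> f u * exp (\<alpha> / 2 * (norm (u - z))\<^sup>2) * exp (- (\<alpha> / 2) * (norm z)\<^sup>2)"
proof -
  have "- (\<alpha> / 2) * (norm u)\<^sup>2 + \<alpha> / 2 * (norm (u - z))\<^sup>2 + - (\<alpha> / 2) * (norm z)\<^sup>2
     = Re (- of_real \<alpha> * cnj z * u)"
    unfolding cmod_power2 by (simp add: algebra_simps power2_eq_square)
  then show ?thesis
    by (simp add: twist_def weighted_mod_def norm_mult mult.assoc flip: exp_add)
qed

lemma twist_holomorphic:
  assumes "f holomorphic_on UNIV"
  shows "twist \<alpha> f z holomorphic_on UNIV"
  unfolding twist_def by (intro holomorphic_intros assms)

lemma deriv_twist:
  assumes "f holomorphic_on UNIV"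
  shows "deriv (twist \<alpha> f z) z = (deriv f z - of_real \<alpha> * cnj z * f z) * exp (- of_real (\<alpha> * (norm z)\<^sup>2))"
proof -
  have "(f has_field_derivative deriv f z) (at z)"
    using assms by (auto intro: holomorphic_derivI)
  then have "(twist \<alpha> f z has_field_derivative
     deriv f z * exp (- of_real \<alpha> * cnj z * z) + f z * (exp (- of_real \<alpha> * cnj z * z) * (- of_real \<alpha> * cnj z))) (at z)"
    unfolding twist_def by (auto intro!: derivative_eq_intros)
  then have "deriv (twist \<alpha> f z) z =
     (deriv f z - of_real \<alpha> * cnj z * f z) * exp (- of_real \<alpha> * cnj z * z)"
    by (simp add: DERIV_imp_deriv algebra_simps)
  also have "- of_real \<alpha> * cnj z * z = - of_real (\<alpha> * (norm z)\<^sup>2)"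
    using complex_norm_square[of z] by (simp add: mult_ac)
  finally show ?thesis .
qed

definition disc_mass :: "real \<Rightarrow> real \<Rightarrow> (complex \<Rightarrow> complex) \<Rightarrow> complex \<Rightarrow> ennreal" where
  "disc_mass q \<alpha> f z = (\<integral>\<^sup>+ u. ennreal (fock_density q \<alpha> f u) * indicator (ball z 1) u \<partial>lborel)"

lemma measurable_fock_density:
  assumes "f holomorphic_on UNIV"
  shows "fock_density q \<alpha> f \<in> borel_measurable borel" "weighted_mod \<alpha> f \<in> borel_measurable borel"
proof -
  have [measurable]: "f \<in> borel_measurable borel"
    using assms by (intro borel_measurable_continuous_onI holomorphic_on_imp_continuous_on)
  show "fock_density q \<alpha> f \<in> borel_measurable borel" "weighted_mod \<alpha> f \<in> borel_measurable borel"
    unfolding fock_density_def weighted_mod_def by measurable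
qed

text \<open>The sub-mean-value inequality for the twisted function on the disc of radius 1/2 about v, which
lies in the unit disc about z, where the recentred weight is at most e^(\<alpha>/2).\<close>
lemma twist_le_disc_mass:
  assumes f: "f holomorphic_on UNIV" and q: "1 \<le> q" and \<alpha>: "0 < \<alpha>" and v: "norm (v - z) \<le> 1 / 2"
  shows "ennreal ((norm (twist \<alpha> f z v) * exp (\<alpha> / 2 * (norm z)\<^sup>2)) powr q)
    \<le> ennreal (4 / pi * exp (q * \<alpha> / 2)) * disc_mass q \<alpha> f z"
proof -
  note [measurable] = measurable_fock_density[OF f]
  let ?E = "exp (\<alpha> / 2 * (norm z)\<^sup>2) powr q"
  have "ennreal ((norm (twist \<alpha> f z v) * exp (\<alpha> / 2 * (norm z)\<^sup>2)) powr q)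
     = ennreal ?E * ennreal (norm (twist \<alpha> f z v) powr q)"
    by (simp add: powr_mult mult.commute flip: ennreal_mult)
  also have "\<dots> \<le> ennreal ?E * (ennreal (1 / (pi * (1/2)\<^sup>2)) *
       (\<integral>\<^sup>+ u. ennreal (norm (twist \<alpha> f z u) powr q) * indicator (ball v (1/2)) u \<partial>lborel))"
    by (intro mult_left_mono disc_mean_value_powr_le twist_holomorphic f q) auto
  also have "\<dots> = ennreal (4 / pi) * (\<integral>\<^sup>+ u. ennreal ((norm (twist \<alpha> f z u) * exp (\<alpha> / 2 * (norm z)\<^sup>2)) powr q) * indicator (ball v (1/2)) u \<partial>lborel)"
  proof -
    have [measurable]: "twist \<alpha> f z \<in> borel_measurable borel"
      using twist_holomorphic[OF f] by (intro borel_measurable_continuous_onI holomorphic_on_imp_continuous_on)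
    have eq: "ennreal ((norm (twist \<alpha> f z u) * exp (\<alpha> / 2 * (norm z)\<^sup>2)) powr q) =
       ennreal ?E * ennreal (norm (twist \<alpha> f z u) powr q)" for u
      by (simp add: powr_mult mult.commute flip: ennreal_mult)
    have "(\<integral>\<^sup>+ u. ennreal ((norm (twist \<alpha> f z u) * exp (\<alpha> / 2 * (norm z)\<^sup>2)) powr q) * indicator (ball v (1/2)) u \<partial>lborel)
       = ennreal ?E * (\<integral>\<^sup>+ u. ennreal (norm (twist \<alpha> f z u) powr q) * indicator (ball v (1/2)) u \<partial>lborel)"
      by (simp only: eq mult.assoc, rule nn_integral_cmult) simp
    moreover have "1 / (pi * (1 / 2)\<^sup>2) = 4 / pi"
      by (simp add: power2_eq_square)
    ultimately show ?thesis
      by (simp only: mult.left_commute)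
  qed
  also have "\<dots> \<le> ennreal (4 / pi) * (\<integral>\<^sup>+ u. ennreal (exp (q * \<alpha> / 2)) * (ennreal (fock_density q \<alpha> f u) * indicator (ball z 1) u) \<partial>lborel)"
  proof (intro mult_left_mono nn_integral_mono)
    fix u
    show "ennreal ((norm (twist \<alpha> f z u) * exp (\<alpha> / 2 * (norm z)\<^sup>2)) powr q) * indicator (ball v (1/2)) u
      \<le> ennreal (exp (q * \<alpha> / 2)) * (ennreal (fock_density q \<alpha> f u) * indicator (ball z 1) u)"
    proof (cases "u \<in> ball v (1/2)")
      case True
      then have u: "norm (u - z) < 1"
        using v norm_triangle_ineq[of "u - v" "v - z"] by (auto simp: dist_norm norm_minus_commute)
      have "norm (twist \<alpha> f z u) * exp (\<alpha> / 2 * (norm z)\<^sup>2) = weighted_mod \<alpha> f u * exp (\<alpha> / 2 * (norm (u - z))\<^sup>2)"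
        unfolding norm_twist by (simp add: mult.assoc flip: exp_add)
      also have "\<dots> \<le> weighted_mod \<alpha> f u * exp (\<alpha> / 2)"
        using u \<alpha> by (intro mult_left_mono) (auto simp: abs_square_le_1 power_le_one)
      finally have "(norm (twist \<alpha> f z u) * exp (\<alpha> / 2 * (norm z)\<^sup>2)) powr q \<le> (weighted_mod \<alpha> f u * exp (\<alpha> / 2)) powr q"
        using q by (intro powr_mono2) auto
      also have "\<dots> = exp (q * \<alpha> / 2) * fock_density q \<alpha> f u"
        by (simp add: fock_density_eq_weighted_mod powr_mult exp_powr_real mult_ac)
      finally show ?thesis
        using True u by (simp add: dist_norm norm_minus_commute ennreal_leI fock_density_eq_weighted_mod flip: ennreal_mult)
    qed auto
  qed auto
  also have "\<dots> = ennreal (4 / pi * exp (q * \<alpha> / 2)) * disc_mass q \<alpha> f z"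
  proof -
    have "ennreal (4 / pi * exp (q * \<alpha> / 2)) = ennreal (4 / pi) * ennreal (exp (q * \<alpha> / 2))"
      by (rule ennreal_mult) auto
    then show ?thesis
      by (simp only: mult.assoc disc_mass_def) (subst nn_integral_cmult, auto)
  qed
  finally show ?thesis .
qed

text \<open>The last factors come from the mean value inequality on discs of radius 1/2, the first from
Cauchy's estimate and from the term \<alpha> (cnj z) f(z) that the twist adds to the derivative.\<close>
definition disc_const :: "real \<Rightarrow> real \<Rightarrow> real" where
  "disc_const q \<alpha> = (2 + \<alpha>) powr q * (4 / pi * exp (q * \<alpha> / 2))"

lemma disc_const_pos: "0 < \<alpha> \<Longrightarrow> 0 < disc_const q \<alpha>"
  by (simp add: disc_const_def)

text \<open>The derivative of the twisted function at z is f'(z) - \<alpha> (cnj z) f(z) up to the weight. Cauchy's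
estimate bounds it by the local mass, and the term \<alpha> (cnj z) f(z) is what makes the factor
1 + |z| necessary. Because of the twist, discs of a fixed radius suffice.\<close>
lemma fock_pointwise_le_disc_mass:
  assumes f: "f holomorphic_on UNIV" and q: "1 \<le> q" and \<alpha>: "0 < \<alpha>"
  shows "ennreal (fock_density q \<alpha> f z) \<le> ennreal (disc_const q \<alpha>) * disc_mass q \<alpha> f z"
    and "ennreal ((weighted_mod \<alpha> (deriv f) z / (1 + norm z)) powr q) \<le> ennreal (disc_const q \<alpha>) * disc_mass q \<alpha> f z"
proof -
  have "ennreal (fock_density q \<alpha> f z) \<le> ennreal (disc_const q \<alpha>) * disc_mass q \<alpha> f z \<and>
    ennreal ((weighted_mod \<alpha> (deriv f) z / (1 + norm z)) powr q) \<le> ennreal (disc_const q \<alpha>) * disc_mass q \<alpha> f z"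
  proof (cases "disc_mass q \<alpha> f z")
    case top
    moreover have "ennreal (disc_const q \<alpha>) \<noteq> 0"
      using disc_const_pos[OF \<alpha>, of q] by (simp add: ennreal_eq_0_iff)
    ultimately show ?thesis by (simp add: ennreal_mult_top)
  next
    case (real J)
    define B where "B = (4 / pi * exp (q * \<alpha> / 2) * J) powr (1 / q)"
    define E where "E = exp (\<alpha> / 2 * (norm z)\<^sup>2)"
    have B: "B \<ge> 0" by (simp add: B_def)
    have Bq: "((2 + \<alpha>) * B) powr q = disc_const q \<alpha> * J"
      using q \<alpha> real by (simp add: B_def powr_mult powr_powr disc_const_def)
    have tw: "norm (twist \<alpha> f z v) * E \<le> B" if "norm (v - z) \<le> 1 / 2" for v
    proof -
      have "(norm (twist \<alpha> f z v) * E) powr q \<le> 4 / pi * exp (q * \<alpha> / 2) * J"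
        using twist_le_disc_mass[OF f q \<alpha> that] real by (simp add: E_def flip: ennreal_mult)
      then have "((norm (twist \<alpha> f z v) * E) powr q) powr (1 / q) \<le> B"
        unfolding B_def using q by (intro powr_mono2) auto
      then show ?thesis using q by (simp add: powr_powr E_def)
    qed
    have EE: "exp (- (\<alpha> / 2) * (norm z)\<^sup>2) = exp (- (\<alpha> * (norm z)\<^sup>2)) * E"
      by (simp add: E_def flip: exp_add) 
    have wf: "weighted_mod \<alpha> f z \<le> B"
      using tw[of z] by (simp add: norm_twist E_def mult.assoc flip: exp_add)
    have "norm ((deriv ^^ 1) (twist \<alpha> f z) z) \<le> fact 1 * (B / E) / (1/2)^1"
    proof (rule Cauchy_inequality)
      show "twist \<alpha> f z holomorphic_on ball z (1/2)" "continuous_on (cball z (1/2)) (twist \<alpha> f z)"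
        using twist_holomorphic[OF f] by (auto intro: holomorphic_on_subset holomorphic_on_imp_continuous_on)
      show "norm (twist \<alpha> f z v) \<le> B / E" if "norm (z - v) = 1 / 2" for v
        using tw[of v] that by (simp add: norm_minus_commute field_simps E_def)
    qed auto
    then have "norm (deriv f z - of_real \<alpha> * cnj z * f z) * exp (- (\<alpha> * (norm z)\<^sup>2)) * E \<le> 2 * B"
      by (simp only: deriv_twist[OF f] funpow.simps comp_def id_apply One_nat_def norm_mult norm_exp_eq_Re)
        (simp add: divide_simps E_def)
    moreover have "weighted_mod \<alpha> (deriv f) z \<le> \<alpha> * norm z * weighted_mod \<alpha> f z
       + norm (deriv f z - of_real \<alpha> * cnj z * f z) * exp (- (\<alpha> * (norm z)\<^sup>2)) * E"
    proof -
      have "norm (deriv f z) \<le> norm (of_real \<alpha> * cnj z * f z) + norm (deriv f z - of_real \<alpha> * cnj z * f z)"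
        by (rule norm_triangle_sub)
      also have "norm (of_real \<alpha> * cnj z * f z) = \<alpha> * norm z * norm (f z)"
        using \<alpha> by (simp add: norm_mult)
      finally show ?thesis
        unfolding weighted_mod_def EE by (simp add: E_def flip: mult.assoc distrib_right)
    qed
    moreover have "\<alpha> * norm z * weighted_mod \<alpha> f z \<le> \<alpha> * norm z * B"
      using wf \<alpha> by (intro mult_left_mono) auto
    ultimately have "weighted_mod \<alpha> (deriv f) z \<le> \<alpha> * norm z * B + 2 * B" by linarith
    also have "\<dots> \<le> (2 + \<alpha>) * B * (1 + norm z)"
      using \<alpha> B by (simp add: algebra_simps)
    finally have wd: "weighted_mod \<alpha> (deriv f) z / (1 + norm z) \<le> (2 + \<alpha>) * B"
      by (simp add: pos_divide_le_eq add_pos_nonneg)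
    have "weighted_mod \<alpha> f z \<le> (2 + \<alpha>) * B"
      using wf B \<alpha> mult_right_mono[of 1 "2 + \<alpha>" B] by simp
    then have "weighted_mod \<alpha> f z powr q \<le> disc_const q \<alpha> * J"
      unfolding Bq[symmetric] using q by (intro powr_mono2) auto
    moreover have "(weighted_mod \<alpha> (deriv f) z / (1 + norm z)) powr q \<le> disc_const q \<alpha> * J"
      unfolding Bq[symmetric] using q wd by (intro powr_mono2) auto
    ultimately show ?thesis
      using real disc_const_pos[OF \<alpha>, of q] by (simp add: fock_density_eq_weighted_mod ennreal_leI flip: ennreal_mult)
  qed
  then show "ennreal (fock_density q \<alpha> f z) \<le> ennreal (disc_const q \<alpha>) * disc_mass q \<alpha> f z"
    and "ennreal ((weighted_mod \<alpha> (deriv f) z / (1 + norm z)) powr q) \<le> ennreal (disc_const q \<alpha>) * disc_mass q \<alpha> f z"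
    by auto
qed

section \<open>The Fock norm of a function and of its derivative\<close>

definition fock_mass :: "real \<Rightarrow> real \<Rightarrow> (complex \<Rightarrow> complex) \<Rightarrow> ennreal" where
  "fock_mass q \<alpha> f = (\<integral>\<^sup>+ z. ennreal (fock_density q \<alpha> f z) \<partial>lborel)"

text \<open>The right-hand side of the norm equivalence: the factor 1 + |z| is the rate at which the derivative of
the Gaussian weight grows.\<close>
definition deriv_mass :: "real \<Rightarrow> real \<Rightarrow> (complex \<Rightarrow> complex) \<Rightarrow> ennreal" where
  "deriv_mass q \<alpha> f = (\<integral>\<^sup>+ z. ennreal ((weighted_mod \<alpha> (deriv f) z / (1 + norm z)) powr q) \<partial>lborel)"

text \<open>Fubini in the form used for Carleson measures: averaging the local masses of f at the points
\<phi>(z) means weighting the density of f at u by the mass of the points z that \<phi> sends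
near u.\<close>
lemma nn_integral_disc_mass_weighted:
  assumes f: "f holomorphic_on UNIV" and [measurable]: "\<phi> \<in> borel_measurable borel" "w \<in> borel_measurable borel"
  shows "(\<integral>\<^sup>+ z. disc_mass q \<alpha> f (\<phi> z) * w z \<partial>lborel) =
    (\<integral>\<^sup>+ u. ennreal (fock_density q \<alpha> f u) * (\<integral>\<^sup>+ z. indicator (ball u 1) (\<phi> z) * w z \<partial>lborel) \<partial>lborel)"
proof -
  note [measurable] = measurable_fock_density[OF f]
  have sw: "indicator (ball (\<phi> z) 1) u = (indicator (ball 0 1) (\<phi> z - u) :: ennreal)" for z u
    by (simp add: indicator_def dist_norm norm_minus_commute[of u "\<phi> z" for u z])
  have sw': "indicator (ball u 1) (\<phi> z) = (indicator (ball 0 1) (\<phi> z - u) :: ennreal)" for z u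
    by (auto simp: indicator_def dist_norm) 
  have "(\<integral>\<^sup>+ z. disc_mass q \<alpha> f (\<phi> z) * w z \<partial>lborel) =
     (\<integral>\<^sup>+ z. \<integral>\<^sup>+ u. ennreal (fock_density q \<alpha> f u) * indicator (ball 0 1) (\<phi> z - u) * w z \<partial>lborel \<partial>lborel)"
    unfolding disc_mass_def sw by (intro nn_integral_cong, subst nn_integral_multc[symmetric]) auto
  also have "\<dots> = (\<integral>\<^sup>+ u. \<integral>\<^sup>+ z. ennreal (fock_density q \<alpha> f u) * indicator (ball 0 1) (\<phi> z - u) * w z \<partial>lborel \<partial>lborel)"
    by (rule lborel_pair.Fubini') measurable
  also have "\<dots> = (\<integral>\<^sup>+ u. ennreal (fock_density q \<alpha> f u) * (\<integral>\<^sup>+ z. indicator (ball u 1) (\<phi> z) * w z \<partial>lborel) \<partial>lborel)"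
    unfolding sw' mult.assoc by (intro nn_integral_cong, subst nn_integral_cmult[symmetric]) auto
  finally show ?thesis .
qed

lemma deriv_mass_le_fock_mass:
  assumes f: "f holomorphic_on UNIV" and q: "1 \<le> q" and \<alpha>: "0 < \<alpha>"
  shows "deriv_mass q \<alpha> f \<le> ennreal (disc_const q \<alpha> * pi) * fock_mass q \<alpha> f"
proof -
  note [measurable] = measurable_fock_density[OF f]
  have "deriv_mass q \<alpha> f \<le> (\<integral>\<^sup>+ z. ennreal (disc_const q \<alpha>) * disc_mass q \<alpha> f z \<partial>lborel)"
    unfolding deriv_mass_def by (intro nn_integral_mono fock_pointwise_le_disc_mass f q \<alpha>)
  also have "\<dots> = (\<integral>\<^sup>+ z. disc_mass q \<alpha> f z * ennreal (disc_const q \<alpha>) \<partial>lborel)"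
    by (simp add: mult.commute)
  also have "\<dots> = (\<integral>\<^sup>+ u. ennreal (fock_density q \<alpha> f u) * (\<integral>\<^sup>+ z. indicator (ball u 1) z * ennreal (disc_const q \<alpha>) \<partial>lborel) \<partial>lborel)"
    using nn_integral_disc_mass_weighted[OF f, of "\<lambda>z. z" "\<lambda>_. ennreal (disc_const q \<alpha>)" q \<alpha>] by simp
  also have "\<dots> = (\<integral>\<^sup>+ u. ennreal (fock_density q \<alpha> f u) * ennreal (disc_const q \<alpha> * pi) \<partial>lborel)"
    using disc_const_pos[OF \<alpha>, of q]
    by (intro nn_integral_cong, subst nn_integral_multc)
       (auto simp: emeasure_ball unit_ball_vol_2 mult.commute simp flip: ennreal_mult)
  also have "\<dots> = ennreal (disc_const q \<alpha> * pi) * fock_mass q \<alpha> f"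
    by (simp add: fock_mass_def nn_integral_multc mult.commute)
  finally show ?thesis .
qed

text \<open>The kernel of integration along the ray from 0 to z, when f(z) and f'(t z) carry their Gaussian
weights. The factor 1 + t |z| that belongs to f'(t z) has been replaced by its upper bound
2 t |z|, valid for t |z| \<ge> 1; both marginals of the kernel then have explicit primitives.\<close>
definition ray_kernel :: "real \<Rightarrow> real \<Rightarrow> complex \<Rightarrow> real" where
  "ray_kernel \<alpha> t z = 2 * t * (norm z)\<^sup>2 * exp (- (\<alpha> / 2) * (1 - t\<^sup>2) * (norm z)\<^sup>2)"

lemma ray_kernel_mass_along_ray:
  assumes \<alpha>: "0 < \<alpha>"
  shows "(\<integral>\<^sup>+ t. ennreal (ray_kernel \<alpha> t z * indicator {0..1} t) \<partial>lborel) \<le> ennreal (2 / \<alpha>)"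
proof -
  let ?F = "\<lambda>t. 2 / \<alpha> * exp (- (\<alpha> / 2) * (1 - t\<^sup>2) * (norm z)\<^sup>2)"
  have "((\<lambda>t. ray_kernel \<alpha> t z) has_integral (?F 1 - ?F 0)) {0..1}"
    using \<alpha> unfolding ray_kernel_def
    by (intro fundamental_theorem_of_calculus)
       (auto intro!: derivative_eq_intros simp flip: has_real_derivative_iff_has_vector_derivative simp: field_simps)
  then have "(\<integral>\<^sup>+ t. ennreal (ray_kernel \<alpha> t z) * indicator {0..1} t \<partial>lborel) = ennreal (?F 1 - ?F 0)"
    by (intro nn_integral_has_integral_lebesgue') (auto simp: ray_kernel_def)
  also have "\<dots> \<le> ennreal (2 / \<alpha>)"
    using \<alpha> by (intro ennreal_leI) auto
  finally show ?thesis by (simp add: ennreal_mult'' ennreal_indicator)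
qed

text \<open>The other marginal of the ray kernel, after the substitution z = u / t in the plane. The
primitive extends continuously by 0 to t = 0, where the division by zero contributes nothing.\<close>
lemma ray_kernel_mass_transposed:
  assumes \<alpha>: "0 < \<alpha>"
  shows "(\<integral>\<^sup>+ t. ennreal (1 / t\<^sup>2 * ray_kernel \<alpha> t (u / of_real t) * indicator {0..1} t) \<partial>lborel) \<le> ennreal (2 / \<alpha>)"
proof (cases "u = 0")
  case True
  then show ?thesis by (simp add: ray_kernel_def)
next
  case False
  define s where "s = \<alpha> / 2 * (norm u)\<^sup>2"
  have s: "s > 0" using \<alpha> False by (simp add: s_def)
  let ?F = "\<lambda>t. if t = 0 then 0 else 2 / \<alpha> * exp (- s * (1 / t\<^sup>2 - 1))"
  have ker: "1 / t\<^sup>2 * ray_kernel \<alpha> t (u / of_real t) = 2 / \<alpha> * (2 * s / t ^ 3) * exp (- s * (1 / t\<^sup>2 - 1))"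
    if "t > 0" for t
    using that \<alpha> by (simp add: ray_kernel_def s_def norm_divide power_divide field_simps power2_eq_square power3_eq_cube)
  have "((\<lambda>t. 1 / t\<^sup>2 * ray_kernel \<alpha> t (u / of_real t)) has_integral (?F 1 - ?F 0)) {0..1}"
  proof (rule fundamental_theorem_of_calculus_interior)
    show "(?F has_vector_derivative (1 / t\<^sup>2 * ray_kernel \<alpha> t (u / of_real t))) (at t)" if t: "t \<in> {0<..<1}" for t
    proof -
      have "((\<lambda>t. 2 / \<alpha> * exp (- s * (1 / t\<^sup>2 - 1))) has_real_derivative (1 / t\<^sup>2 * ray_kernel \<alpha> t (u / of_real t))) (at t)"
        using t \<alpha> by (subst ker) (auto intro!: derivative_eq_intros simp: field_simps power2_eq_square power3_eq_cube)
      then have "(?F has_real_derivative (1 / t\<^sup>2 * ray_kernel \<alpha> t (u / of_real t))) (at t)"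
        by (rule has_field_derivative_transform_within_open[where S = "{0<..}"]) (use t in auto)
      then show ?thesis by (simp add: has_real_derivative_iff_has_vector_derivative)
    qed
    show "continuous_on {0..1} ?F"
      unfolding continuous_on_eq_continuous_within
    proof
      fix t :: real assume t: "t \<in> {0..1}"
      show "continuous (at t within {0..1}) ?F"
      proof (cases "t = 0")
        case True
        have "((\<lambda>t. 2 / \<alpha> * exp (- s * (1 / t\<^sup>2 - 1))) \<longlongrightarrow> 0) (at_right 0)"
          using s \<alpha> by real_asymp
        then have "(?F \<longlongrightarrow> 0) (at_right 0)"
          by (rule Lim_transform_eventually) (rule eventually_mono[OF eventually_at_right_less[of 0]], auto)
        then show ?thesis using True
          by (auto simp: continuous_within at_within_Icc_at_right)
      next
        case False
        then have "continuous (at t) (\<lambda>t. 2 / \<alpha> * exp (- s * (1 / t\<^sup>2 - 1)))"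
          by (intro continuous_intros) auto
        then have "continuous (at t) ?F"
          using False t
          by (subst isCont_cong[where g = "\<lambda>t. 2 / \<alpha> * exp (- s * (1 / t\<^sup>2 - 1))"])
             (rule eventually_mono[OF eventually_nhds_in_open[of "{0<..}" t]], auto)
        then show ?thesis by (rule continuous_at_imp_continuous_at_within)
      qed
    qed
  qed auto
  then have "(\<integral>\<^sup>+ t. ennreal (1 / t\<^sup>2 * ray_kernel \<alpha> t (u / of_real t)) * indicator {0..1} t \<partial>lborel) = ennreal (?F 1 - ?F 0)"
    by (intro nn_integral_has_integral_lebesgue') (auto simp: ray_kernel_def)
  moreover have "(\<integral>\<^sup>+ t. ennreal (1 / t\<^sup>2 * ray_kernel \<alpha> t (u / of_real t)) * indicator {0..1} t \<partial>lborel)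
      = (\<integral>\<^sup>+ t. ennreal (1 / t\<^sup>2 * ray_kernel \<alpha> t (u / of_real t) * indicator {0..1} t) \<partial>lborel)"
    by (intro nn_integral_cong) (auto split: split_indicator)
  ultimately show ?thesis by simp
qed

text \<open>Near the origin the weights are bounded, so the sub-mean-value inequality for f' applies directly.\<close>
lemma deriv_bounded_by_deriv_mass:
  assumes f: "f holomorphic_on UNIV" and q: "1 \<le> q" and \<alpha>: "0 < \<alpha>" and u: "norm u \<le> 1"
  shows "ennreal (norm (deriv f u) powr q) \<le> ennreal (3 powr q * exp (2 * q * \<alpha>)) * deriv_mass q \<alpha> f"
proof -
  have f': "deriv f holomorphic_on UNIV"
    using f by (intro holomorphic_deriv) auto
  note [measurable] = measurable_fock_density[OF f']
  have "ennreal (norm (deriv f u) powr q) \<le> ennreal (1 / (pi * 1\<^sup>2)) *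
      (\<integral>\<^sup>+ v. ennreal (norm (deriv f v) powr q) * indicator (ball u 1) v \<partial>lborel)"
    by (rule disc_mean_value_powr_le[OF f' _ q]) auto
  also have "\<dots> \<le> 1 * (\<integral>\<^sup>+ v. ennreal (3 powr q * exp (2 * q * \<alpha>)) *
      ennreal ((weighted_mod \<alpha> (deriv f) v / (1 + norm v)) powr q) \<partial>lborel)"
  proof (rule mult_mono[OF _ nn_integral_mono])
    show "ennreal (1 / (pi * 1\<^sup>2)) \<le> 1"
      using pi_gt3 by simp
    fix v
    show "ennreal (norm (deriv f v) powr q) * indicator (ball u 1) v \<le> ennreal (3 powr q * exp (2 * q * \<alpha>)) *
      ennreal ((weighted_mod \<alpha> (deriv f) v / (1 + norm v)) powr q)"
    proof (cases "v \<in> ball u 1")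
      case True
      then have v: "norm v \<le> 2"
        using u norm_triangle_ineq4[of u "u - v"] by (auto simp: dist_norm)
      have "norm (deriv f v) = weighted_mod \<alpha> (deriv f) v / (1 + norm v) * ((1 + norm v) * exp (\<alpha> / 2 * (norm v)\<^sup>2))"
        using add_pos_nonneg[of 1 "norm v"] by (simp add: weighted_mod_def flip: exp_add mult.assoc)
      also have "\<dots> \<le> weighted_mod \<alpha> (deriv f) v / (1 + norm v) * (3 * exp (\<alpha> / 2 * 2\<^sup>2))"
        using v \<alpha> power_mono[OF v, of 2] by (intro mult_left_mono mult_mono) auto
      finally have "norm (deriv f v) powr q \<le> (weighted_mod \<alpha> (deriv f) v / (1 + norm v) * (3 * exp (\<alpha> / 2 * 2\<^sup>2))) powr q"
        using q by (intro powr_mono2) auto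
      also have "\<dots> = 3 powr q * exp (2 * q * \<alpha>) * (weighted_mod \<alpha> (deriv f) v / (1 + norm v)) powr q"
        by (subst powr_mult) (auto simp: powr_mult exp_powr_real mult_ac)
      finally show ?thesis
        using True by (simp add: ennreal_leI flip: ennreal_mult)
    qed auto
  qed auto
  also have "\<dots> = ennreal (3 powr q * exp (2 * q * \<alpha>)) * deriv_mass q \<alpha> f"
    unfolding deriv_mass_def mult_1 by (rule nn_integral_cmult) measurable
  finally show ?thesis .
qed

text \<open>Integrating f' along the ray from 0 to z. The part of the ray inside the unit disc is estimated
by a bound M for |f'| there; the rest of the ray satisfies t |z| \<ge> 1, which is where the ray
kernel dominates.\<close>
lemma weighted_mod_le_ray_integral:
  fixes \<alpha> M :: real
  assumes f: "f holomorphic_on UNIV" and f0: "f 0 = 0"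
    and M: "0 \<le> M" "\<And>u. norm u \<le> 1 \<Longrightarrow> norm (deriv f u) \<le> M"
  defines "G \<equiv> \<lambda>u. if norm u < 1 then 0 else weighted_mod \<alpha> (deriv f) u / (1 + norm u)"
  shows "ennreal (weighted_mod \<alpha> f z) \<le> ennreal (M * exp (- (\<alpha> / 2) * (norm z)\<^sup>2)) +
    (\<integral>\<^sup>+ t. ennreal (G (of_real t * z) * (ray_kernel \<alpha> t z * indicator {0..1} t)) \<partial>lborel)"
proof -
  define E where "E = exp (- (\<alpha> / 2) * (norm z)\<^sup>2)"
  have E: "E > 0" by (simp add: E_def)
  have f': "deriv f holomorphic_on UNIV"
    using f by (intro holomorphic_deriv) auto
  note [measurable] = measurable_fock_density[OF f']
  have [measurable]: "G \<in> borel_measurable borel"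
    unfolding G_def by measurable
  have [measurable]: "(\<lambda>t. ray_kernel \<alpha> t z) \<in> borel_measurable borel"
    unfolding ray_kernel_def by measurable
  have G_nonneg: "0 \<le> G u" for u by (simp add: G_def)
  have "((\<lambda>t. z * deriv f (of_real t * z)) has_integral f (of_real 1 * z) - f (of_real 0 * z)) {0..1}"
  proof (rule fundamental_theorem_of_calculus)
    fix t :: real
    have "(f has_field_derivative deriv f (of_real t * z)) (at (of_real t * z))"
      using f by (auto intro: holomorphic_derivI)
    moreover have "((\<lambda>t. of_real t * z) has_vector_derivative z) (at t within {0..1})"
      by (auto intro!: derivative_eq_intros)
    ultimately have "((f \<circ> (\<lambda>t. of_real t * z)) has_vector_derivative z * deriv f (of_real t * z)) (at t within {0..1})"
      by (intro field_vector_diff_chain_within[OF _ has_field_derivative_at_within])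
    then show "((\<lambda>t. f (of_real t * z)) has_vector_derivative z * deriv f (of_real t * z)) (at t within {0..1})"
      by (simp add: o_def)
  qed auto
  moreover have "continuous_on {0..1} (\<lambda>t. z * deriv f (of_real t * z))"
    by (rule continuous_on_mult_left, rule continuous_on_compose2[OF holomorphic_on_imp_continuous_on[OF f']])
       (auto intro!: continuous_intros)
  ultimately have "ennreal (norm (f (of_real 1 * z) - f (of_real 0 * z)))
     \<le> (\<integral>\<^sup>+ t. ennreal (norm (z * deriv f (of_real t * z))) * indicator {0..1} t \<partial>lborel)"
    by (rule norm_has_integral_le_nn_integral)
  then have "ennreal (weighted_mod \<alpha> f z) \<le> (\<integral>\<^sup>+ t. ennreal (norm (z * deriv f (of_real t * z))) * indicator {0..1} t \<partial>lborel) * ennreal E"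
    using f0 by (simp add: weighted_mod_def E_def mult_right_mono ennreal_mult)
  also have "\<dots> = (\<integral>\<^sup>+ t. ennreal (norm (z * deriv f (of_real t * z)) * E) * indicator {0..1} t \<partial>lborel)"
  proof -
    have [measurable]: "deriv f \<in> borel_measurable borel"
      using f' by (intro borel_measurable_continuous_onI holomorphic_on_imp_continuous_on)
    show ?thesis
      using E by (subst nn_integral_multc[symmetric]) (auto simp: ennreal_mult'' mult_ac intro!: nn_integral_cong)
  qed
  also have "\<dots> \<le> (\<integral>\<^sup>+ t. ennreal (M * E) * (ennreal (norm z) * indicator {0..<1 / norm z} t) +
      ennreal (G (of_real t * z) * (ray_kernel \<alpha> t z * indicator {0..1} t)) \<partial>lborel)"
  proof (intro nn_integral_mono)
    fix t :: real
    show "ennreal (norm (z * deriv f (of_real t * z)) * E) * indicator {0..1} t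
      \<le> ennreal (M * E) * (ennreal (norm z) * indicator {0..<1 / norm z} t) +
      ennreal (G (of_real t * z) * (ray_kernel \<alpha> t z * indicator {0..1} t))"
    proof (cases "t \<in> {0..1} \<and> z \<noteq> 0")
      case True
      then have t: "0 \<le> t" "t \<le> 1" and z: "norm z > 0" by auto
      have nt: "norm (of_real t * z) = t * norm z" using t by (simp add: norm_mult)
      show ?thesis
      proof (cases "t * norm z < 1")
        case less: True
        then have "t \<in> {0..<1 / norm z}" using t z by (simp add: field_simps)
        moreover have "norm (z * deriv f (of_real t * z)) * E \<le> M * E * norm z"
          using less M(2)[of "of_real t * z"] nt E z by (simp add: norm_mult)
        ultimately show ?thesis
          using t M E by (auto intro!: add_increasing2 ennreal_leI simp flip: ennreal_mult)
      next
        case False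
        define r where "r = t * norm z"
        have r: "r \<ge> 1" using False by (simp add: r_def)
        have EE: "E = exp (- (\<alpha> / 2) * r\<^sup>2) * exp (- (\<alpha> / 2) * (1 - t\<^sup>2) * (norm z)\<^sup>2)"
          by (simp add: E_def r_def algebra_simps flip: exp_add)
        have "norm (z * deriv f (of_real t * z)) * E = G (of_real t * z) * ((1 + r) * norm z * exp (- (\<alpha> / 2) * (1 - t\<^sup>2) * (norm z)\<^sup>2))"
          using r unfolding EE G_def nt weighted_mod_def r_def[symmetric] by (simp add: norm_mult)
        also have "\<dots> \<le> G (of_real t * z) * ((2 * r) * norm z * exp (- (\<alpha> / 2) * (1 - t\<^sup>2) * (norm z)\<^sup>2))"
          using r G_nonneg by (intro mult_left_mono mult_right_mono) auto
        also have "\<dots> = G (of_real t * z) * ray_kernel \<alpha> t z"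
          by (simp add: ray_kernel_def r_def power2_eq_square)
        finally show ?thesis
          using t by (auto intro!: add_increasing ennreal_leI)
      qed
    qed (auto simp: indicator_def)
  qed
  also have "\<dots> = ennreal (M * E) * (ennreal (norm z) * emeasure lborel {0..<1 / norm z}) +
     (\<integral>\<^sup>+ t. ennreal (G (of_real t * z) * (ray_kernel \<alpha> t z * indicator {0..1} t)) \<partial>lborel)"
    by (subst nn_integral_add) (auto simp: nn_integral_cmult)
  also have "\<dots> \<le> ennreal (M * E) * 1 +
     (\<integral>\<^sup>+ t. ennreal (G (of_real t * z) * (ray_kernel \<alpha> t z * indicator {0..1} t)) \<partial>lborel)"
    by (intro add_mono mult_left_mono) (auto simp flip: ennreal_mult)
  finally show ?thesis by (simp add: E_def)
qed


text \<open>The first summand comes from the unit disc and the second from the rays outside it.\<close>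
definition primitive_const :: "real \<Rightarrow> real \<Rightarrow> real" where
  "primitive_const q \<alpha> = 2 powr q * (3 powr q * exp (2 * q * \<alpha>) *
      gauss_mass (q * \<alpha> / 2) + (2 / \<alpha>) powr q)"

lemma primitive_const_pos: "0 < \<alpha> \<Longrightarrow> 0 < primitive_const q \<alpha>"
  unfolding primitive_const_def by (intro mult_pos_pos add_nonneg_pos) auto

text \<open>Schur's test: Fubini and the scaling z = u / t turn the average over rays into the transposed kernel.\<close>
lemma ray_average_le:
  assumes q: "1 \<le> q" and \<alpha>: "0 < \<alpha>" and [measurable]: "G \<in> borel_measurable borel" and G: "\<And>u. 0 \<le> G u"
  shows "(\<integral>\<^sup>+ z. \<integral>\<^sup>+ t. ennreal (G (of_real t * z) powr q * (ray_kernel \<alpha> t z * indicator {0..1} t)) \<partial>lborel \<partial>lborel)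
    \<le> ennreal (2 / \<alpha>) * (\<integral>\<^sup>+ u. ennreal (G u powr q) \<partial>lborel)"
proof -
  have [measurable]: "(\<lambda>p. ray_kernel \<alpha> (fst p) (snd p)) \<in> borel_measurable (borel \<Otimes>\<^sub>M borel)"
    "(\<lambda>p. ray_kernel \<alpha> (snd p) (fst p)) \<in> borel_measurable (borel \<Otimes>\<^sub>M borel)"
    "(\<lambda>p. ray_kernel \<alpha> (snd p) (fst p / of_real (snd p))) \<in> borel_measurable (borel \<Otimes>\<^sub>M borel)"
    "(\<lambda>p. ray_kernel \<alpha> (fst p) (snd p / of_real (fst p))) \<in> borel_measurable (borel \<Otimes>\<^sub>M borel)"
    "(\<lambda>u. ray_kernel \<alpha> t (u / of_real t)) \<in> borel_measurable borel"
    "(\<lambda>t. ray_kernel \<alpha> t (v / of_real t)) \<in> borel_measurable borel" for t v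
    unfolding ray_kernel_def by measurable
  have scale: "(\<integral>\<^sup>+ z. ennreal (G (of_real t * z) powr q * (ray_kernel \<alpha> t z * indicator {0..1} t)) \<partial>lborel)
    = (\<integral>\<^sup>+ u. ennreal (G u powr q) * ennreal (1 / t\<^sup>2 * ray_kernel \<alpha> t (u / of_real t) * indicator {0..1} t) \<partial>lborel)" for t
  proof (cases "0 < t \<and> t \<le> 1")
    case True
    then have "(\<integral>\<^sup>+ z. ennreal (G (of_real t * z) powr q * (ray_kernel \<alpha> t z * indicator {0..1} t)) \<partial>lborel)
      = (\<integral>\<^sup>+ z. ennreal (G (of_real t * z) powr q * ray_kernel \<alpha> t ((of_real t * z) / of_real t)) \<partial>lborel)"
      by simp
    also have "\<dots> = ennreal (1 / t\<^sup>2) * (\<integral>\<^sup>+ u. ennreal (G u powr q * ray_kernel \<alpha> t (u / of_real t)) \<partial>lborel)"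
      using True by (intro nn_integral_complex_scale[where f = "\<lambda>u. ennreal (G u powr q * ray_kernel \<alpha> t (u / of_real t))"]) auto
    also have "\<dots> = (\<integral>\<^sup>+ u. ennreal (1 / t\<^sup>2) * ennreal (G u powr q * ray_kernel \<alpha> t (u / of_real t)) \<partial>lborel)"
      by (subst nn_integral_cmult) auto
    also have "\<dots> = (\<integral>\<^sup>+ u. ennreal (G u powr q) * ennreal (1 / t\<^sup>2 * ray_kernel \<alpha> t (u / of_real t) * indicator {0..1} t) \<partial>lborel)"
      using True by (intro nn_integral_cong) (simp add: mult_ac ray_kernel_def flip: ennreal_mult)
    finally show ?thesis .
  next
    case False
    then show ?thesis by (cases "t = 0") (auto simp: ray_kernel_def)
  qed
  have "(\<integral>\<^sup>+ z. \<integral>\<^sup>+ t. ennreal (G (of_real t * z) powr q * (ray_kernel \<alpha> t z * indicator {0..1} t)) \<partial>lborel \<partial>lborel)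
    = (\<integral>\<^sup>+ t. \<integral>\<^sup>+ z. ennreal (G (of_real t * z) powr q * (ray_kernel \<alpha> t z * indicator {0..1} t)) \<partial>lborel \<partial>lborel)"
    by (rule lborel_pair.Fubini') measurable
  also have "\<dots> = (\<integral>\<^sup>+ t. \<integral>\<^sup>+ u. ennreal (G u powr q) * ennreal (1 / t\<^sup>2 * ray_kernel \<alpha> t (u / of_real t) * indicator {0..1} t) \<partial>lborel \<partial>lborel)"
    by (simp only: scale)
  also have "\<dots> = (\<integral>\<^sup>+ u. \<integral>\<^sup>+ t. ennreal (G u powr q) * ennreal (1 / t\<^sup>2 * ray_kernel \<alpha> t (u / of_real t) * indicator {0..1} t) \<partial>lborel \<partial>lborel)"
    by (rule lborel_pair.Fubini'[symmetric]) measurable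
  also have "\<dots> = (\<integral>\<^sup>+ u. ennreal (G u powr q) * (\<integral>\<^sup>+ t. ennreal (1 / t\<^sup>2 * ray_kernel \<alpha> t (u / of_real t) * indicator {0..1} t) \<partial>lborel) \<partial>lborel)"
    by (intro nn_integral_cong nn_integral_cmult) measurable
  also have "\<dots> \<le> (\<integral>\<^sup>+ u. ennreal (G u powr q) * ennreal (2 / \<alpha>) \<partial>lborel)"
    by (intro nn_integral_mono mult_left_mono ray_kernel_mass_transposed[OF \<alpha>]) auto
  also have "\<dots> = ennreal (2 / \<alpha>) * (\<integral>\<^sup>+ u. ennreal (G u powr q) \<partial>lborel)"
    by (subst nn_integral_multc) (auto simp: mult.commute)
  finally show ?thesis .
qed

text \<open>The Hardy-type half of the norm equivalence: Jensen's inequality on each ray, whose kernel has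
bounded mass, followed by integration over the plane.\<close>
lemma fock_mass_le_deriv_mass:
  assumes f: "f holomorphic_on UNIV" and f0: "f 0 = 0" and q: "1 \<le> q" and \<alpha>: "0 < \<alpha>"
  shows "fock_mass q \<alpha> f \<le> ennreal (primitive_const q \<alpha>) * deriv_mass q \<alpha> f"
proof (cases "deriv_mass q \<alpha> f")
  case top
  moreover have "ennreal (primitive_const q \<alpha>) \<noteq> 0"
    using primitive_const_pos[OF \<alpha>, of q] by (simp add: ennreal_eq_0_iff)
  ultimately show ?thesis by (simp add: ennreal_mult_top)
next
  case (real D)
  define K where "K = 3 powr q * exp (2 * q * \<alpha>)"
  \<comment> \<open>M bounds |f'| on the unit disc.\<close>
  define M where "M = (K * D) powr (1 / q)"
  define I where "I = gauss_mass (q * \<alpha> / 2)"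
  have I: "(\<integral>\<^sup>+ z. ennreal (exp (- (q * \<alpha> / 2) * (norm (z :: complex))\<^sup>2)) \<partial>lborel) = ennreal I" "0 \<le> I"
    using nn_integral_complex_gaussian_finite[of "q * \<alpha> / 2"] q \<alpha> by (auto simp: I_def gauss_mass_def)
  have K: "K \<ge> 0" by (simp add: K_def)
  have Mq: "M powr q = K * D" using q real K by (simp add: M_def powr_powr)
  have M: "norm (deriv f u) \<le> M" if "norm u \<le> 1" for u
  proof -
    have "norm (deriv f u) powr q \<le> K * D"
      using deriv_bounded_by_deriv_mass[OF f q \<alpha> that] real K by (simp add: K_def flip: ennreal_mult)
    then have "(norm (deriv f u) powr q) powr (1 / q) \<le> M"
      unfolding M_def using q by (intro powr_mono2) auto
    then show ?thesis using q by (simp add: powr_powr)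
  qed
  have M0: "M \<ge> 0" by (simp add: M_def)
  have f': "deriv f holomorphic_on UNIV"
    using f by (intro holomorphic_deriv) auto
  note [measurable] = measurable_fock_density[OF f'] measurable_fock_density[OF f]
  define G where "G u = (if norm u < 1 then 0 else weighted_mod \<alpha> (deriv f) u / (1 + norm u))" for u
  have Gm [measurable]: "G \<in> borel_measurable borel"
    unfolding G_def by measurable
  have G0: "0 \<le> G u" for u by (simp add: G_def)
  define E where "E z = exp (- (\<alpha> / 2) * (norm z)\<^sup>2)" for z :: complex
  have [measurable]: "E \<in> borel_measurable borel" unfolding E_def by measurable
  have E0: "0 < E z" for z by (simp add: E_def)
  define A where "A z = (\<integral>\<^sup>+ t. ennreal (G (of_real t * z) powr q * (ray_kernel \<alpha> t z * indicator {0..1} t)) \<partial>lborel)" for z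
  have [measurable]: "(\<lambda>p. ray_kernel \<alpha> (snd p) (fst p)) \<in> borel_measurable (borel \<Otimes>\<^sub>M borel)"
     "(\<lambda>t. ray_kernel \<alpha> t z) \<in> borel_measurable borel" for z
    unfolding ray_kernel_def by measurable
  have [measurable]: "A \<in> borel_measurable borel"
    unfolding A_def by measurable
  have pointwise: "ennreal (fock_density q \<alpha> f z) \<le> ennreal (2 powr q) * (ennreal ((2 / \<alpha>) powr (q - 1)) * A z
      + ennreal (K * D) * ennreal (exp (- (q * \<alpha> / 2) * (norm z)\<^sup>2)))" for z
  proof -
    \<comment> \<open>What remains of f(z) after the contribution of the unit disc is removed.\<close>
    define y where "y = max 0 (weighted_mod \<alpha> f z - M * E z)"
    have y: "0 \<le> y" by (simp add: y_def)
    have "ennreal (weighted_mod \<alpha> f z) \<le> ennreal (M * E z) +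
       (\<integral>\<^sup>+ t. ennreal (G (of_real t * z) * (ray_kernel \<alpha> t z * indicator {0..1} t)) \<partial>lborel)"
      unfolding G_def E_def by (rule weighted_mod_le_ray_integral[OF f f0 M0 M])
    then have "ennreal (weighted_mod \<alpha> f z - M * E z) \<le>
       (\<integral>\<^sup>+ t. ennreal (G (of_real t * z) * (ray_kernel \<alpha> t z * indicator {0..1} t)) \<partial>lborel)"
      using M0 E0[of z] by (simp add: ennreal_minus[symmetric] ennreal_minus_le_iff)
    then have "ennreal y \<le> (\<integral>\<^sup>+ t. ennreal (G (of_real t * z) * (ray_kernel \<alpha> t z * indicator {0..1} t)) \<partial>lborel)"
      by (auto simp: y_def max_def)
    then have yq: "ennreal (y powr q) \<le> ennreal ((2 / \<alpha>) powr (q - 1)) * A z"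
      unfolding A_def using \<alpha> G0 y
      by (intro nn_integral_jensen_powr q ray_kernel_mass_along_ray) (auto simp: ray_kernel_def indicator_def)
    have "fock_density q \<alpha> f z \<le> (y + M * E z) powr q"
      unfolding fock_density_eq_weighted_mod using q by (intro powr_mono2) (auto simp: y_def)
    also have "\<dots> \<le> 2 powr q * (y powr q + (M * E z) powr q)"
      using y M0 E0[of z] q by (intro powr_add_le) auto
    also have "(M * E z) powr q = K * D * exp (- (q * \<alpha> / 2) * (norm z)\<^sup>2)"
      using M0 by (simp add: powr_mult Mq E_def exp_powr_real algebra_simps)
    finally have "ennreal (fock_density q \<alpha> f z) \<le> ennreal (2 powr q * (y powr q + K * D * exp (- (q * \<alpha> / 2) * (norm z)\<^sup>2)))"
      by (rule ennreal_leI)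
    also have "\<dots> = ennreal (2 powr q) * (ennreal (y powr q) + ennreal (K * D) * ennreal (exp (- (q * \<alpha> / 2) * (norm z)\<^sup>2)))"
      using K real by (subst ennreal_mult) (auto simp: ennreal_mult)
    also have "\<dots> \<le> ennreal (2 powr q) * (ennreal ((2 / \<alpha>) powr (q - 1)) * A z
      + ennreal (K * D) * ennreal (exp (- (q * \<alpha> / 2) * (norm z)\<^sup>2)))"
      using yq by (intro mult_left_mono add_right_mono) auto
    finally show ?thesis .
  qed
  have "fock_mass q \<alpha> f \<le> (\<integral>\<^sup>+ z. ennreal (2 powr q) * (ennreal ((2 / \<alpha>) powr (q - 1)) * A z
      + ennreal (K * D) * ennreal (exp (- (q * \<alpha> / 2) * (norm z)\<^sup>2))) \<partial>lborel)"
    unfolding fock_mass_def by (intro nn_integral_mono pointwise)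
  also have "\<dots> = ennreal (2 powr q) * (ennreal ((2 / \<alpha>) powr (q - 1)) * (\<integral>\<^sup>+ z. A z \<partial>lborel) + ennreal (K * D) * ennreal I)"
    by (simp add: nn_integral_cmult nn_integral_add I(1)[simplified])
  also have "\<dots> \<le> ennreal (2 powr q) * (ennreal ((2 / \<alpha>) powr (q - 1)) * (ennreal (2 / \<alpha>) * ennreal D) + ennreal (K * D) * ennreal I)"
  proof (intro mult_left_mono add_right_mono)
    have "(\<integral>\<^sup>+ z. A z \<partial>lborel) \<le> ennreal (2 / \<alpha>) * (\<integral>\<^sup>+ u. ennreal (G u powr q) \<partial>lborel)"
      unfolding A_def by (rule ray_average_le[OF q \<alpha> Gm G0])
    also have "\<dots> \<le> ennreal (2 / \<alpha>) * deriv_mass q \<alpha> f"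
      unfolding deriv_mass_def G_def by (intro mult_left_mono nn_integral_mono) auto
    finally show "(\<integral>\<^sup>+ z. A z \<partial>lborel) \<le> ennreal (2 / \<alpha>) * ennreal D"
      using real by simp
  qed auto
  also have "\<dots> = ennreal (2 powr q * ((2 / \<alpha>) powr (q - 1) * (2 / \<alpha> * D) + K * D * I))"
  proof -
    have "ennreal (2 powr q) * (ennreal (c powr (q - 1)) * (ennreal c * ennreal D) + ennreal (K * D) * ennreal I)
      = ennreal (2 powr q * (c powr (q - 1) * (c * D) + K * D * I))" if "0 \<le> c" for c
      using that K I(2) real by (simp add: ennreal_mult)
    then show ?thesis using \<alpha> by simp
  qed
  also have "2 powr q * ((2 / \<alpha>) powr (q - 1) * (2 / \<alpha> * D) + K * D * I) = primitive_const q \<alpha> * D"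
  proof -
    have "(2 / \<alpha>) powr (q - 1) * (2 / \<alpha>) = (2 / \<alpha>) powr q"
      using \<alpha> powr_add[of "2 / \<alpha>" "q - 1" 1] by simp
    then have "(2 / \<alpha>) powr (q - 1) * (2 / \<alpha> * D) = (2 / \<alpha>) powr q * D"
      by (simp only: mult.assoc[symmetric])
    then show ?thesis
      unfolding primitive_const_def I_def[symmetric] K_def[symmetric] by (simp add: algebra_simps)
  qed
  also have "ennreal (primitive_const q \<alpha> * D) = ennreal (primitive_const q \<alpha>) * deriv_mass q \<alpha> f"
    using real primitive_const_pos[OF \<alpha>, of q] by (simp add: ennreal_mult)
  finally show ?thesis .
qed

section \<open>Fock spaces as quasi-normed spaces\<close>

lemma fock_space_iff_fock_mass:
  "f \<in> fock_space p \<alpha> \<longleftrightarrow> f holomorphic_on UNIV \<and> fock_mass p \<alpha> f < \<infinity>"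
proof -
  have "fock_density p \<alpha> f z \<ge> 0" for z by (simp add: fock_density_def)
  then show ?thesis
    using measurable_fock_density(1)[of f p \<alpha>]
    by (auto simp: fock_space_def fock_mass_def integrable_iff_bounded)
qed

lemma fock_norm_nonneg [simp]: "0 \<le> fock_norm p \<alpha> f"
  by (simp add: fock_norm_def)

text \<open>This converts between estimates of integrals in [0, \<infinity>] and estimates of norms.\<close>
lemma fock_mass_eq_fock_norm:
  assumes f: "f \<in> fock_space p \<alpha>" and p: "0 < p" and \<alpha>: "0 < \<alpha>"
  shows "fock_mass p \<alpha> f = ennreal (2 * pi / (p * \<alpha>) * fock_norm p \<alpha> f powr p)"
proof -
  have nonneg: "fock_density p \<alpha> f z \<ge> 0" for z by (simp add: fock_density_def)
  then have "fock_mass p \<alpha> f = ennreal (LINT z|lborel. fock_density p \<alpha> f z)"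
    using f unfolding fock_mass_def by (intro nn_integral_eq_integral) (auto simp: fock_space_def)
  moreover have "0 \<le> (LINT z|lborel. fock_density p \<alpha> f z)"
    using nonneg by (simp add: integral_nonneg)
  then have "fock_norm p \<alpha> f powr p = p * \<alpha> / (2 * pi) * (LINT z|lborel. fock_density p \<alpha> f z)"
    using p \<alpha> by (simp add: fock_norm_def powr_powr)
  ultimately show ?thesis using p \<alpha> by simp
qed

lemma fock_norm_le_of_fock_mass:
  assumes f: "f \<in> fock_space p \<alpha>" and p: "0 < p" and \<alpha>: "0 < \<alpha>" and B: "0 \<le> B"
    and le: "fock_mass p \<alpha> f \<le> ennreal (2 * pi / (p * \<alpha>) * B powr p)"
  shows "fock_norm p \<alpha> f \<le> B"
proof -
  have "2 * pi / (p * \<alpha>) * fock_norm p \<alpha> f powr p \<le> 2 * pi / (p * \<alpha>) * B powr p"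
    using le p \<alpha> by (simp add: fock_mass_eq_fock_norm[OF f p \<alpha>])
  then have "fock_norm p \<alpha> f powr p \<le> B powr p"
    using p \<alpha> by (simp add: field_simps)
  then show ?thesis using B p powr_less_mono2[of p B "fock_norm p \<alpha> f"] by linarith
qed

lemma weighted_mod_add_le: "weighted_mod \<alpha> (\<lambda>z. f z + g z) z \<le> weighted_mod \<alpha> f z + weighted_mod \<alpha> g z"
  using norm_triangle_ineq[of "f z" "g z"] by (simp add: weighted_mod_def flip: distrib_right)

lemma weighted_mod_cmult: "weighted_mod \<alpha> (\<lambda>z. c * f z) z = norm c * weighted_mod \<alpha> f z"
  by (simp add: weighted_mod_def norm_mult)

lemma fock_mass_add_le:
  assumes "f holomorphic_on UNIV" "g holomorphic_on UNIV" and p: "0 \<le> p"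
  shows "fock_mass p \<alpha> (\<lambda>z. f z + g z) \<le> ennreal (2 powr p) * (fock_mass p \<alpha> f + fock_mass p \<alpha> g)"
proof -
  note [measurable] = assms(1,2)[THEN measurable_fock_density(1)]
  have "fock_mass p \<alpha> (\<lambda>z. f z + g z) \<le>
    (\<integral>\<^sup>+ z. ennreal (2 powr p) * (ennreal (fock_density p \<alpha> f z) + ennreal (fock_density p \<alpha> g z)) \<partial>lborel)"
    unfolding fock_mass_def
  proof (intro nn_integral_mono)
    fix z
    have "fock_density p \<alpha> (\<lambda>z. f z + g z) z \<le> (weighted_mod \<alpha> f z + weighted_mod \<alpha> g z) powr p"
      unfolding fock_density_eq_weighted_mod using p by (intro powr_mono2 weighted_mod_add_le) auto
    also have "\<dots> \<le> 2 powr p * (fock_density p \<alpha> f z + fock_density p \<alpha> g z)"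
      unfolding fock_density_eq_weighted_mod using p by (intro powr_add_le) auto
    finally show "ennreal (fock_density p \<alpha> (\<lambda>z. f z + g z) z) \<le>
      ennreal (2 powr p) * (ennreal (fock_density p \<alpha> f z) + ennreal (fock_density p \<alpha> g z))"
      by (simp add: fock_density_eq_weighted_mod ennreal_leI flip: ennreal_plus ennreal_mult)
  qed
  also have "\<dots> = ennreal (2 powr p) * (fock_mass p \<alpha> f + fock_mass p \<alpha> g)"
    by (simp add: fock_mass_def nn_integral_cmult nn_integral_add)
  finally show ?thesis .
qed

lemma fock_mass_cmult:
  assumes "f holomorphic_on UNIV"
  shows "fock_mass p \<alpha> (\<lambda>z. c * f z) = ennreal (norm c powr p) * fock_mass p \<alpha> f"
proof -
  note [measurable] = assms[THEN measurable_fock_density(1)] assms[THEN measurable_fock_density(2)]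
  show ?thesis
    unfolding fock_mass_def
    by (subst nn_integral_cmult[symmetric]) (auto simp: fock_density_eq_weighted_mod weighted_mod_cmult powr_mult simp flip: ennreal_mult)
qed

lemma fock_space_cmult:
  "f \<in> fock_space p \<alpha> \<Longrightarrow> (\<lambda>z. c * f z) \<in> fock_space p \<alpha>"
  by (auto simp: fock_space_iff_fock_mass fock_mass_cmult ennreal_mult_less_top intro!: holomorphic_intros)

lemma fock_space_add:
  assumes "f \<in> fock_space p \<alpha>" "g \<in> fock_space p \<alpha>" "0 \<le> p"
  shows "(\<lambda>z. f z + g z) \<in> fock_space p \<alpha>"
proof -
  have "fock_mass p \<alpha> (\<lambda>z. f z + g z) \<le> ennreal (2 powr p) * (fock_mass p \<alpha> f + fock_mass p \<alpha> g)"
    using assms by (intro fock_mass_add_le) (auto simp: fock_space_iff_fock_mass)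
  also have "\<dots> < \<infinity>"
    using assms by (auto simp: fock_space_iff_fock_mass ennreal_mult_less_top)
  finally show ?thesis
    using assms by (auto simp: fock_space_iff_fock_mass intro!: holomorphic_intros)
qed

lemma fock_space_diff:
  assumes "f \<in> fock_space p \<alpha>" "g \<in> fock_space p \<alpha>" "0 \<le> p"
  shows "(\<lambda>z. f z - g z) \<in> fock_space p \<alpha>"
  using fock_space_add[OF assms(1) fock_space_cmult[OF assms(2), of "-1"] assms(3)] by simp

lemma fock_space_zero: "(\<lambda>_. 0) \<in> fock_space p \<alpha>"
  by (simp add: fock_space_iff_fock_mass fock_mass_def fock_density_def)

lemma fock_norm_cmult:
  assumes f: "f \<in> fock_space p \<alpha>" and p: "0 < p" and \<alpha>: "0 < \<alpha>"
  shows "fock_norm p \<alpha> (\<lambda>z. c * f z) = norm c * fock_norm p \<alpha> f"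
proof -
  have "ennreal (2 * pi / (p * \<alpha>) * fock_norm p \<alpha> (\<lambda>z. c * f z) powr p)
      = ennreal (2 * pi / (p * \<alpha>) * (norm c * fock_norm p \<alpha> f) powr p)"
    using f p \<alpha> fock_mass_cmult[of f p \<alpha> c]
    by (simp add: fock_mass_eq_fock_norm fock_space_cmult fock_space_iff_fock_mass[of f] powr_mult mult_ac
             flip: ennreal_mult)
  then have "fock_norm p \<alpha> (\<lambda>z. c * f z) powr p = (norm c * fock_norm p \<alpha> f) powr p"
    using p \<alpha> by (simp add: divide_simps)
  then have "(fock_norm p \<alpha> (\<lambda>z. c * f z) powr p) powr (1 / p) = ((norm c * fock_norm p \<alpha> f) powr p) powr (1 / p)"
    by simp
  then show ?thesis using p by (simp add: powr_powr)
qed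

text \<open>Only a quasi-triangle inequality: the constant 4 is harmless for two-sided estimates.\<close>
lemma fock_norm_add_le:
  assumes f: "f \<in> fock_space p \<alpha>" and g: "g \<in> fock_space p \<alpha>" and p: "1 \<le> p" and \<alpha>: "0 < \<alpha>"
  shows "fock_norm p \<alpha> (\<lambda>z. f z + g z) \<le> 4 * (fock_norm p \<alpha> f + fock_norm p \<alpha> g)"
proof (rule fock_norm_le_of_fock_mass)
  let ?a = "fock_norm p \<alpha> f" and ?b = "fock_norm p \<alpha> g"
  have "fock_mass p \<alpha> (\<lambda>z. f z + g z) \<le> ennreal (2 powr p) * (fock_mass p \<alpha> f + fock_mass p \<alpha> g)"
    using f g p by (intro fock_mass_add_le) (auto simp: fock_space_iff_fock_mass)
  also have "\<dots> = ennreal (2 powr p * (2 * pi / (p * \<alpha>) * ?a powr p + 2 * pi / (p * \<alpha>) * ?b powr p))"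
    using f g p \<alpha> by (simp add: fock_mass_eq_fock_norm flip: ennreal_plus ennreal_mult)
  also have "\<dots> \<le> ennreal (2 * pi / (p * \<alpha>) * (4 * (?a + ?b)) powr p)"
  proof (rule ennreal_leI)
    have "?a powr p \<le> (?a + ?b) powr p" "?b powr p \<le> (?a + ?b) powr p"
      using p by (auto intro!: powr_mono2)
    then have "?a powr p + ?b powr p \<le> 2 * (?a + ?b) powr p" by simp
    also have "\<dots> \<le> 2 powr p * (?a + ?b) powr p"
      using p powr_mono[of 1 p 2] by (intro mult_right_mono) auto
    finally have "2 powr p * (?a powr p + ?b powr p) \<le> 2 powr p * (2 powr p * (?a + ?b) powr p)"
      by simp
    also have "\<dots> = (4 * (?a + ?b)) powr p"
      using powr_mult[of 2 2 p] powr_mult[of 4 "?a + ?b" p] by (simp only: mult.assoc[symmetric]) simp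
    finally have "2 * pi / (p * \<alpha>) * (2 powr p * (?a powr p + ?b powr p)) \<le> 2 * pi / (p * \<alpha>) * (4 * (?a + ?b)) powr p"
      using p \<alpha> by (intro mult_left_mono) auto
    then show "2 powr p * (2 * pi / (p * \<alpha>) * ?a powr p + 2 * pi / (p * \<alpha>) * ?b powr p) \<le>
      2 * pi / (p * \<alpha>) * (4 * (?a + ?b)) powr p"
      by (simp add: algebra_simps)
  qed
  finally show "fock_mass p \<alpha> (\<lambda>z. f z + g z) \<le> ennreal (2 * pi / (p * \<alpha>) * (4 * (?a + ?b)) powr p)" .
qed (use fock_space_add[OF f g] p \<alpha> in auto)

lemma fock_norm_diff_le:
  assumes f: "f \<in> fock_space p \<alpha>" and g: "g \<in> fock_space p \<alpha>" and p: "1 \<le> p" and \<alpha>: "0 < \<alpha>"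
  shows "fock_norm p \<alpha> (\<lambda>z. f z - g z) \<le> 4 * (fock_norm p \<alpha> f + fock_norm p \<alpha> g)"
  using fock_norm_add_le[OF f fock_space_cmult[OF g, of "-1"] p \<alpha>] fock_norm_cmult[OF g _ \<alpha>, of "-1"] p
  by simp

definition eval_const :: "real \<Rightarrow> real \<Rightarrow> real" where
  "eval_const p \<alpha> = (disc_const p \<alpha> * (2 * pi / (p * \<alpha>))) powr (1 / p)"

lemma eval_const_pos: "0 < p \<Longrightarrow> 0 < \<alpha> \<Longrightarrow> 0 < eval_const p \<alpha>"
  using disc_const_pos[of \<alpha> p] by (simp add: eval_const_def)

lemma fock_pointwise_le_norm:
  assumes f: "f \<in> fock_space p \<alpha>" and p: "1 \<le> p" and \<alpha>: "0 < \<alpha>"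
  shows "weighted_mod \<alpha> f z \<le> eval_const p \<alpha> * fock_norm p \<alpha> f"
    and "weighted_mod \<alpha> (deriv f) z / (1 + norm z) \<le> eval_const p \<alpha> * fock_norm p \<alpha> f"
proof -
  let ?N = "fock_norm p \<alpha> f"
  have hol: "f holomorphic_on UNIV" using f by (simp add: fock_space_def)
  have "disc_mass p \<alpha> f z \<le> fock_mass p \<alpha> f"
    unfolding disc_mass_def fock_mass_def by (intro nn_integral_mono) (auto simp: indicator_def)
  also have "\<dots> = ennreal (2 * pi / (p * \<alpha>) * ?N powr p)"
    using p by (intro fock_mass_eq_fock_norm f \<alpha>) auto
  finally have "ennreal (disc_const p \<alpha>) * disc_mass p \<alpha> f z \<le> ennreal (disc_const p \<alpha>) * ennreal (2 * pi / (p * \<alpha>) * ?N powr p)"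
    by (intro mult_left_mono) auto
  also have "\<dots> = ennreal (disc_const p \<alpha> * (2 * pi / (p * \<alpha>) * ?N powr p))"
    using disc_const_pos[OF \<alpha>, of p] p \<alpha> by (intro ennreal_mult[symmetric]) auto
  finally have D: "ennreal (disc_const p \<alpha>) * disc_mass p \<alpha> f z \<le> ennreal (disc_const p \<alpha> * (2 * pi / (p * \<alpha>) * ?N powr p))" .
  have root: "x \<le> eval_const p \<alpha> * ?N"
    if "0 \<le> x" and "ennreal (x powr p) \<le> ennreal (disc_const p \<alpha>) * disc_mass p \<alpha> f z" for x
  proof -
    have "x powr p \<le> disc_const p \<alpha> * (2 * pi / (p * \<alpha>)) * ?N powr p"
      using order_trans[OF that(2) D] disc_const_pos[OF \<alpha>, of p] p \<alpha> by (simp add: mult.assoc)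
    then have "(x powr p) powr (1 / p) \<le> (disc_const p \<alpha> * (2 * pi / (p * \<alpha>)) * ?N powr p) powr (1 / p)"
      using p by (intro powr_mono2) auto
    also have "\<dots> = eval_const p \<alpha> * ?N"
      using p \<alpha> disc_const_pos[OF \<alpha>, of p] unfolding eval_const_def by (subst powr_mult) (auto simp: powr_powr)
    finally show ?thesis using that(1) p by (simp add: powr_powr)
  qed
  show "weighted_mod \<alpha> f z \<le> eval_const p \<alpha> * ?N"
    using fock_pointwise_le_disc_mass(1)[OF hol p \<alpha>] by (intro root) (auto simp: fock_density_eq_weighted_mod)
  show "weighted_mod \<alpha> (deriv f) z / (1 + norm z) \<le> eval_const p \<alpha> * ?N"
    using fock_pointwise_le_disc_mass(2)[OF hol p \<alpha>] by (intro root) auto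
qed

definition embedding_const :: "real \<Rightarrow> real \<Rightarrow> real \<Rightarrow> real" where
  "embedding_const p q \<alpha> = eval_const p \<alpha> powr (q - p) * (2 * pi / (p * \<alpha>))"

lemma embedding_const_pos: "1 \<le> p \<Longrightarrow> 0 < \<alpha> \<Longrightarrow> 0 < embedding_const p q \<alpha>"
  using eval_const_pos[of p \<alpha>] by (simp add: embedding_const_def)

text \<open>The inclusion of the Fock space with exponent p in the one with exponent q \<ge> p: point
evaluations control q - p of the q factors.\<close>
lemma fock_mass_le_fock_norm_powr:
  assumes f: "f \<in> fock_space p \<alpha>" and p: "1 \<le> p" "p \<le> q" and \<alpha>: "0 < \<alpha>"
  shows "fock_mass q \<alpha> f \<le> ennreal (embedding_const p q \<alpha> * fock_norm p \<alpha> f powr q)"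
proof -
  let ?N = "fock_norm p \<alpha> f"
  have hol: "f holomorphic_on UNIV" using f by (simp add: fock_space_def)
  note [measurable] = hol[THEN measurable_fock_density(1)]
  have c: "0 < eval_const p \<alpha>" using eval_const_pos p \<alpha> by simp
  have "fock_mass q \<alpha> f \<le> (\<integral>\<^sup>+ z. ennreal ((eval_const p \<alpha> * ?N) powr (q - p)) * ennreal (fock_density p \<alpha> f z) \<partial>lborel)"
    unfolding fock_mass_def
  proof (intro nn_integral_mono)
    fix z
    have "fock_density q \<alpha> f z = weighted_mod \<alpha> f z powr (q - p) * weighted_mod \<alpha> f z powr p"
      by (simp add: fock_density_eq_weighted_mod flip: powr_add)
    also have "\<dots> \<le> (eval_const p \<alpha> * ?N) powr (q - p) * fock_density p \<alpha> f z"
      unfolding fock_density_eq_weighted_mod using p fock_pointwise_le_norm(1)[OF f p(1) \<alpha>]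
      by (intro mult_right_mono powr_mono2) auto
    finally show "ennreal (fock_density q \<alpha> f z) \<le> ennreal ((eval_const p \<alpha> * ?N) powr (q - p)) * ennreal (fock_density p \<alpha> f z)"
      by (simp add: ennreal_leI fock_density_eq_weighted_mod flip: ennreal_mult)
  qed
  also have "\<dots> = ennreal ((eval_const p \<alpha> * ?N) powr (q - p)) * fock_mass p \<alpha> f"
    unfolding fock_mass_def by (rule nn_integral_cmult) simp
  also have "\<dots> = ennreal ((eval_const p \<alpha> * ?N) powr (q - p) * (2 * pi / (p * \<alpha>) * ?N powr p))"
    using p \<alpha> by (subst fock_mass_eq_fock_norm[OF f]) (auto simp flip: ennreal_mult)
  also have "(eval_const p \<alpha> * ?N) powr (q - p) * (2 * pi / (p * \<alpha>) * ?N powr p) = embedding_const p q \<alpha> * ?N powr q"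
  proof -
    have "?N powr (q - p) * ?N powr p = ?N powr q" by (simp flip: powr_add)
    then show ?thesis using c by (simp add: embedding_const_def powr_mult)
  qed
  finally show ?thesis .
qed

section \<open>Operator norms and the measure behind the Berezin transform\<close>

lemma fock_norm_zero [simp]: "fock_norm p \<alpha> (\<lambda>_. 0) = 0"
  by (simp add: fock_norm_def fock_density_def)

lemma fock_bounded_diff_bound:
  assumes T: "fock_bounded p q \<alpha> T" and K: "fock_bounded p q \<alpha> K" and q: "1 \<le> q" and \<alpha>: "0 < \<alpha>"
  shows "\<exists>C\<ge>0. \<forall>f\<in>fock_space p \<alpha>. (\<lambda>z. T f z - K f z) \<in> fock_space q \<alpha> \<and>
    fock_norm q \<alpha> (\<lambda>z. T f z - K f z) \<le> C * fock_norm p \<alpha> f"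
proof -
  obtain C1 C2 where C1: "\<And>f. f \<in> fock_space p \<alpha> \<Longrightarrow> fock_norm q \<alpha> (T f) \<le> C1 * fock_norm p \<alpha> f"
    and C2: "\<And>f. f \<in> fock_space p \<alpha> \<Longrightarrow> fock_norm q \<alpha> (K f) \<le> C2 * fock_norm p \<alpha> f"
    using T K by (auto simp: fock_bounded_def)
  have sp: "T f \<in> fock_space q \<alpha>" "K f \<in> fock_space q \<alpha>" if "f \<in> fock_space p \<alpha>" for f
    using T K that by (auto simp: fock_bounded_def fock_linear_def)
  show ?thesis
  proof (intro exI[of _ "\<bar>4 * (C1 + C2)\<bar>"] conjI ballI)
    show "0 \<le> \<bar>4 * (C1 + C2)\<bar>" by simp
    fix f assume f: "f \<in> fock_space p \<alpha>"
    show "(\<lambda>z. T f z - K f z) \<in> fock_space q \<alpha>"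
      using sp[OF f] q by (intro fock_space_diff) auto
    have "fock_norm q \<alpha> (\<lambda>z. T f z - K f z) \<le> 4 * (fock_norm q \<alpha> (T f) + fock_norm q \<alpha> (K f))"
      using sp[OF f] q \<alpha> by (intro fock_norm_diff_le)
    also have "\<dots> \<le> 4 * (C1 * fock_norm p \<alpha> f + C2 * fock_norm p \<alpha> f)"
      using C1[OF f] C2[OF f] by simp
    also have "\<dots> \<le> \<bar>4 * (C1 + C2)\<bar> * fock_norm p \<alpha> f"
      using mult_right_mono[OF abs_ge_self[of "4 * (C1 + C2)"] fock_norm_nonneg[of p \<alpha> f]]
      by (simp add: algebra_simps)
    finally show "fock_norm q \<alpha> (\<lambda>z. T f z - K f z) \<le> \<bar>4 * (C1 + C2)\<bar> * fock_norm p \<alpha> f" .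
  qed
qed

text \<open>A bound for T is required because the supremum over an unbounded set of reals carries no information.\<close>
lemma fock_opnorm_upper:
  assumes "f \<in> fock_space p \<alpha>" "fock_norm p \<alpha> f \<le> 1" and C: "0 \<le> C"
    and bound: "\<And>f. f \<in> fock_space p \<alpha> \<Longrightarrow> fock_norm q \<alpha> (T f) \<le> C * fock_norm p \<alpha> f"
  shows "fock_norm q \<alpha> (T f) \<le> fock_opnorm p q \<alpha> T"
  unfolding fock_opnorm_def
proof (rule cSUP_upper)
  show "bdd_above ((\<lambda>f. fock_norm q \<alpha> (T f)) ` {f \<in> fock_space p \<alpha>. fock_norm p \<alpha> f \<le> 1})"
  proof (rule bdd_aboveI2)
    fix f assume f: "f \<in> {f \<in> fock_space p \<alpha>. fock_norm p \<alpha> f \<le> 1}"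
    then have "fock_norm q \<alpha> (T f) \<le> C * fock_norm p \<alpha> f" using bound by auto
    also have "\<dots> \<le> C * 1" using f C by (intro mult_left_mono) auto
    finally show "fock_norm q \<alpha> (T f) \<le> C" by simp
  qed
qed (use assms in auto)

lemma fock_opnorm_least:
  assumes "\<And>f. f \<in> fock_space p \<alpha> \<Longrightarrow> fock_norm p \<alpha> f \<le> 1 \<Longrightarrow> fock_norm q \<alpha> (T f) \<le> C"
  shows "fock_opnorm p q \<alpha> T \<le> C"
  unfolding fock_opnorm_def
proof (rule cSUP_least)
  have "(\<lambda>_. 0) \<in> {f \<in> fock_space p \<alpha>. fock_norm p \<alpha> f \<le> 1}"
    using fock_space_zero by simp
  then show "{f \<in> fock_space p \<alpha>. fock_norm p \<alpha> f \<le> 1} \<noteq> {}" by blast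
qed (use assms in auto)

lemma fock_opnorm_diff_upper:
  assumes T: "fock_bounded p q \<alpha> T" and K: "fock_bounded p q \<alpha> K" and q: "1 \<le> q" and \<alpha>: "0 < \<alpha>"
    and f: "f \<in> fock_space p \<alpha>" "fock_norm p \<alpha> f \<le> 1"
  shows "fock_norm q \<alpha> (\<lambda>z. T f z - K f z) \<le> fock_opnorm p q \<alpha> (\<lambda>f z. T f z - K f z)"
proof -
  obtain C where C: "0 \<le> C"
    "\<forall>f\<in>fock_space p \<alpha>. (\<lambda>z. T f z - K f z) \<in> fock_space q \<alpha> \<and>
      fock_norm q \<alpha> (\<lambda>z. T f z - K f z) \<le> C * fock_norm p \<alpha> f"
    using fock_bounded_diff_bound[OF T K q \<alpha>] by auto
  show ?thesis
    by (rule fock_opnorm_upper[OF f C(1), where T = "\<lambda>f z. T f z - K f z"]) (use C(2) in simp)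
qed

lemma fock_opnorm_diff_nonneg:
  assumes "fock_bounded p q \<alpha> T" "fock_bounded p q \<alpha> K" "1 \<le> q" "0 < \<alpha>"
  shows "0 \<le> fock_opnorm p q \<alpha> (\<lambda>f z. T f z - K f z)"
proof -
  have "fock_norm p \<alpha> (\<lambda>_. 0) \<le> 1" by simp
  from order_trans[OF fock_norm_nonneg fock_opnorm_diff_upper[OF assms fock_space_zero this]] show ?thesis .
qed

lemma fock_essnorm_le:
  assumes T: "fock_bounded p q \<alpha> T" and K: "fock_compact p q \<alpha> K" and q: "1 \<le> q" and \<alpha>: "0 < \<alpha>"
  shows "fock_essnorm p q \<alpha> T \<le> fock_opnorm p q \<alpha> (\<lambda>f z. T f z - K f z)"
  unfolding fock_essnorm_def
proof (rule cINF_lower)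
  show "bdd_below ((\<lambda>K. fock_opnorm p q \<alpha> (\<lambda>f z. T f z - K f z)) ` {K. fock_compact p q \<alpha> K})"
    using fock_opnorm_diff_nonneg[OF T _ q \<alpha>] by (intro bdd_belowI2[of _ 0]) (auto simp: fock_compact_def)
qed (use K in auto)

lemma volterra_op_facts:
  assumes f: "f holomorphic_on UNIV" and g: "g holomorphic_on UNIV" and \<psi>: "\<psi> holomorphic_on UNIV"
  shows "(volterra_op g \<psi> f has_field_derivative f (\<psi> z) * deriv g z) (at z)"
    and "volterra_op g \<psi> f 0 = 0"
proof -
  define h where "h w = f (\<psi> w) * deriv g w" for w
  have h: "h holomorphic_on UNIV"
    unfolding h_def using f g \<psi>
    by (intro holomorphic_on_mult holomorphic_deriv holomorphic_on_compose_gen[OF \<psi> f, unfolded o_def]) auto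
  obtain P where P: "\<And>x. (P has_field_derivative h x) (at x)"
    using holomorphic_convex_primitive'[OF convex_UNIV open_UNIV h] by auto
  have "(h has_contour_integral (P (pathfinish (linepath 0 z)) - P (pathstart (linepath 0 z)))) (linepath 0 z)" for z
    by (rule contour_integral_primitive[of UNIV P, OF _ valid_path_linepath]) (use P in auto)
  then have V: "volterra_op g \<psi> f = (\<lambda>z. P z - P 0)"
    unfolding volterra_op_def h_def[symmetric] by (auto simp: contour_integral_unique)
  show "(volterra_op g \<psi> f has_field_derivative f (\<psi> z) * deriv g z) (at z)"
    unfolding V using P[of z] by (auto intro!: derivative_eq_intros simp: h_def)
  show "volterra_op g \<psi> f 0 = 0" unfolding V by simp
qed

lemma volterra_op_holomorphic:
  assumes "f holomorphic_on UNIV" "g holomorphic_on UNIV" "\<psi> holomorphic_on UNIV"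
  shows "volterra_op g \<psi> f holomorphic_on UNIV"
  using volterra_op_facts(1)[OF assms] by (auto simp: holomorphic_on_open)

text \<open>The density of the measure on the plane for which the L^q-norm of f \<circ> \<psi> is comparable to the
norm of V f.\<close>
definition symbol_weight :: "real \<Rightarrow> real \<Rightarrow> (complex \<Rightarrow> complex) \<Rightarrow> complex \<Rightarrow> real" where
  "symbol_weight q \<alpha> g z = (weighted_mod \<alpha> (deriv g) z / (1 + norm z)) powr q"

lemma symbol_weight_nonneg [simp]: "0 \<le> symbol_weight q \<alpha> g z"
  by (simp add: symbol_weight_def)

lemma measurable_symbol_weight:
  assumes "g holomorphic_on UNIV"
  shows "symbol_weight q \<alpha> g \<in> borel_measurable borel"
proof -
  have "deriv g holomorphic_on UNIV" using assms by (intro holomorphic_deriv) auto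
  note [measurable] = measurable_fock_density(2)[OF this]
  show ?thesis unfolding symbol_weight_def by measurable
qed

lemma deriv_mass_volterra_op:
  assumes "f holomorphic_on UNIV" "g holomorphic_on UNIV" "\<psi> holomorphic_on UNIV"
  shows "deriv_mass q \<alpha> (volterra_op g \<psi> f) =
    (\<integral>\<^sup>+ z. ennreal (norm (f (\<psi> z)) powr q * symbol_weight q \<alpha> g z) \<partial>lborel)"
proof -
  have "deriv (volterra_op g \<psi> f) z = f (\<psi> z) * deriv g z" for z
    using volterra_op_facts(1)[OF assms] by (rule DERIV_imp_deriv)
  then have "(weighted_mod \<alpha> (deriv (volterra_op g \<psi> f)) z / (1 + norm z)) powr q
      = norm (f (\<psi> z)) powr q * symbol_weight q \<alpha> g z" for z
    by (simp add: weighted_mod_def symbol_weight_def norm_mult mult.assoc flip: powr_mult)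
  then show ?thesis by (simp add: deriv_mass_def)
qed

text \<open>Completing the square displays the Berezin transform at w as a Gaussian average, centred at w, over
the values \<psi>(z).\<close>
lemma berezin_eq:
  "berezin q \<alpha> \<psi> g w =
    (\<integral>\<^sup>+ z. ennreal (exp (q * \<alpha> / 2 * ((norm (\<psi> z))\<^sup>2 - (norm (\<psi> z - w))\<^sup>2)) * symbol_weight q \<alpha> g z) \<partial>lborel)"
proof -
  have "exp (q * \<alpha> / 2 * (2 * Re (\<psi> z * cnj w) - (norm z)\<^sup>2 - (norm w)\<^sup>2)) *
        (norm (deriv g z) powr q / (1 + norm z) powr q)
     = exp (q * \<alpha> / 2 * ((norm (\<psi> z))\<^sup>2 - (norm (\<psi> z - w))\<^sup>2)) * symbol_weight q \<alpha> g z" for z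
  proof -
    have "(norm (\<psi> z))\<^sup>2 - (norm (\<psi> z - w))\<^sup>2 = 2 * Re (\<psi> z * cnj w) - (norm w)\<^sup>2"
      unfolding cmod_power2 by (simp add: algebra_simps power2_eq_square)
    moreover have "exp (q * \<alpha> / 2 * (2 * Re (\<psi> z * cnj w) - (norm z)\<^sup>2 - (norm w)\<^sup>2))
      = exp (q * \<alpha> / 2 * (2 * Re (\<psi> z * cnj w) - (norm w)\<^sup>2)) * exp (- (\<alpha> / 2) * (norm z)\<^sup>2) powr q"
      by (simp add: exp_powr_real algebra_simps flip: exp_add)
    ultimately show ?thesis
      by (simp add: symbol_weight_def weighted_mod_def powr_mult powr_divide)
  qed
  then show ?thesis by (simp add: berezin_def)
qed

text \<open>Each value |h(\<psi>(z))|^q is bounded by the mass of h near \<psi>(z). After Fubini the mass of h near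
u is multiplied by the measure of the set |\<psi>(z) - u| < 1, on which the Gaussian in the Berezin
transform at u is at least e^(-q \<alpha> / 2). Only points u with |u| > R - 1 occur.\<close>
lemma carleson_estimate_outside_disc:
  assumes h: "h holomorphic_on UNIV" and g: "g holomorphic_on UNIV" and \<psi>: "\<psi> holomorphic_on UNIV"
    and q: "1 \<le> q" and \<alpha>: "0 < \<alpha>" and S: "0 \<le> S"
    and le: "\<And>u. R - 1 < norm u \<Longrightarrow> berezin q \<alpha> \<psi> g u \<le> ennreal S"
  shows "(\<integral>\<^sup>+ z. ennreal (norm (h (\<psi> z)) powr q * symbol_weight q \<alpha> g z) * indicator {z. R < norm (\<psi> z)} z \<partial>lborel)
    \<le> ennreal (disc_const q \<alpha> * exp (q * \<alpha> / 2) * S) * fock_mass q \<alpha> h"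
proof -
  have [measurable]: "\<psi> \<in> borel_measurable borel"
    using \<psi> by (intro borel_measurable_continuous_onI holomorphic_on_imp_continuous_on)
  note [measurable] = measurable_symbol_weight[OF g] measurable_fock_density[OF h]
  have pt: "0 \<le> disc_const q \<alpha>" using disc_const_pos[OF \<alpha>, of q] by simp
  define w where "w z = ennreal (disc_const q \<alpha>) * ennreal (exp (q * \<alpha> / 2 * (norm (\<psi> z))\<^sup>2) * symbol_weight q \<alpha> g z)
     * indicator {z. R < norm (\<psi> z)} z" for z
  have [measurable]: "w \<in> borel_measurable borel" unfolding w_def by measurable
  have "(\<integral>\<^sup>+ z. ennreal (norm (h (\<psi> z)) powr q * symbol_weight q \<alpha> g z) * indicator {z. R < norm (\<psi> z)} z \<partial>lborel)
    \<le> (\<integral>\<^sup>+ z. disc_mass q \<alpha> h (\<psi> z) * w z \<partial>lborel)"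
  proof (intro nn_integral_mono)
    fix z
    let ?e = "exp (q * \<alpha> / 2 * (norm (\<psi> z))\<^sup>2)"
    have "norm (h (\<psi> z)) powr q = fock_density q \<alpha> h (\<psi> z) * ?e"
      by (simp add: fock_density_def algebra_simps flip: exp_add)
    then have "ennreal (norm (h (\<psi> z)) powr q * symbol_weight q \<alpha> g z)
      = ennreal (fock_density q \<alpha> h (\<psi> z)) * ennreal (?e * symbol_weight q \<alpha> g z)"
      by (simp add: fock_density_eq_weighted_mod mult.assoc flip: ennreal_mult)
    also have "\<dots> \<le> ennreal (disc_const q \<alpha>) * disc_mass q \<alpha> h (\<psi> z) * ennreal (?e * symbol_weight q \<alpha> g z)"
      by (intro mult_right_mono fock_pointwise_le_disc_mass h q \<alpha>) auto
    finally show "ennreal (norm (h (\<psi> z)) powr q * symbol_weight q \<alpha> g z) * indicator {z. R < norm (\<psi> z)} z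
      \<le> disc_mass q \<alpha> h (\<psi> z) * w z"
      by (auto simp: w_def mult_ac indicator_def)
  qed
  also have "\<dots> = (\<integral>\<^sup>+ u. ennreal (fock_density q \<alpha> h u) * (\<integral>\<^sup>+ z. indicator (ball u 1) (\<psi> z) * w z \<partial>lborel) \<partial>lborel)"
    by (rule nn_integral_disc_mass_weighted[OF h]) measurable
  also have "\<dots> \<le> (\<integral>\<^sup>+ u. ennreal (fock_density q \<alpha> h u) * ennreal (disc_const q \<alpha> * exp (q * \<alpha> / 2) * S) \<partial>lborel)"
  proof (intro nn_integral_mono mult_left_mono)
    fix u
    show "(\<integral>\<^sup>+ z. indicator (ball u 1) (\<psi> z) * w z \<partial>lborel) \<le> ennreal (disc_const q \<alpha> * exp (q * \<alpha> / 2) * S)"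
    proof (cases "R - 1 < norm u")
      case True
      have "(\<integral>\<^sup>+ z. indicator (ball u 1) (\<psi> z) * w z \<partial>lborel) \<le> (\<integral>\<^sup>+ z. ennreal (disc_const q \<alpha> * exp (q * \<alpha> / 2)) *
         ennreal (exp (q * \<alpha> / 2 * ((norm (\<psi> z))\<^sup>2 - (norm (\<psi> z - u))\<^sup>2)) * symbol_weight q \<alpha> g z) \<partial>lborel)"
      proof (intro nn_integral_mono)
        fix z
        show "indicator (ball u 1) (\<psi> z) * w z \<le> ennreal (disc_const q \<alpha> * exp (q * \<alpha> / 2)) *
         ennreal (exp (q * \<alpha> / 2 * ((norm (\<psi> z))\<^sup>2 - (norm (\<psi> z - u))\<^sup>2)) * symbol_weight q \<alpha> g z)"
        proof (cases "\<psi> z \<in> ball u 1 \<and> R < norm (\<psi> z)")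
          case True
          then have "(norm (\<psi> z - u))\<^sup>2 \<le> 1"
            by (auto simp: dist_norm norm_minus_commute abs_square_le_1)
          then have "exp (q * \<alpha> / 2 * (norm (\<psi> z))\<^sup>2)
             \<le> exp (q * \<alpha> / 2 * (1 + ((norm (\<psi> z))\<^sup>2 - (norm (\<psi> z - u))\<^sup>2)))"
            using q \<alpha> by (subst exp_le_cancel_iff, intro mult_left_mono) auto
          also have "\<dots> = exp (q * \<alpha> / 2) * exp (q * \<alpha> / 2 * ((norm (\<psi> z))\<^sup>2 - (norm (\<psi> z - u))\<^sup>2))"
            by (simp add: distrib_left flip: exp_add)
          finally have "disc_const q \<alpha> * (exp (q * \<alpha> / 2 * (norm (\<psi> z))\<^sup>2) * symbol_weight q \<alpha> g z)
             \<le> disc_const q \<alpha> * ((exp (q * \<alpha> / 2) * exp (q * \<alpha> / 2 * ((norm (\<psi> z))\<^sup>2 - (norm (\<psi> z - u))\<^sup>2))) * symbol_weight q \<alpha> g z)"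
            using pt by (intro mult_left_mono mult_right_mono) auto
          then show ?thesis
            using True pt by (simp add: w_def ennreal_leI mult.assoc flip: ennreal_mult)
        qed (auto simp: w_def)
      qed
      also have "\<dots> = ennreal (disc_const q \<alpha> * exp (q * \<alpha> / 2)) * berezin q \<alpha> \<psi> g u"
        unfolding berezin_eq by (rule nn_integral_cmult) measurable
      also have "\<dots> \<le> ennreal (disc_const q \<alpha> * exp (q * \<alpha> / 2)) * ennreal S"
        by (intro mult_left_mono le True) auto
      also have "\<dots> = ennreal (disc_const q \<alpha> * exp (q * \<alpha> / 2) * S)"
        using pt S by (intro ennreal_mult[symmetric]) auto
      finally show ?thesis .
    next
      case False
      have "indicator (ball u 1) (\<psi> z) * w z = 0" for z
      proof (cases "\<psi> z \<in> ball u 1")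
        case True
        then have "norm (\<psi> z) \<le> R"
          using False norm_triangle_ineq2[of "\<psi> z" u] by (auto simp: dist_norm norm_minus_commute)
        then show ?thesis by (simp add: w_def)
      qed auto
      then show ?thesis by (simp only: nn_integral_const mult_zero_left zero_le)
    qed
  qed auto
  also have "\<dots> = ennreal (disc_const q \<alpha> * exp (q * \<alpha> / 2) * S) * fock_mass q \<alpha> h"
    by (simp add: fock_mass_def nn_integral_multc mult.commute)
  finally show ?thesis .
qed

section \<open>Dilations and the upper estimate\<close>

definition dilate :: "real \<Rightarrow> (complex \<Rightarrow> complex) \<Rightarrow> complex \<Rightarrow> complex" where
  "dilate r f z = f (of_real r * z)"

lemma dilate_holomorphic:
  assumes "f holomorphic_on UNIV"
  shows "dilate r f holomorphic_on UNIV"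
  unfolding dilate_def
  by (rule holomorphic_on_compose_gen[OF _ assms, unfolded o_def]) (auto intro!: holomorphic_intros)

lemma fock_space_dilate:
  assumes f: "f \<in> fock_space p \<alpha>" and p: "1 \<le> p" and \<alpha>: "0 < \<alpha>" and r: "1 / 2 \<le> r" "r \<le> 1"
  shows "dilate r f \<in> fock_space p \<alpha>" and "fock_norm p \<alpha> (dilate r f) \<le> 4 * fock_norm p \<alpha> f"
proof -
  have hol: "f holomorphic_on UNIV" using f by (simp add: fock_space_def)
  note [measurable] = measurable_fock_density(1)[OF hol]
  have "fock_mass p \<alpha> (dilate r f) \<le> (\<integral>\<^sup>+ z. ennreal (fock_density p \<alpha> f (of_real r * z)) \<partial>lborel)"
    unfolding fock_mass_def
  proof (intro nn_integral_mono ennreal_leI)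
    fix z :: complex
    have "(r * norm z)\<^sup>2 \<le> (norm z)\<^sup>2"
      using r by (intro power_mono mult_left_le_one_le) auto
    then have "- (p * \<alpha> / 2) * (norm z)\<^sup>2 \<le> - (p * \<alpha> / 2) * (norm (of_real r * z))\<^sup>2"
      using p \<alpha> r by (simp add: norm_mult)
    then show "fock_density p \<alpha> (dilate r f) z \<le> fock_density p \<alpha> f (of_real r * z)"
      unfolding fock_density_def dilate_def by (intro mult_left_mono) auto
  qed
  also have "\<dots> = ennreal (1 / r\<^sup>2) * fock_mass p \<alpha> f"
    unfolding fock_mass_def using r
    by (intro nn_integral_complex_scale[where f = "\<lambda>z. ennreal (fock_density p \<alpha> f z)"]) auto
  also have "\<dots> \<le> ennreal 4 * fock_mass p \<alpha> f"
  proof (intro mult_right_mono ennreal_leI)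
    have "(1 / 2)\<^sup>2 \<le> r\<^sup>2" using r by (intro power_mono) auto
    then have "1 / r\<^sup>2 \<le> 1 / (1 / 2)\<^sup>2" using r by (intro divide_left_mono) auto
    then show "1 / r\<^sup>2 \<le> 4" by (simp add: power2_eq_square)
  qed auto
  finally have le: "fock_mass p \<alpha> (dilate r f) \<le> ennreal 4 * fock_mass p \<alpha> f" .
  then have "fock_mass p \<alpha> (dilate r f) < \<infinity>"
    using f by (auto simp: fock_space_iff_fock_mass ennreal_mult_less_top intro: le_less_trans)
  then show sp: "dilate r f \<in> fock_space p \<alpha>"
    using dilate_holomorphic[OF hol] by (simp add: fock_space_iff_fock_mass)
  let ?N = "fock_norm p \<alpha> f"
  have "ennreal 4 * fock_mass p \<alpha> f = ennreal (4 * (2 * pi / (p * \<alpha>) * ?N powr p))"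
    using p \<alpha> fock_mass_eq_fock_norm[OF f _ \<alpha>] by (subst ennreal_mult) auto
  also have "\<dots> \<le> ennreal (2 * pi / (p * \<alpha>) * (4 * ?N) powr p)"
  proof (rule ennreal_leI)
    have "4 * ?N powr p \<le> 4 powr p * ?N powr p"
      using p powr_mono[of 1 p 4] by (intro mult_right_mono) auto
    also have "\<dots> = (4 * ?N) powr p" by (rule powr_mult[symmetric])
    finally have "2 * pi / (p * \<alpha>) * (4 * ?N powr p) \<le> 2 * pi / (p * \<alpha>) * (4 * ?N) powr p"
      using p \<alpha> by (intro mult_left_mono) auto
    then show "4 * (2 * pi / (p * \<alpha>) * ?N powr p) \<le> 2 * pi / (p * \<alpha>) * (4 * ?N) powr p"
      by (simp add: mult_ac)
  qed
  finally show "fock_norm p \<alpha> (dilate r f) \<le> 4 * fock_norm p \<alpha> f"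
    using le p \<alpha> by (intro fock_norm_le_of_fock_mass[OF sp]) auto
qed

lemma fock_linear_diff:
  assumes T: "fock_linear p q \<alpha> T" and f: "f \<in> fock_space p \<alpha>" and h: "h \<in> fock_space p \<alpha>"
  shows "T (\<lambda>z. f z - h z) = (\<lambda>z. T f z - T h z)"
proof -
  have m: "(\<lambda>z. (-1) * h z) \<in> fock_space p \<alpha>" using h by (rule fock_space_cmult)
  have add: "T (\<lambda>z. f z + h z) = (\<lambda>z. T f z + T h z)"
    if "f \<in> fock_space p \<alpha>" "h \<in> fock_space p \<alpha>" for f h
    using T that by (simp add: fock_linear_def)
  have scale: "T (\<lambda>z. c * h z) = (\<lambda>z. c * T h z)" for c
    using T h by (simp add: fock_linear_def)
  have "T (\<lambda>z. f z + (-1) * h z) = (\<lambda>z. T f z + T (\<lambda>z. (-1) * h z) z)"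
    by (rule add[OF f m])
  also have "T (\<lambda>z. (-1) * h z) = (\<lambda>z. (-1) * T h z)"
    by (rule scale)
  finally show ?thesis by simp
qed

lemma fock_growth:
  assumes f: "f \<in> fock_space p \<alpha>" and p: "1 \<le> p" and \<alpha>: "0 < \<alpha>"
  shows "norm (f z) \<le> eval_const p \<alpha> * fock_norm p \<alpha> f * exp (\<alpha> / 2 * (norm z)\<^sup>2)"
    and "norm (deriv f z) \<le> eval_const p \<alpha> * fock_norm p \<alpha> f * (1 + norm z) * exp (\<alpha> / 2 * (norm z)\<^sup>2)"
proof -
  have e: "exp (- (\<alpha> / 2) * (norm z)\<^sup>2) * exp (\<alpha> / 2 * (norm z)\<^sup>2) = 1"
    by (simp flip: exp_add)
  have n: "norm (g z) = weighted_mod \<alpha> g z * exp (\<alpha> / 2 * (norm z)\<^sup>2)" for g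
    unfolding weighted_mod_def mult.assoc e by simp
  show "norm (f z) \<le> eval_const p \<alpha> * fock_norm p \<alpha> f * exp (\<alpha> / 2 * (norm z)\<^sup>2)"
    unfolding n[of f] by (intro mult_right_mono fock_pointwise_le_norm f p \<alpha>) auto
  have "weighted_mod \<alpha> (deriv f) z \<le> eval_const p \<alpha> * fock_norm p \<alpha> f * (1 + norm z)"
    using fock_pointwise_le_norm(2)[OF f p \<alpha>, of z] by (simp add: pos_divide_le_eq add_pos_nonneg)
  then show "norm (deriv f z) \<le> eval_const p \<alpha> * fock_norm p \<alpha> f * (1 + norm z) * exp (\<alpha> / 2 * (norm z)\<^sup>2)"
    unfolding n[of "deriv f"] by (intro mult_right_mono) auto
qed

text \<open>Dilating by r < 1 turns the critical growth e^(\<alpha> |z|^2 / 2) into a Gaussian with room to spare,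
which serves as an integrable majorant.\<close>
lemma fock_density_dilate_le:
  assumes B: "\<And>z. norm (f z) \<le> B * exp (\<alpha> / 2 * (norm z)\<^sup>2)" and p: "0 \<le> p" and B0: "0 \<le> B" and r: "0 \<le> r"
  shows "fock_density p \<alpha> (dilate r f) z \<le> B powr p * exp (- (p * \<alpha> / 2 * (1 - r\<^sup>2)) * (norm z)\<^sup>2)"
proof -
  have "weighted_mod \<alpha> (dilate r f) z \<le> B * exp (\<alpha> / 2 * (norm (of_real r * z))\<^sup>2) * exp (- (\<alpha> / 2) * (norm z)\<^sup>2)"
    unfolding weighted_mod_def dilate_def using B by (intro mult_right_mono) auto
  also have "\<dots> = B * exp (- (\<alpha> / 2 * (1 - r\<^sup>2)) * (norm z)\<^sup>2)"
    using r by (simp add: norm_mult power_mult_distrib algebra_simps flip: exp_add)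
  finally have "weighted_mod \<alpha> (dilate r f) z powr p \<le> (B * exp (- (\<alpha> / 2 * (1 - r\<^sup>2)) * (norm z)\<^sup>2)) powr p"
    using p by (intro powr_mono2) auto
  then show ?thesis
    by (simp add: fock_density_eq_weighted_mod powr_mult exp_powr_real mult_ac)
qed

lemma fock_norm_tendsto_0I:
  assumes u: "\<And>n. u n \<in> fock_space p \<alpha>" and p: "0 < p" and \<alpha>: "0 < \<alpha>"
    and lim: "(\<lambda>n :: nat. fock_mass p \<alpha> (u n)) \<longlonglongrightarrow> 0"
  shows "(\<lambda>n. fock_norm p \<alpha> (u n)) \<longlonglongrightarrow> 0"
proof -
  have "(\<lambda>n. ennreal (2 * pi / (p * \<alpha>) * fock_norm p \<alpha> (u n) powr p)) \<longlonglongrightarrow> 0"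
    using lim by (simp only: fock_mass_eq_fock_norm[OF u p \<alpha>])
  then have "(\<lambda>n. 2 * pi / (p * \<alpha>) * fock_norm p \<alpha> (u n) powr p) \<longlonglongrightarrow> 0"
    using p \<alpha> by (subst (asm) ennreal_tendsto_0_iff) auto
  then have "(\<lambda>n. p * \<alpha> / (2 * pi) * (2 * pi / (p * \<alpha>) * fock_norm p \<alpha> (u n) powr p)) \<longlonglongrightarrow> 0"
    by (rule tendsto_mult_right_zero)
  then have powr_lim: "(\<lambda>n. fock_norm p \<alpha> (u n) powr p) \<longlonglongrightarrow> 0"
    using p \<alpha> by simp
  have "(\<lambda>n. (fock_norm p \<alpha> (u n) powr p) powr (1 / p)) \<longlonglongrightarrow> 0"
    by (rule tendsto_zero_powrI[OF powr_lim tendsto_const]) (use p in auto)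
  then show ?thesis using p by (simp add: powr_powr)
qed

text \<open>A bounded sequence has uniformly controlled growth, so Montel's theorem gives a locally uniform limit
along a subsequence; after dilation the Gaussian majorant turns this into convergence in norm, which
the bounded operator T preserves.\<close>
lemma fock_compact_dilate:
  assumes T: "fock_bounded p q \<alpha> T" and p: "1 \<le> p" and \<alpha>: "0 < \<alpha>" and r: "1 / 2 \<le> r" "r < 1"
  shows "fock_compact p q \<alpha> (\<lambda>f. T (dilate r f))"
  unfolding fock_compact_def
proof (intro conjI allI impI)
  have lin: "fock_linear p q \<alpha> T" using T by (simp add: fock_bounded_def)
  obtain C where C: "\<And>f. f \<in> fock_space p \<alpha> \<Longrightarrow> fock_norm q \<alpha> (T f) \<le> C * fock_norm p \<alpha> f"
    using T by (auto simp: fock_bounded_def)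
  have sp: "dilate r f \<in> fock_space p \<alpha>" if "f \<in> fock_space p \<alpha>" for f
    using fock_space_dilate(1)[OF that p \<alpha>] r by simp
  show "fock_bounded p q \<alpha> (\<lambda>f. T (dilate r f))"
    unfolding fock_bounded_def
  proof (intro conjI exI ballI)
    have "dilate r (\<lambda>z. f z + h z) = (\<lambda>z. dilate r f z + dilate r h z)"
      "dilate r (\<lambda>z. c * f z) = (\<lambda>z. c * dilate r f z)" for f h c
      by (auto simp: dilate_def)
    then show "fock_linear p q \<alpha> (\<lambda>f. T (dilate r f))"
      using lin sp unfolding fock_linear_def by simp
    fix f assume f: "f \<in> fock_space p \<alpha>"
    have "fock_norm q \<alpha> (T (dilate r f)) \<le> C * fock_norm p \<alpha> (dilate r f)"
      by (rule C[OF sp[OF f]])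
    also have "\<dots> \<le> \<bar>C\<bar> * (4 * fock_norm p \<alpha> f)"
      using fock_space_dilate(2)[OF f p \<alpha>, of r] r by (intro mult_mono) auto
    finally show "fock_norm q \<alpha> (T (dilate r f)) \<le> (\<bar>C\<bar> * 4) * fock_norm p \<alpha> f" by simp
  qed
  fix F :: "nat \<Rightarrow> complex \<Rightarrow> complex"
  assume "(\<forall>n. F n \<in> fock_space p \<alpha>) \<and> (\<exists>M. \<forall>n. fock_norm p \<alpha> (F n) \<le> M)"
  then obtain M where F: "\<And>n. F n \<in> fock_space p \<alpha>" and M: "\<And>n. fock_norm p \<alpha> (F n) \<le> M" by blast
  define B where "B = eval_const p \<alpha> * M"
  have M0: "0 \<le> M" using order_trans[OF fock_norm_nonneg M] .
  have ec: "0 \<le> eval_const p \<alpha>" using eval_const_pos[of p \<alpha>] p \<alpha> by simp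
  have B: "0 \<le> B" using M0 ec by (simp add: B_def)
  have growth: "norm (F n z) \<le> B * exp (\<alpha> / 2 * (norm z)\<^sup>2)" for n z
  proof -
    have "eval_const p \<alpha> * fock_norm p \<alpha> (F n) \<le> B"
      unfolding B_def using ec M by (intro mult_left_mono)
    then show ?thesis
      using fock_growth(1)[OF F p \<alpha>, of n z] by (meson mult_right_mono exp_ge_zero order_trans)
  qed
  have Fhol: "F n holomorphic_on UNIV" for n using F by (simp add: fock_space_def)
  define \<H> where "\<H> = {h. h holomorphic_on UNIV \<and> (\<forall>z. norm (h z) \<le> B * exp (\<alpha> / 2 * (norm z)\<^sup>2))}"
  obtain g s where g: "g holomorphic_on UNIV" and s: "strict_mono (s :: nat \<Rightarrow> nat)"
    and lim: "\<And>x. x \<in> UNIV \<Longrightarrow> ((\<lambda>n. F (s n) x) \<longlongrightarrow> g x) sequentially"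
  proof (rule Montel[of UNIV \<H> F])
    show "\<exists>Q. \<forall>h\<in>\<H>. \<forall>z\<in>K. norm (h z) \<le> Q" if K: "compact K" for K
    proof -
      obtain \<rho> where \<rho>: "\<And>z. z \<in> K \<Longrightarrow> norm z \<le> \<rho>"
        using compact_imp_bounded[OF K] by (auto simp: bounded_iff)
      have "norm (h z) \<le> B * exp (\<alpha> / 2 * \<rho>\<^sup>2)" if h: "h \<in> \<H>" and z: "z \<in> K" for h z
      proof -
        have "norm (h z) \<le> B * exp (\<alpha> / 2 * (norm z)\<^sup>2)" using h by (simp add: \<H>_def)
        also have "\<dots> \<le> B * exp (\<alpha> / 2 * \<rho>\<^sup>2)"
          using \<rho>[OF z] \<alpha> B by (intro mult_left_mono) (auto intro!: power_mono)
        finally show ?thesis .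
      qed
      then show ?thesis by blast
    qed
  qed (use Fhol growth in \<open>auto simp: \<H>_def\<close>)
  have g_growth: "norm (g z) \<le> B * exp (\<alpha> / 2 * (norm z)\<^sup>2)" for z
    using tendsto_norm[OF lim[of z]] growth by (intro LIMSEQ_le_const2) auto
  have r2: "r\<^sup>2 < 1" using r by (simp add: abs_square_less_1)
  define W where "W A z = A powr p * exp (- (p * \<alpha> / 2 * (1 - r\<^sup>2)) * (norm z)\<^sup>2)" for A and z :: complex
  have W: "(\<integral>\<^sup>+ z. ennreal (W A z) \<partial>lborel) < \<infinity>" for A
  proof -
    have "(\<integral>\<^sup>+ z. ennreal (W A z) \<partial>lborel) = ennreal (A powr p) *
       (\<integral>\<^sup>+ z. ennreal (exp (- (p * \<alpha> / 2 * (1 - r\<^sup>2)) * (norm (z :: complex))\<^sup>2)) \<partial>lborel)"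
      unfolding W_def by (subst nn_integral_cmult[symmetric]) (auto simp flip: ennreal_mult)
    also have "\<dots> < \<infinity>"
      using nn_integral_complex_gaussian_finite[of "p * \<alpha> / 2 * (1 - r\<^sup>2)"] r2 p \<alpha>
      by (simp add: ennreal_mult_less_top)
    finally show ?thesis .
  qed
  have "fock_mass p \<alpha> (dilate r g) \<le> (\<integral>\<^sup>+ z. ennreal (W B z) \<partial>lborel)"
    unfolding fock_mass_def W_def using g_growth p B r
    by (intro nn_integral_mono ennreal_leI fock_density_dilate_le) auto
  then have Dg: "dilate r g \<in> fock_space p \<alpha>"
    using W[of B] dilate_holomorphic[OF g] by (auto simp: fock_space_iff_fock_mass intro: le_less_trans)
  define u where "u n z = dilate r (F (s n)) z - dilate r g z" for n z
  have u_sp: "u n \<in> fock_space p \<alpha>" for n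
    unfolding u_def using sp[OF F] Dg p by (intro fock_space_diff) auto
  have u_dil: "u n = dilate r (\<lambda>z. F (s n) z - g z)" for n
    by (auto simp: u_def dilate_def)
  have u_hol: "u n holomorphic_on UNIV" for n
    using u_sp by (simp add: fock_space_def)
  note [measurable] = u_hol[THEN measurable_fock_density(1)]
  have "(\<lambda>n. \<integral>\<^sup>+ z. ennreal (fock_density p \<alpha> (u n) z) \<partial>lborel) \<longlonglongrightarrow> (\<integral>\<^sup>+ z. 0 \<partial>(lborel :: complex measure))"
  proof (rule nn_integral_dominated_convergence[where w = "\<lambda>z. ennreal (W (2 * B) z)"])
    show "AE z in lborel. ennreal (fock_density p \<alpha> (u n) z) \<le> ennreal (W (2 * B) z)" for n
    proof (intro AE_I2 ennreal_leI)
      fix z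
      have "norm (F (s n) v - g v) \<le> (2 * B) * exp (\<alpha> / 2 * (norm v)\<^sup>2)" for v
        using norm_triangle_ineq4[of "F (s n) v" "g v"] growth[of "s n" v] g_growth[of v] by simp
      then show "fock_density p \<alpha> (u n) z \<le> W (2 * B) z"
        unfolding u_dil W_def using p B r by (intro fock_density_dilate_le) auto
    qed
    show "AE z in lborel. (\<lambda>n. ennreal (fock_density p \<alpha> (u n) z)) \<longlonglongrightarrow> 0"
    proof (intro AE_I2)
      fix z
      have "(\<lambda>n. u n z) \<longlonglongrightarrow> dilate r g z - dilate r g z"
        unfolding u_def dilate_def by (intro tendsto_diff lim tendsto_const) auto
      then have "(\<lambda>n. norm (u n z)) \<longlonglongrightarrow> 0"
        by (simp add: tendsto_norm_zero)
      then have "(\<lambda>n. norm (u n z) powr p) \<longlonglongrightarrow> 0"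
        using p by (intro tendsto_zero_powrI) auto
      then have "(\<lambda>n. fock_density p \<alpha> (u n) z) \<longlonglongrightarrow> 0"
        unfolding fock_density_def by (rule tendsto_mult_left_zero)
      then show "(\<lambda>n. ennreal (fock_density p \<alpha> (u n) z)) \<longlonglongrightarrow> 0"
        by (subst ennreal_tendsto_0_iff) (auto simp: fock_density_def)
    qed
  qed (use W in \<open>auto simp: W_def\<close>)
  then have "(\<lambda>n. fock_norm p \<alpha> (u n)) \<longlonglongrightarrow> 0"
    using p \<alpha> by (intro fock_norm_tendsto_0I u_sp) (auto simp: fock_mass_def)
  then have "(\<lambda>n. C * fock_norm p \<alpha> (u n)) \<longlonglongrightarrow> 0"
    by (rule tendsto_mult_right_zero)
  then have "(\<lambda>n. fock_norm q \<alpha> (T (u n))) \<longlonglongrightarrow> 0"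
    by (rule tendsto_sandwich[rotated 2, OF tendsto_const]) (auto intro!: always_eventually C u_sp)
  moreover have "T (u n) = (\<lambda>z. T (dilate r (F (s n))) z - T (dilate r g) z)" for n
    unfolding u_def by (rule fock_linear_diff[OF lin sp[OF F] Dg])
  moreover have "T (dilate r g) \<in> fock_space q \<alpha>"
    using lin Dg unfolding fock_linear_def by blast
  ultimately show "\<exists>s h. strict_mono (s :: nat \<Rightarrow> nat) \<and> h \<in> fock_space q \<alpha> \<and>
      (\<lambda>n. fock_norm q \<alpha> (\<lambda>z. T (dilate r (F (s n))) z - h z)) \<longlonglongrightarrow> 0"
    using s by (intro exI[of _ s] exI[of _ "T (dilate r g)"]) auto
qed

text \<open>The mean value inequality along the segment from r z to z, with the growth of f'.\<close>
lemma dilate_close_on_disc: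
  assumes f: "f \<in> fock_space p \<alpha>" and p: "1 \<le> p" and \<alpha>: "0 < \<alpha>" and r: "0 \<le> r" "r \<le> 1"
    and N: "fock_norm p \<alpha> f \<le> 1" and z: "norm z \<le> R"
  shows "norm (f z - dilate r f z) \<le> (1 - r) * (eval_const p \<alpha> * (1 + R) * exp (\<alpha> / 2 * R\<^sup>2) * R)"
proof -
  have hol: "f holomorphic_on UNIV" using f by (simp add: fock_space_def)
  have R: "0 \<le> R" using z norm_ge_zero[of z] by linarith
  have ec: "0 \<le> eval_const p \<alpha>" using eval_const_pos[of p \<alpha>] p \<alpha> by simp
  define B where "B = eval_const p \<alpha> * (1 + R) * exp (\<alpha> / 2 * R\<^sup>2)"
  have B: "0 \<le> B" using ec R by (simp add: B_def)
  have "norm (f z - f (of_real r * z)) \<le> B * norm (z - of_real r * z)"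
  proof (rule field_differentiable_bound[of "cball 0 R" f "deriv f"])
    show "(f has_field_derivative deriv f v) (at v within cball 0 R)" for v
      by (rule has_field_derivative_at_within[OF holomorphic_derivI[OF hol]]) auto
    show "norm (deriv f v) \<le> B" if "v \<in> cball 0 R" for v
    proof -
      have v: "norm v \<le> R" using that by simp
      have "norm (deriv f v) \<le> eval_const p \<alpha> * fock_norm p \<alpha> f * (1 + norm v) * exp (\<alpha> / 2 * (norm v)\<^sup>2)"
        by (rule fock_growth(2)[OF f p \<alpha>])
      also have "\<dots> \<le> eval_const p \<alpha> * 1 * (1 + R) * exp (\<alpha> / 2 * R\<^sup>2)"
        using ec N v \<alpha> R power_mono[OF v, of 2] by (intro mult_mono) auto
      finally show ?thesis by (simp add: B_def)
    qed
    have "r * norm z \<le> 1 * norm z" using r by (intro mult_right_mono) auto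
    then show "of_real r * z \<in> cball 0 R" using z r by (simp add: norm_mult)
  qed (use z in auto)
  also have "norm (z - of_real r * z) = (1 - r) * norm z"
  proof -
    have "z - of_real r * z = of_real (1 - r) * z" by (simp add: algebra_simps)
    then show ?thesis using r by (simp only: norm_mult norm_of_real)
  qed
  also have "B * ((1 - r) * norm z) \<le> B * ((1 - r) * R)"
    using B r z by (intro mult_left_mono) auto
  finally show ?thesis by (simp add: dilate_def B_def mult_ac)
qed

text \<open>The constant function 1 lies in the Fock space, and its image under V has derivative g'.\<close>
lemma deriv_mass_symbol_finite:
  assumes V: "fock_bounded p q \<alpha> (volterra_op g \<psi>)" and g: "g holomorphic_on UNIV" and \<psi>: "\<psi> holomorphic_on UNIV"
    and p: "0 < p" and q: "1 \<le> q" and \<alpha>: "0 < \<alpha>"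
  shows "(\<integral>\<^sup>+ z. ennreal (symbol_weight q \<alpha> g z) \<partial>lborel) < \<infinity>"
proof -
  have "fock_mass p \<alpha> (\<lambda>_. 1) < \<infinity>"
    using nn_integral_complex_gaussian_finite[of "p * \<alpha> / 2"] p \<alpha> by (simp add: fock_mass_def fock_density_def)
  then have one: "(\<lambda>_. 1) \<in> fock_space p \<alpha>"
    by (simp add: fock_space_iff_fock_mass)
  then have "volterra_op g \<psi> (\<lambda>_. 1) \<in> fock_space q \<alpha>"
    using V by (simp add: fock_bounded_def fock_linear_def)
  then have hol: "volterra_op g \<psi> (\<lambda>_. 1) holomorphic_on UNIV" and fin: "fock_mass q \<alpha> (volterra_op g \<psi> (\<lambda>_. 1)) < \<infinity>"
    by (simp_all add: fock_space_iff_fock_mass)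
  have "(\<integral>\<^sup>+ z. ennreal (symbol_weight q \<alpha> g z) \<partial>lborel) = deriv_mass q \<alpha> (volterra_op g \<psi> (\<lambda>_. 1))"
    by (subst deriv_mass_volterra_op[OF _ g \<psi>]) auto
  also have "\<dots> \<le> ennreal (disc_const q \<alpha> * pi) * fock_mass q \<alpha> (volterra_op g \<psi> (\<lambda>_. 1))"
    by (rule deriv_mass_le_fock_mass[OF hol q \<alpha>])
  also have "\<dots> < \<infinity>" using fin by (simp add: ennreal_mult_less_top)
  finally show ?thesis .
qed

text \<open>The first factor turns a mass into a power of the norm, the second recovers a function from its
derivative, and 20^q bounds the power of the norm of f - f_r, where f_r(z) = f(r z),
for f in the unit ball.\<close>
definition essnorm_upper_const :: "real \<Rightarrow> real \<Rightarrow> real \<Rightarrow> real" where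
  "essnorm_upper_const p q \<alpha> = q * \<alpha> / (2 * pi) * primitive_const q \<alpha> *
     (1 + disc_const q \<alpha> * exp (q * \<alpha> / 2) * embedding_const p q \<alpha> * 20 powr q)"

lemma essnorm_upper_const_pos:
  assumes "1 \<le> p" "1 \<le> q" "0 < \<alpha>"
  shows "0 < essnorm_upper_const p q \<alpha>"
  unfolding essnorm_upper_const_def using assms disc_const_pos[of \<alpha> q] primitive_const_pos[of \<alpha> q] embedding_const_pos[of p \<alpha> q]
  by (intro mult_pos_pos add_pos_nonneg divide_pos_pos) auto

text \<open>With f_r(z) = f(r z), the norm of V(f - f_r) has two parts: over |\<psi>| \<le> R the difference is uniformly small
for r close to 1, and over |\<psi>| > R the Carleson-type estimate applies. The norm of
f - f_r is at most 4 (1 + 4) = 20 times that of f.\<close>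
lemma volterra_op_dilation_error:
  assumes V: "fock_bounded p q \<alpha> (volterra_op g \<psi>)" and g: "g holomorphic_on UNIV" and \<psi>: "\<psi> holomorphic_on UNIV"
    and p: "1 \<le> p" "p \<le> q" and \<alpha>: "0 < \<alpha>" and S: "0 \<le> S" and \<epsilon>: "0 < \<epsilon>"
    and le: "\<And>u. R - 1 < norm u \<Longrightarrow> berezin q \<alpha> \<psi> g u \<le> ennreal S"
  obtains r where "1 / 2 \<le> r" "r < 1"
    "\<And>f. f \<in> fock_space p \<alpha> \<Longrightarrow> fock_norm p \<alpha> f \<le> 1 \<Longrightarrow>
       fock_norm q \<alpha> (\<lambda>z. volterra_op g \<psi> f z - volterra_op g \<psi> (dilate r f) z) powr q \<le> essnorm_upper_const p q \<alpha> * (S + \<epsilon>)"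
proof -
  let ?V = "volterra_op g \<psi>"
  have q: "1 \<le> q" using p by simp
  have lin: "fock_linear p q \<alpha> ?V" using V by (simp add: fock_bounded_def)
  have [measurable]: "\<psi> \<in> borel_measurable borel"
    using \<psi> by (intro borel_measurable_continuous_onI holomorphic_on_imp_continuous_on)
  note [measurable] = measurable_symbol_weight[OF g]
  obtain m where m: "(\<integral>\<^sup>+ z. ennreal (symbol_weight q \<alpha> g z) \<partial>lborel) = ennreal m" "0 \<le> m"
    using deriv_mass_symbol_finite[OF V g \<psi> _ q \<alpha>] p by (cases "\<integral>\<^sup>+ z. ennreal (symbol_weight q \<alpha> g z) \<partial>lborel") auto
  define Z where "Z = \<bar>eval_const p \<alpha> * (1 + R) * exp (\<alpha> / 2 * R\<^sup>2) * R\<bar>"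
  define \<delta> where "\<delta> = (\<epsilon> / (m + 1)) powr (1 / q)"
  have \<delta>: "0 < \<delta>" using \<epsilon> m by (simp add: \<delta>_def)
  have \<delta>q: "\<delta> powr q * m \<le> \<epsilon>"
    using \<epsilon> m q by (simp add: \<delta>_def powr_powr field_simps)
  have Z: "0 \<le> Z" by (simp add: Z_def)
  \<comment> \<open>Z is the Lipschitz bound on |z| \<le> R multiplied by R, so (1 - r) Z bounds the error there.\<close>
  define r where "r = max (1 / 2) (1 - \<delta> / (Z + 1))"
  have r: "1 / 2 \<le> r" "r < 1" using \<delta> Z by (auto simp: r_def)
  have rZ: "(1 - r) * Z \<le> \<delta>"
  proof -
    have "(1 - r) * Z \<le> \<delta> / (Z + 1) * Z"
      using Z by (intro mult_right_mono) (auto simp: r_def)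
    also have "\<dots> \<le> \<delta>" using \<delta> Z by (simp add: field_simps)
    finally show ?thesis .
  qed
  show ?thesis
  proof (rule that[OF r])
    fix f assume f: "f \<in> fock_space p \<alpha>" and N: "fock_norm p \<alpha> f \<le> 1"
    have Df: "dilate r f \<in> fock_space p \<alpha>" "fock_norm p \<alpha> (dilate r f) \<le> 4 * fock_norm p \<alpha> f"
      using fock_space_dilate[OF f p(1) \<alpha>, of r] r by auto
    define h where "h z = f z - dilate r f z" for z
    have h: "h \<in> fock_space p \<alpha>"
      unfolding h_def using p by (intro fock_space_diff f Df) auto
    have hol: "h holomorphic_on UNIV" using h by (simp add: fock_space_def)
    have [measurable]: "h \<in> borel_measurable borel"
      using hol by (intro borel_measurable_continuous_onI holomorphic_on_imp_continuous_on)
    have "fock_norm p \<alpha> h \<le> 4 * (fock_norm p \<alpha> f + fock_norm p \<alpha> (dilate r f))"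
      unfolding h_def by (rule fock_norm_diff_le[OF f Df(1) p(1) \<alpha>])
    moreover have "fock_norm p \<alpha> (dilate r f) \<le> 4"
      using order_trans[OF Df(2)] N by simp
    ultimately have hN: "fock_norm p \<alpha> h \<le> 20" using N by argo
    have Vh_sp: "?V h \<in> fock_space q \<alpha>"
      using lin h by (simp add: fock_linear_def)
    have hmass: "fock_mass q \<alpha> h \<le> ennreal (embedding_const p q \<alpha> * 20 powr q)"
    proof (rule order_trans[OF fock_mass_le_fock_norm_powr[OF h p \<alpha>]], rule ennreal_leI)
      show "embedding_const p q \<alpha> * fock_norm p \<alpha> h powr q \<le> embedding_const p q \<alpha> * 20 powr q"
        using embedding_const_pos[OF p(1) \<alpha>, of q] hN q by (intro mult_left_mono powr_mono2) auto
    qed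
    have inside: "(\<integral>\<^sup>+ z. ennreal (norm (h (\<psi> z)) powr q * symbol_weight q \<alpha> g z) * indicator {z. norm (\<psi> z) \<le> R} z \<partial>lborel)
      \<le> ennreal \<epsilon>"
    proof -
      have "(\<integral>\<^sup>+ z. ennreal (norm (h (\<psi> z)) powr q * symbol_weight q \<alpha> g z) * indicator {z. norm (\<psi> z) \<le> R} z \<partial>lborel)
        \<le> (\<integral>\<^sup>+ z. ennreal (\<delta> powr q) * ennreal (symbol_weight q \<alpha> g z) \<partial>lborel)"
      proof (intro nn_integral_mono)
        fix z
        show "ennreal (norm (h (\<psi> z)) powr q * symbol_weight q \<alpha> g z) * indicator {z. norm (\<psi> z) \<le> R} z
          \<le> ennreal (\<delta> powr q) * ennreal (symbol_weight q \<alpha> g z)"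
        proof (cases "norm (\<psi> z) \<le> R")
          case True
          have "norm (h (\<psi> z)) \<le> (1 - r) * (eval_const p \<alpha> * (1 + R) * exp (\<alpha> / 2 * R\<^sup>2) * R)"
            unfolding h_def using r by (intro dilate_close_on_disc[OF f p(1) \<alpha> _ _ N True]) auto
          also have "\<dots> \<le> (1 - r) * Z"
            unfolding Z_def using r by (intro mult_left_mono abs_ge_self) auto
          finally have "norm (h (\<psi> z)) \<le> \<delta>" using rZ by linarith
          then have "norm (h (\<psi> z)) powr q * symbol_weight q \<alpha> g z \<le> \<delta> powr q * symbol_weight q \<alpha> g z"
            using q by (intro mult_right_mono powr_mono2) auto
          then show ?thesis using True by (simp add: ennreal_leI flip: ennreal_mult)
        qed simp
      qed
      also have "\<dots> = ennreal (\<delta> powr q) * (\<integral>\<^sup>+ z. ennreal (symbol_weight q \<alpha> g z) \<partial>lborel)"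
        by (rule nn_integral_cmult) measurable
      also have "\<dots> = ennreal (\<delta> powr q * m)"
        using m by (simp add: ennreal_mult)
      also have "\<dots> \<le> ennreal \<epsilon>" by (rule ennreal_leI[OF \<delta>q])
      finally show ?thesis .
    qed
    define c where "c = disc_const q \<alpha> * exp (q * \<alpha> / 2)"
    define e where "e = embedding_const p q \<alpha> * 20 powr q"
    have c: "0 \<le> c" using disc_const_pos[OF \<alpha>, of q] by (simp add: c_def)
    have e: "0 \<le> e" using embedding_const_pos[OF p(1) \<alpha>, of q] by (simp add: e_def)
    have rc: "0 \<le> primitive_const q \<alpha>" using primitive_const_pos[OF \<alpha>, of q] by simp
    have outside: "(\<integral>\<^sup>+ z. ennreal (norm (h (\<psi> z)) powr q * symbol_weight q \<alpha> g z) * indicator {z. R < norm (\<psi> z)} z \<partial>lborel)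
      \<le> ennreal (c * S * e)"
    proof -
      have "(\<integral>\<^sup>+ z. ennreal (norm (h (\<psi> z)) powr q * symbol_weight q \<alpha> g z) * indicator {z. R < norm (\<psi> z)} z \<partial>lborel)
        \<le> ennreal (c * S) * fock_mass q \<alpha> h"
        unfolding c_def by (rule carleson_estimate_outside_disc[OF hol g \<psi> q \<alpha> S le])
      also have "\<dots> \<le> ennreal (c * S) * ennreal e"
        unfolding e_def by (intro mult_left_mono hmass) auto
      also have "\<dots> = ennreal (c * S * e)"
        using c S e by (intro ennreal_mult[symmetric]) auto
      finally show ?thesis .
    qed
    have "deriv_mass q \<alpha> (?V h) =
       (\<integral>\<^sup>+ z. ennreal (norm (h (\<psi> z)) powr q * symbol_weight q \<alpha> g z) * indicator {z. norm (\<psi> z) \<le> R} z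
          + ennreal (norm (h (\<psi> z)) powr q * symbol_weight q \<alpha> g z) * indicator {z. R < norm (\<psi> z)} z \<partial>lborel)"
      unfolding deriv_mass_volterra_op[OF hol g \<psi>] by (intro nn_integral_cong) (auto split: split_indicator)
    also have "\<dots> = (\<integral>\<^sup>+ z. ennreal (norm (h (\<psi> z)) powr q * symbol_weight q \<alpha> g z) * indicator {z. norm (\<psi> z) \<le> R} z \<partial>lborel)
          + (\<integral>\<^sup>+ z. ennreal (norm (h (\<psi> z)) powr q * symbol_weight q \<alpha> g z) * indicator {z. R < norm (\<psi> z)} z \<partial>lborel)"
      by (rule nn_integral_add) measurable
    also have "\<dots> \<le> ennreal \<epsilon> + ennreal (c * S * e)"
      by (rule add_mono[OF inside outside])
    also have "\<dots> = ennreal (\<epsilon> + c * S * e)"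
      using \<epsilon> c S e by (simp add: ennreal_plus)
    finally have dm: "deriv_mass q \<alpha> (?V h) \<le> ennreal (\<epsilon> + c * S * e)" .
    have "ennreal (2 * pi / (q * \<alpha>) * fock_norm q \<alpha> (?V h) powr q) = fock_mass q \<alpha> (?V h)"
      using q by (intro fock_mass_eq_fock_norm[OF Vh_sp _ \<alpha>, symmetric]) simp
    also have "\<dots> \<le> ennreal (primitive_const q \<alpha>) * deriv_mass q \<alpha> (?V h)"
      by (intro fock_mass_le_deriv_mass volterra_op_holomorphic volterra_op_facts(2) hol g \<psi> q \<alpha>)
    also have "\<dots> \<le> ennreal (primitive_const q \<alpha>) * ennreal (\<epsilon> + c * S * e)"
      by (intro mult_left_mono dm) auto
    also have "\<dots> = ennreal (primitive_const q \<alpha> * (\<epsilon> + c * S * e))"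
      using rc \<epsilon> c S e by (intro ennreal_mult[symmetric]) auto
    finally have "2 * pi / (q * \<alpha>) * fock_norm q \<alpha> (?V h) powr q \<le> primitive_const q \<alpha> * (\<epsilon> + c * S * e)"
      using rc \<epsilon> c S e by (subst (asm) ennreal_le_iff) auto
    then have "q * \<alpha> / (2 * pi) * (2 * pi / (q * \<alpha>) * fock_norm q \<alpha> (?V h) powr q)
      \<le> q * \<alpha> / (2 * pi) * (primitive_const q \<alpha> * (\<epsilon> + c * S * e))"
      using q \<alpha> by (intro mult_left_mono) auto
    then have "fock_norm q \<alpha> (?V h) powr q \<le> q * \<alpha> / (2 * pi) * primitive_const q \<alpha> * (\<epsilon> + c * S * e)"
      using q \<alpha> by simp
    also have "\<dots> \<le> q * \<alpha> / (2 * pi) * primitive_const q \<alpha> * ((1 + c * e) * (S + \<epsilon>))"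
    proof (rule mult_left_mono)
      have "0 \<le> S + c * e * \<epsilon>" using S c e \<epsilon> by simp
      then show "\<epsilon> + c * S * e \<le> (1 + c * e) * (S + \<epsilon>)" by (simp add: algebra_simps)
    qed (use q \<alpha> rc in auto)
    also have "\<dots> = essnorm_upper_const p q \<alpha> * (S + \<epsilon>)"
      by (simp add: essnorm_upper_const_def c_def e_def mult.assoc)
    also have "?V h = (\<lambda>z. ?V f z - ?V (dilate r f) z)"
      unfolding h_def by (rule fock_linear_diff[OF lin f Df(1)])
    finally show "fock_norm q \<alpha> (\<lambda>z. ?V f z - ?V (dilate r f) z) powr q \<le> essnorm_upper_const p q \<alpha> * (S + \<epsilon>)" .
  qed
qed

text \<open>The operators f \<mapsto> V f_r with f_r(z) = f(r z) compete in the infimum that defines the essential norm; the error beyond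
the limit superior is then made arbitrarily small.\<close>
lemma fock_essnorm_volterra_le:
  assumes V: "fock_bounded p q \<alpha> (volterra_op g \<psi>)" and g: "g holomorphic_on UNIV" and \<psi>: "\<psi> holomorphic_on UNIV"
    and p: "1 \<le> p" "p \<le> q" and \<alpha>: "0 < \<alpha>" and l: "0 \<le> l"
    and Lim: "Limsup at_infinity (berezin q \<alpha> \<psi> g) = ennreal l"
  shows "fock_essnorm p q \<alpha> (volterra_op g \<psi>) \<le> essnorm_upper_const p q \<alpha> powr (1 / q) * l powr (1 / q)"
proof -
  let ?V = "volterra_op g \<psi>"
  let ?E = "fock_essnorm p q \<alpha> ?V"
  have q: "1 \<le> q" using p by simp
  have U: "0 < essnorm_upper_const p q \<alpha>" by (rule essnorm_upper_const_pos[OF p(1) q \<alpha>])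
  show ?thesis
  proof (cases "0 \<le> ?E")
    case False
    moreover have "0 \<le> essnorm_upper_const p q \<alpha> powr (1 / q) * l powr (1 / q)" by simp
    ultimately show ?thesis by linarith
  next
    case True
    have approx: "?E powr q \<le> essnorm_upper_const p q \<alpha> * l + d" if d: "0 < d" for d
    proof -
      \<comment> \<open>The error enters twice: once above the limit superior and once from the inner disc.\<close>
      define \<epsilon> where "\<epsilon> = d / (2 * essnorm_upper_const p q \<alpha>)"
      have \<epsilon>: "0 < \<epsilon>" using d U by (simp add: \<epsilon>_def)
      have "ennreal l < ennreal (l + \<epsilon>)" using l \<epsilon> by (simp add: ennreal_less_iff)
      then have "eventually (\<lambda>u. berezin q \<alpha> \<psi> g u < ennreal (l + \<epsilon>)) at_infinity"
        unfolding Lim[symmetric] by (rule Limsup_lessD)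
      then obtain b where b: "\<And>u. b \<le> norm u \<Longrightarrow> berezin q \<alpha> \<psi> g u < ennreal (l + \<epsilon>)"
        by (auto simp: eventually_at_infinity)
      obtain r where r: "1 / 2 \<le> r" "r < 1"
        and est: "\<And>f. f \<in> fock_space p \<alpha> \<Longrightarrow> fock_norm p \<alpha> f \<le> 1 \<Longrightarrow>
       fock_norm q \<alpha> (\<lambda>z. ?V f z - ?V (dilate r f) z) powr q \<le> essnorm_upper_const p q \<alpha> * ((l + \<epsilon>) + \<epsilon>)"
      proof (rule volterra_op_dilation_error[OF V g \<psi> p \<alpha> _ \<epsilon>, of "l + \<epsilon>" "b + 1"])
        show "berezin q \<alpha> \<psi> g u \<le> ennreal (l + \<epsilon>)" if "b + 1 - 1 < norm u" for u
          using b[of u] that by simp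
      qed (use l \<epsilon> in auto)
      define X where "X = (essnorm_upper_const p q \<alpha> * ((l + \<epsilon>) + \<epsilon>)) powr (1 / q)"
      have "?E \<le> fock_opnorm p q \<alpha> (\<lambda>f z. ?V f z - ?V (dilate r f) z)"
        by (rule fock_essnorm_le[OF V fock_compact_dilate[OF V p(1) \<alpha> r] q \<alpha>])
      also have "\<dots> \<le> X"
      proof (rule fock_opnorm_least)
        fix f assume f: "f \<in> fock_space p \<alpha>" "fock_norm p \<alpha> f \<le> 1"
        have "(fock_norm q \<alpha> (\<lambda>z. ?V f z - ?V (dilate r f) z) powr q) powr (1 / q) \<le> X"
          unfolding X_def using est[OF f] q by (intro powr_mono2) auto
        then show "fock_norm q \<alpha> (\<lambda>z. ?V f z - ?V (dilate r f) z) \<le> X"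
          using q by (simp add: powr_powr)
      qed
      finally have "?E powr q \<le> X powr q" using True q by (intro powr_mono2) auto
      also have "\<dots> = essnorm_upper_const p q \<alpha> * (l + 2 * \<epsilon>)"
        using U l \<epsilon> q by (simp add: X_def powr_powr)
      also have "\<dots> = essnorm_upper_const p q \<alpha> * l + d"
        using U by (simp add: \<epsilon>_def field_simps)
      finally show ?thesis .
    qed
    then have "?E powr q \<le> essnorm_upper_const p q \<alpha> * l"
      by (rule field_le_epsilon)
    then have "(?E powr q) powr (1 / q) \<le> (essnorm_upper_const p q \<alpha> * l) powr (1 / q)"
      using q by (intro powr_mono2) auto
    then show ?thesis using True q by (simp add: powr_powr powr_mult)
  qed
qed

section \<open>Normalized kernels and the lower estimate\<close>

text \<open>The reproducing kernel at w, normalized so that its weighted modulus is a translated Gaussian of height 1.\<close>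
definition fock_kernel :: "real \<Rightarrow> complex \<Rightarrow> complex \<Rightarrow> complex" where
  "fock_kernel \<alpha> w z = exp (of_real \<alpha> * cnj w * z - of_real (\<alpha> / 2 * (norm w)\<^sup>2))"

lemma fock_kernel_holomorphic: "fock_kernel \<alpha> w holomorphic_on UNIV"
  unfolding fock_kernel_def by (intro holomorphic_intros)

lemma norm_fock_kernel:
  "norm (fock_kernel \<alpha> w z) = exp (\<alpha> / 2 * ((norm z)\<^sup>2 - (norm (z - w))\<^sup>2))"
proof -
  have sq: "(norm z)\<^sup>2 - (norm (z - w))\<^sup>2 = 2 * Re (cnj w * z) - (norm w)\<^sup>2"
    unfolding cmod_power2 by (simp add: algebra_simps power2_eq_square)
  show ?thesis
    unfolding sq by (simp add: fock_kernel_def norm_exp_eq_Re algebra_simps)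
qed

lemma weighted_mod_fock_kernel: "weighted_mod \<alpha> (fock_kernel \<alpha> w) z = exp (- (\<alpha> / 2) * (norm (z - w))\<^sup>2)"
  by (simp add: weighted_mod_def norm_fock_kernel algebra_simps flip: exp_add)

text \<open>The exact value of the norm is 1; a positive bound that does not depend on w is all that the
comparison of the norms needs, and it comes without evaluating the Gaussian integral.\<close>
definition kernel_norm_bound :: "real \<Rightarrow> real \<Rightarrow> real" where
  "kernel_norm_bound p \<alpha> = 1 + (p * \<alpha> / (2 * pi) * gauss_mass (p * \<alpha> / 2)) powr (1 / p)"

lemma kernel_norm_bound_pos: "0 < kernel_norm_bound p \<alpha>"
  by (simp add: kernel_norm_bound_def add_pos_nonneg)

lemma fock_kernel_in_fock_space:
  assumes p: "0 < p" and \<alpha>: "0 < \<alpha>"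
  shows "fock_kernel \<alpha> w \<in> fock_space p \<alpha>" and "fock_norm p \<alpha> (fock_kernel \<alpha> w) \<le> kernel_norm_bound p \<alpha>"
proof -
  have "fock_density p \<alpha> (fock_kernel \<alpha> w) z = exp (- (p * \<alpha> / 2) * (norm (z - w))\<^sup>2)" for z
    by (simp add: fock_density_eq_weighted_mod weighted_mod_fock_kernel exp_powr_real mult_ac)
  then have mass: "fock_mass p \<alpha> (fock_kernel \<alpha> w) = ennreal (gauss_mass (p * \<alpha> / 2))"
    unfolding fock_mass_def using p \<alpha> by (simp only:) (rule nn_integral_translated_gaussian, simp)
  then show sp: "fock_kernel \<alpha> w \<in> fock_space p \<alpha>"
    by (simp add: fock_space_iff_fock_mass fock_kernel_holomorphic)
  show "fock_norm p \<alpha> (fock_kernel \<alpha> w) \<le> kernel_norm_bound p \<alpha>"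
  proof (rule fock_norm_le_of_fock_mass[OF sp p \<alpha>])
    let ?x = "p * \<alpha> / (2 * pi) * gauss_mass (p * \<alpha> / 2)"
    have x: "0 \<le> ?x" using p \<alpha> gauss_mass_nonneg by simp
    have "(y powr (1 / p)) powr p = y" if "0 \<le> y" for y
      using that p by (simp add: powr_powr)
    from this[OF x] have "?x = (?x powr (1 / p)) powr p" by (rule sym)
    also have "\<dots> \<le> kernel_norm_bound p \<alpha> powr p"
      unfolding kernel_norm_bound_def using p by (intro powr_mono2) auto
    finally have "2 * pi / (p * \<alpha>) * ?x \<le> 2 * pi / (p * \<alpha>) * kernel_norm_bound p \<alpha> powr p"
      using p \<alpha> by (intro mult_left_mono) auto
    then show "fock_mass p \<alpha> (fock_kernel \<alpha> w) \<le> ennreal (2 * pi / (p * \<alpha>) * kernel_norm_bound p \<alpha> powr p)"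
      unfolding mass using p \<alpha> by (intro ennreal_leI) simp
  qed (use kernel_norm_bound_pos[of p \<alpha>] in simp)
qed

lemma berezin_eq_deriv_mass:
  assumes "g holomorphic_on UNIV" "\<psi> holomorphic_on UNIV"
  shows "berezin q \<alpha> \<psi> g w = deriv_mass q \<alpha> (volterra_op g \<psi> (fock_kernel \<alpha> w))"
  unfolding berezin_eq deriv_mass_volterra_op[OF fock_kernel_holomorphic assms] norm_fock_kernel
  by (simp add: exp_powr_real mult_ac)

lemma fock_linear_sum:
  assumes T: "fock_linear p q \<alpha> T" and p: "0 \<le> p" and J: "finite J"
    and f: "\<And>j. j \<in> J \<Longrightarrow> f j \<in> fock_space p \<alpha>"
  shows "(\<lambda>z. \<Sum>j\<in>J. f j z) \<in> fock_space p \<alpha> \<and> T (\<lambda>z. \<Sum>j\<in>J. f j z) = (\<lambda>z. \<Sum>j\<in>J. T (f j) z)"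
  using J f
proof (induction J rule: finite_induct)
  case empty
  have "T (\<lambda>z. c * h z) = (\<lambda>z. c * T h z)" if "h \<in> fock_space p \<alpha>" for c h
    using T that by (simp add: fock_linear_def)
  from this[OF fock_space_zero, of 0] show ?case
    by (simp add: fock_space_zero)
next
  case (insert i J)
  have add: "T (\<lambda>z. f z + h z) = (\<lambda>z. T f z + T h z)"
    if "f \<in> fock_space p \<alpha>" "h \<in> fock_space p \<alpha>" for f h
    using T that by (simp add: fock_linear_def)
  have fi: "f i \<in> fock_space p \<alpha>" using insert by simp
  have IH: "(\<lambda>z. \<Sum>j\<in>J. f j z) \<in> fock_space p \<alpha>" "T (\<lambda>z. \<Sum>j\<in>J. f j z) = (\<lambda>z. \<Sum>j\<in>J. T (f j) z)"
    using insert by auto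
  show ?case
    using insert.hyps fock_space_add[OF fi IH(1) p] add[OF fi IH(1)] by (simp add: IH(2))
qed

text \<open>Jensen's inequality for the counting measure.\<close>
lemma sum_powr_le:
  fixes a :: "'i \<Rightarrow> real"
  assumes q: "1 \<le> q" and J: "finite J" and a: "\<And>j. j \<in> J \<Longrightarrow> 0 \<le> a j"
  shows "(\<Sum>j\<in>J. a j) powr q \<le> real (card J) powr (q - 1) * (\<Sum>j\<in>J. a j powr q)"
proof (cases "J = {}")
  case False
  have c: "0 < real (card J)" using J False by (simp add: card_gt_0_iff)
  have a0: "0 \<le> (\<Sum>j\<in>J. a j)" using a by (rule sum_nonneg)
  let ?b = "\<lambda>j. if j \<in> J then a j else 0"
  have "ennreal ((\<Sum>j\<in>J. a j) powr q) \<le> ennreal (real (card J) powr (q - 1)) *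
      (\<integral>\<^sup>+ j. ennreal (?b j powr q * 1) \<partial>count_space J)"
  proof (rule nn_integral_jensen_powr[OF q c a0])
    show "(\<integral>\<^sup>+ j. ennreal 1 \<partial>count_space J) \<le> ennreal (real (card J))"
      using J by (simp add: nn_integral_count_space_finite)
    show "ennreal (\<Sum>j\<in>J. a j) \<le> (\<integral>\<^sup>+ j. ennreal (?b j * 1) \<partial>count_space J)"
      using J a by (simp add: nn_integral_count_space_finite sum_ennreal)
  qed (use a in auto)
  also have "(\<integral>\<^sup>+ j. ennreal (?b j powr q * 1) \<partial>count_space J) = ennreal (\<Sum>j\<in>J. a j powr q)"
    using J by (simp add: nn_integral_count_space_finite)
  finally show ?thesis
    by (simp add: sum_nonneg flip: ennreal_mult)
qed simp

text \<open>Iterating the quasi-triangle inequality would produce a constant exponential in the number of terms;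
convexity of the power gives the linear one.\<close>
lemma fock_norm_sum_le:
  assumes q: "1 \<le> q" and \<alpha>: "0 < \<alpha>" and J: "finite J" and \<phi>: "\<And>j. j \<in> J \<Longrightarrow> \<phi> j \<in> fock_space q \<alpha>"
    and \<eta>: "0 \<le> \<eta>" "\<And>j. j \<in> J \<Longrightarrow> fock_norm q \<alpha> (\<phi> j) \<le> \<eta>"
    and sp: "(\<lambda>z. \<Sum>j\<in>J. \<phi> j z) \<in> fock_space q \<alpha>"
  shows "fock_norm q \<alpha> (\<lambda>z. \<Sum>j\<in>J. \<phi> j z) \<le> real (card J) * \<eta>"
proof (rule fock_norm_le_of_fock_mass[OF sp])
  have hol: "\<phi> j holomorphic_on UNIV" if "j \<in> J" for j using \<phi>[OF that] by (simp add: fock_space_def)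
  let ?n = "real (card J)"
  have "fock_mass q \<alpha> (\<lambda>z. \<Sum>j\<in>J. \<phi> j z) \<le>
    (\<integral>\<^sup>+ z. ennreal (?n powr (q - 1)) * (\<Sum>j\<in>J. ennreal (fock_density q \<alpha> (\<phi> j) z)) \<partial>lborel)"
    unfolding fock_mass_def
  proof (intro nn_integral_mono)
    fix z
    have "weighted_mod \<alpha> (\<lambda>z. \<Sum>j\<in>J. \<phi> j z) z \<le> (\<Sum>j\<in>J. weighted_mod \<alpha> (\<phi> j) z)"
      unfolding weighted_mod_def sum_distrib_right[symmetric] by (intro mult_right_mono norm_sum) auto
    then have "fock_density q \<alpha> (\<lambda>z. \<Sum>j\<in>J. \<phi> j z) z \<le> (\<Sum>j\<in>J. weighted_mod \<alpha> (\<phi> j) z) powr q"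
      unfolding fock_density_eq_weighted_mod using q by (intro powr_mono2) auto
    also have "\<dots> \<le> ?n powr (q - 1) * (\<Sum>j\<in>J. fock_density q \<alpha> (\<phi> j) z)"
      unfolding fock_density_eq_weighted_mod by (intro sum_powr_le q J) auto
    finally show "ennreal (fock_density q \<alpha> (\<lambda>z. \<Sum>j\<in>J. \<phi> j z) z) \<le>
       ennreal (?n powr (q - 1)) * (\<Sum>j\<in>J. ennreal (fock_density q \<alpha> (\<phi> j) z))"
      by (simp add: fock_density_eq_weighted_mod sum_ennreal sum_nonneg ennreal_leI flip: ennreal_mult)
  qed
  also have "\<dots> = ennreal (?n powr (q - 1)) * (\<Sum>j\<in>J. fock_mass q \<alpha> (\<phi> j))"
  proof -
    have "(\<lambda>z. ennreal (fock_density q \<alpha> (\<phi> j) z)) \<in> borel_measurable lborel" if "j \<in> J" for j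
      using measurable_fock_density(1)[OF hol[OF that], of q \<alpha>] by simp
    then show ?thesis
      unfolding fock_mass_def by (simp add: nn_integral_cmult nn_integral_sum)
  qed
  also have "\<dots> \<le> ennreal (?n powr (q - 1)) * (\<Sum>j\<in>J. ennreal (2 * pi / (q * \<alpha>) * \<eta> powr q))"
  proof (intro mult_left_mono sum_mono)
    fix j assume j: "j \<in> J"
    have "2 * pi / (q * \<alpha>) * fock_norm q \<alpha> (\<phi> j) powr q \<le> 2 * pi / (q * \<alpha>) * \<eta> powr q"
      using \<eta>(2)[OF j] q \<alpha> by (intro mult_left_mono powr_mono2) auto
    then show "fock_mass q \<alpha> (\<phi> j) \<le> ennreal (2 * pi / (q * \<alpha>) * \<eta> powr q)"
      using q by (subst fock_mass_eq_fock_norm[OF \<phi>[OF j] _ \<alpha>]) (auto intro: ennreal_leI)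
  qed auto
  also have "\<dots> = ennreal (?n powr (q - 1) * (?n * (2 * pi / (q * \<alpha>) * \<eta> powr q)))"
  proof -
    have "0 \<le> 2 * pi / (q * \<alpha>) * \<eta> powr q" using q \<alpha> by simp
    then show ?thesis by (simp only: sum_constant ennreal_of_nat_eq_real_of_nat) (simp add: ennreal_mult del: times_divide_eq_left)
  qed
  also have "?n powr (q - 1) * (?n * (2 * pi / (q * \<alpha>) * \<eta> powr q)) = 2 * pi / (q * \<alpha>) * (?n * \<eta>) powr q"
  proof -
    have "?n powr (q - 1) * ?n powr 1 = ?n powr q" by (subst powr_add[symmetric]) simp
    then have "?n powr (q - 1) * ?n = ?n powr q" by simp
    then show ?thesis by (simp add: powr_mult mult_ac)
  qed
  finally show "fock_mass q \<alpha> (\<lambda>z. \<Sum>j\<in>J. \<phi> j z) \<le> ennreal (2 * pi / (q * \<alpha>) * (?n * \<eta>) powr q)" .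
qed (use q \<alpha> \<eta> in auto)

text \<open>A greedy choice: the next point is so far out that it is far from all the earlier ones.\<close>
lemma separated_subset_exists:
  fixes v :: "nat \<Rightarrow> complex"
  assumes v: "filterlim v at_infinity sequentially"
  shows "\<exists>J. finite J \<and> card J = N \<and> (\<forall>j\<in>J. n0 \<le> j) \<and> (\<forall>i\<in>J. \<forall>j\<in>J. i \<noteq> j \<longrightarrow> R \<le> norm (v i - v j))"
proof (induction N)
  case 0
  show ?case by (intro exI[of _ "{}"]) auto
next
  case (Suc N)
  then obtain J where J: "finite J" "card J = N" "\<forall>j\<in>J. n0 \<le> j" "\<forall>i\<in>J. \<forall>j\<in>J. i \<noteq> j \<longrightarrow> R \<le> norm (v i - v j)"
    by blast
  have "filterlim (\<lambda>n. norm (v n)) at_top sequentially"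
    using v by (rule filterlim_at_infinity_imp_norm_at_top)
  then have "eventually (\<lambda>n. (\<Sum>j\<in>J. norm (v j)) + R \<le> norm (v n)) sequentially"
    by (simp add: filterlim_at_top)
  moreover have "eventually (\<lambda>n. n0 + Suc (\<Sum>J) \<le> n) sequentially"
    by (rule eventually_ge_at_top)
  ultimately have "eventually (\<lambda>n. (\<Sum>j\<in>J. norm (v j)) + R \<le> norm (v n) \<and> n0 + Suc (\<Sum>J) \<le> n) sequentially"
    by (rule eventually_conj)
  then obtain n where n: "(\<Sum>j\<in>J. norm (v j)) + R \<le> norm (v n)" "n0 + Suc (\<Sum>J) \<le> n"
    by (auto simp: eventually_sequentially)
  have nJ: "n \<notin> J"
    using n(2) member_le_sum[of n J "\<lambda>j. j"] J(1) by auto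
  have far: "R \<le> norm (v n - v j)" if "j \<in> J" for j
  proof -
    have "norm (v j) \<le> (\<Sum>j\<in>J. norm (v j))"
      using that J(1) by (intro member_le_sum) auto
    then show ?thesis using n(1) norm_triangle_ineq2[of "v n" "v j"] by linarith
  qed
  have "R \<le> norm (v i - v j)" if "i \<in> insert n J" "j \<in> insert n J" "i \<noteq> j" for i j
    using that far J(4) by (auto simp: norm_minus_commute)
  then show ?case
    using J nJ n(2) by (intro exI[of _ "insert n J"]) auto
qed

text \<open>At most one centre lies within distance R of z, and the condition on R makes all the other
Gaussians sum to at most 1.\<close>
lemma separated_gaussian_sum_le:
  fixes v :: "'i \<Rightarrow> complex"
  assumes \<alpha>: "0 < \<alpha>" and J: "finite J" and R: "0 \<le> R" "real (card J) * exp (- (\<alpha> / 2) * R\<^sup>2) \<le> 1"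
    and sep: "\<And>i j. i \<in> J \<Longrightarrow> j \<in> J \<Longrightarrow> i \<noteq> j \<Longrightarrow> 2 * R \<le> norm (v i - v j)"
  shows "(\<Sum>j\<in>J. exp (- (\<alpha> / 2) * (norm (z - v j))\<^sup>2)) \<le> 2"
proof -
  let ?u = "\<lambda>j. exp (- (\<alpha> / 2) * (norm (z - v j))\<^sup>2)"
  have far: "?u j \<le> exp (- (\<alpha> / 2) * R\<^sup>2)" if "R \<le> norm (z - v j)" for j
    using power_mono[OF that R(1), of 2] \<alpha> by simp
  have rest: "(\<Sum>j\<in>I. ?u j) \<le> 1" if "I \<subseteq> J" "\<And>j. j \<in> I \<Longrightarrow> R \<le> norm (z - v j)" for I
  proof -
    have "(\<Sum>j\<in>I. ?u j) \<le> (\<Sum>j\<in>I. exp (- (\<alpha> / 2) * R\<^sup>2))"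
      using that far by (intro sum_mono) auto
    also have "\<dots> \<le> real (card J) * exp (- (\<alpha> / 2) * R\<^sup>2)"
      using card_mono[OF J that(1)] by simp
    finally show ?thesis using R(2) by linarith
  qed
  show ?thesis
  proof (cases "\<exists>i\<in>J. norm (z - v i) < R")
    case True
    then obtain i where i: "i \<in> J" "norm (z - v i) < R" by blast
    have "R \<le> norm (z - v j)" if "j \<in> J - {i}" for j
    proof -
      have "2 * R \<le> norm (v i - v j)" using sep[of i j] i that by auto
      then show ?thesis
        using i(2) norm_triangle_ineq4[of "z - v j" "z - v i"] by simp
    qed
    then have "(\<Sum>j\<in>J - {i}. ?u j) \<le> 1" by (intro rest) auto
    moreover have "?u i \<le> 1" using \<alpha> by simp
    ultimately show ?thesis using sum.remove[OF J i(1), of ?u] by linarith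
  next
    case False
    then have "(\<Sum>j\<in>J. ?u j) \<le> 1" by (intro rest) auto
    then show ?thesis by simp
  qed
qed

text \<open>Writing s for the sum of the weighted moduli of the kernels, s \<le> 2 gives s^p \<le> 2^(p-1) s, whose integral
grows only linearly in the number of kernels.\<close>
lemma separated_kernel_sum_norm:
  assumes p: "1 \<le> p" and \<alpha>: "0 < \<alpha>" and J: "finite J" and R: "0 \<le> R" "real (card J) * exp (- (\<alpha> / 2) * R\<^sup>2) \<le> 1"
    and sep: "\<And>i j. i \<in> J \<Longrightarrow> j \<in> J \<Longrightarrow> i \<noteq> j \<Longrightarrow> 2 * R \<le> norm (v i - v j)"
    and sp: "(\<lambda>z. \<Sum>j\<in>J. fock_kernel \<alpha> (v j) z) \<in> fock_space p \<alpha>"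
  shows "fock_norm p \<alpha> (\<lambda>z. \<Sum>j\<in>J. fock_kernel \<alpha> (v j) z)
     \<le> (p * \<alpha> / (2 * pi) * 2 powr (p - 1) * gauss_mass (\<alpha> / 2)) powr (1 / p) * real (card J) powr (1 / p)"
proof (rule fock_norm_le_of_fock_mass[OF sp])
  let ?n = "real (card J)" and ?G = "gauss_mass (\<alpha> / 2)"
  let ?u = "\<lambda>j z. exp (- (\<alpha> / 2) * (norm (z - v j))\<^sup>2)"
  have "fock_mass p \<alpha> (\<lambda>z. \<Sum>j\<in>J. fock_kernel \<alpha> (v j) z) \<le>
    (\<integral>\<^sup>+ z. ennreal (2 powr (p - 1)) * (\<Sum>j\<in>J. ennreal (?u j z)) \<partial>lborel)"
    unfolding fock_mass_def
  proof (intro nn_integral_mono)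
    fix z
    let ?s = "\<Sum>j\<in>J. ?u j z"
    have s: "0 \<le> ?s" "?s \<le> 2"
      using separated_gaussian_sum_le[OF \<alpha> J R sep] by (auto intro: sum_nonneg)
    have "weighted_mod \<alpha> (\<lambda>z. \<Sum>j\<in>J. fock_kernel \<alpha> (v j) z) z \<le> (\<Sum>j\<in>J. weighted_mod \<alpha> (fock_kernel \<alpha> (v j)) z)"
      unfolding weighted_mod_def sum_distrib_right[symmetric] by (intro mult_right_mono norm_sum) auto
    then have "fock_density p \<alpha> (\<lambda>z. \<Sum>j\<in>J. fock_kernel \<alpha> (v j) z) z \<le> ?s powr p"
      unfolding fock_density_eq_weighted_mod weighted_mod_fock_kernel using p by (intro powr_mono2) auto
    also have "?s powr p = ?s powr (p - 1) * ?s powr 1" by (subst powr_add[symmetric]) simp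
    also have "\<dots> \<le> 2 powr (p - 1) * ?s"
      using s p by (intro mult_mono powr_mono2) auto
    finally have "ennreal (fock_density p \<alpha> (\<lambda>z. \<Sum>j\<in>J. fock_kernel \<alpha> (v j) z) z) \<le> ennreal (2 powr (p - 1) * ?s)"
      by (rule ennreal_leI)
    also have "\<dots> = ennreal (2 powr (p - 1)) * (\<Sum>j\<in>J. ennreal (?u j z))"
      using s by (simp add: ennreal_mult sum_ennreal)
    finally show "ennreal (fock_density p \<alpha> (\<lambda>z. \<Sum>j\<in>J. fock_kernel \<alpha> (v j) z) z)
       \<le> ennreal (2 powr (p - 1)) * (\<Sum>j\<in>J. ennreal (?u j z))" .
  qed
  also have "\<dots> = ennreal (2 powr (p - 1)) * (\<Sum>j\<in>J. ennreal ?G)"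
  proof -
    have "(\<integral>\<^sup>+ z. ennreal (?u j z) \<partial>lborel) = ennreal ?G" for j
      using \<alpha> by (intro nn_integral_translated_gaussian) simp
    moreover have "(\<integral>\<^sup>+ z. (\<Sum>j\<in>J. ennreal (?u j z)) \<partial>lborel) = (\<Sum>j\<in>J. \<integral>\<^sup>+ z. ennreal (?u j z) \<partial>lborel)"
      by (rule nn_integral_sum) measurable
    moreover have "(\<integral>\<^sup>+ z. ennreal (2 powr (p - 1)) * (\<Sum>j\<in>J. ennreal (?u j z)) \<partial>lborel) =
       ennreal (2 powr (p - 1)) * (\<integral>\<^sup>+ z. (\<Sum>j\<in>J. ennreal (?u j z)) \<partial>lborel)"
      by (rule nn_integral_cmult) measurable
    ultimately show ?thesis by (simp only:)
  qed
  also have "\<dots> = ennreal (2 powr (p - 1) * (?n * ?G))"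
    using gauss_mass_nonneg[of "\<alpha> / 2"] by (simp add: ennreal_of_nat_eq_real_of_nat ennreal_mult)
  also have "2 powr (p - 1) * (?n * ?G) = 2 * pi / (p * \<alpha>) *
     ((p * \<alpha> / (2 * pi) * 2 powr (p - 1) * ?G) powr (1 / p) * ?n powr (1 / p)) powr p"
  proof -
    have "((p * \<alpha> / (2 * pi) * 2 powr (p - 1) * ?G) powr (1 / p) * ?n powr (1 / p)) powr p
       = p * \<alpha> / (2 * pi) * 2 powr (p - 1) * ?G * ?n"
      using p \<alpha> gauss_mass_nonneg[of "\<alpha> / 2"] by (subst powr_mult) (simp add: powr_powr)
    then show ?thesis using p \<alpha> by simp
  qed
  finally show "fock_mass p \<alpha> (\<lambda>z. \<Sum>j\<in>J. fock_kernel \<alpha> (v j) z) \<le> ennreal (2 * pi / (p * \<alpha>) *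
     ((p * \<alpha> / (2 * pi) * 2 powr (p - 1) * ?G) powr (1 / p) * ?n powr (1 / p)) powr p)" .
qed (use p \<alpha> in auto)

text \<open>If the images of the kernels tend to h along a subsequence, so do the images of the means of N kernels
taken far out and far apart. The means have norm at most of order N^(1/p - 1), hence h = 0 since p > 1.\<close>
lemma fock_compact_kernel_subsequence:
  assumes K: "fock_compact p q \<alpha> K" and p: "1 < p" and q: "1 \<le> q" and \<alpha>: "0 < \<alpha>"
    and w: "filterlim w at_infinity sequentially"
  obtains s :: "nat \<Rightarrow> nat" where "strict_mono s" "(\<lambda>n. fock_norm q \<alpha> (K (fock_kernel \<alpha> (w (s n))))) \<longlonglongrightarrow> 0"
proof -
  have p0: "0 < p" "1 \<le> p" "0 \<le> p" using p by auto
  have lin: "fock_linear p q \<alpha> K" using K by (simp add: fock_compact_def fock_bounded_def)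
  obtain C where C: "\<And>f. f \<in> fock_space p \<alpha> \<Longrightarrow> fock_norm q \<alpha> (K f) \<le> C * fock_norm p \<alpha> f"
    using K by (auto simp: fock_compact_def fock_bounded_def)
  have ker_sp: "fock_kernel \<alpha> v \<in> fock_space p \<alpha>" for v
    by (rule fock_kernel_in_fock_space[OF p0(1) \<alpha>])
  have K_sp: "K (fock_kernel \<alpha> v) \<in> fock_space q \<alpha>" for v
    using lin ker_sp by (simp add: fock_linear_def)
  have "(\<forall>n. fock_kernel \<alpha> (w n) \<in> fock_space p \<alpha>) \<and> (\<exists>M. \<forall>n. fock_norm p \<alpha> (fock_kernel \<alpha> (w n)) \<le> M)"
    using ker_sp fock_kernel_in_fock_space(2)[OF p0(1) \<alpha>] by blast
  moreover have "\<forall>F :: nat \<Rightarrow> complex \<Rightarrow> complex.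
        (\<forall>n. F n \<in> fock_space p \<alpha>) \<and> (\<exists>M. \<forall>n. fock_norm p \<alpha> (F n) \<le> M) \<longrightarrow>
        (\<exists>r h. strict_mono (r :: nat \<Rightarrow> nat) \<and> h \<in> fock_space q \<alpha> \<and>
           (\<lambda>n. fock_norm q \<alpha> (\<lambda>z. K (F (r n)) z - h z)) \<longlonglongrightarrow> 0)"
    using K by (simp add: fock_compact_def)
  ultimately obtain s h where s: "strict_mono (s :: nat \<Rightarrow> nat)" and h: "h \<in> fock_space q \<alpha>"
    and lim: "(\<lambda>n. fock_norm q \<alpha> (\<lambda>z. K (fock_kernel \<alpha> (w (s n))) z - h z)) \<longlonglongrightarrow> 0"
    by (auto dest!: spec[of _ "\<lambda>n. fock_kernel \<alpha> (w n)"])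
  define v where "v n = w (s n)" for n
  have v: "filterlim v at_infinity sequentially"
    unfolding v_def by (rule filterlim_compose[OF w filterlim_subseq[OF s]])
  define D where "D = (p * \<alpha> / (2 * pi) * 2 powr (p - 1) * gauss_mass (\<alpha> / 2)) powr (1 / p)"
  have D: "0 \<le> D" by (simp add: D_def)
  have mean: "fock_norm q \<alpha> h \<le> 4 * (\<bar>C\<bar> * D * real N powr (1 / p - 1) + \<eta>)" if N: "0 < N" and \<eta>: "0 < \<eta>" for N :: nat and \<eta>
  proof -
    have "eventually (\<lambda>n. fock_norm q \<alpha> (\<lambda>z. K (fock_kernel \<alpha> (v n)) z - h z) < \<eta>) sequentially"
      using order_tendstoD(2)[OF lim \<eta>] by (simp add: v_def)
    then obtain n0 where n0: "\<And>n. n0 \<le> n \<Longrightarrow> fock_norm q \<alpha> (\<lambda>z. K (fock_kernel \<alpha> (v n)) z - h z) < \<eta>"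
      by (auto simp: eventually_sequentially)
    \<comment> \<open>This choice makes N e^(- \<alpha> R^2 / 2) = 1.\<close>
    define R where "R = sqrt (2 / \<alpha> * ln (real N))"
    have "0 \<le> ln (real N)" using N by simp
    then have R2: "R\<^sup>2 = 2 / \<alpha> * ln (real N)" and R0: "0 \<le> R" using \<alpha> by (simp_all add: R_def)
    have "exp (- (\<alpha> / 2) * R\<^sup>2) = inverse (real N)"
      unfolding R2 using \<alpha> N by (simp add: exp_minus)
    then have RN: "real N * exp (- (\<alpha> / 2) * R\<^sup>2) \<le> 1" using N by simp
    obtain J where J: "finite J" "card J = N" "\<forall>j\<in>J. n0 \<le> j" "\<forall>i\<in>J. \<forall>j\<in>J. i \<noteq> j \<longrightarrow> 2 * R \<le> norm (v i - v j)"
      using separated_subset_exists[OF v, of N n0 "2 * R"] by blast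
    let ?f = "\<lambda>z. \<Sum>j\<in>J. fock_kernel \<alpha> (v j) z"
    have f: "?f \<in> fock_space p \<alpha>" "K ?f = (\<lambda>z. \<Sum>j\<in>J. K (fock_kernel \<alpha> (v j)) z)"
      using fock_linear_sum[OF lin p0(3) J(1), of "\<lambda>j. fock_kernel \<alpha> (v j)"] ker_sp by auto
    have fN: "fock_norm p \<alpha> ?f \<le> D * real N powr (1 / p)"
      unfolding D_def J(2)[symmetric] by (rule separated_kernel_sum_norm[OF p0(2) \<alpha> J(1) R0 _ _ f(1)]) (use RN J in auto)
    let ?\<phi> = "\<lambda>j z. K (fock_kernel \<alpha> (v j)) z - h z"
    have Kf: "K ?f \<in> fock_space q \<alpha>" using lin f(1) unfolding fock_linear_def by blast
    have Nh: "(\<lambda>z. of_nat N * h z) \<in> fock_space q \<alpha>" by (rule fock_space_cmult[OF h])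
    have sum_eq: "(\<lambda>z. \<Sum>j\<in>J. ?\<phi> j z) = (\<lambda>z. K ?f z - of_nat N * h z)"
      unfolding f(2) by (simp add: sum_subtractf J(2))
    have sum_sp: "(\<lambda>z. \<Sum>j\<in>J. ?\<phi> j z) \<in> fock_space q \<alpha>"
      unfolding sum_eq using Kf Nh q by (intro fock_space_diff) auto
    have err: "fock_norm q \<alpha> (\<lambda>z. \<Sum>j\<in>J. ?\<phi> j z) \<le> real N * \<eta>"
      unfolding J(2)[symmetric]
    proof (rule fock_norm_sum_le[OF q \<alpha> J(1) _ _ _ sum_sp])
      show "?\<phi> j \<in> fock_space q \<alpha>" for j using K_sp h q by (intro fock_space_diff) auto
      show "fock_norm q \<alpha> (?\<phi> j) \<le> \<eta>" if "j \<in> J" for j using n0 J(3) that by (auto intro: less_imp_le)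
    qed (use \<eta> in simp)
    have "real N * fock_norm q \<alpha> h = fock_norm q \<alpha> (\<lambda>z. of_nat N * h z)"
      using fock_norm_cmult[OF h _ \<alpha>, of "of_nat N"] q by simp
    also have "(\<lambda>z. of_nat N * h z) = (\<lambda>z. K ?f z - (\<Sum>j\<in>J. ?\<phi> j z))"
      by (rule ext) (simp add: fun_cong[OF sum_eq])
    also have "fock_norm q \<alpha> \<dots> \<le> 4 * (fock_norm q \<alpha> (K ?f) + fock_norm q \<alpha> (\<lambda>z. \<Sum>j\<in>J. ?\<phi> j z))"
      by (rule fock_norm_diff_le[OF Kf sum_sp q \<alpha>])
    also have "\<dots> \<le> 4 * (\<bar>C\<bar> * (D * real N powr (1 / p)) + real N * \<eta>)"
    proof -
      have "fock_norm q \<alpha> (K ?f) \<le> C * fock_norm p \<alpha> ?f" by (rule C[OF f(1)])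
      also have "\<dots> \<le> \<bar>C\<bar> * (D * real N powr (1 / p))"
        using fN by (intro mult_mono) auto
      finally have "fock_norm q \<alpha> (K ?f) \<le> \<bar>C\<bar> * (D * real N powr (1 / p))" .
      from add_mono[OF this err] show ?thesis by (rule mult_left_mono) simp
    qed
    also have "\<dots> = real N * (4 * (\<bar>C\<bar> * D * real N powr (1 / p - 1) + \<eta>))"
    proof -
      have "real N powr (1 / p) = real N powr 1 * real N powr (1 / p - 1)"
        by (subst powr_add[symmetric]) simp
      then have "real N powr (1 / p) = real N * real N powr (1 / p - 1)" by simp
      then show ?thesis by (simp only:) (simp add: algebra_simps)
    qed
    finally show ?thesis using N by (simp only: mult_le_cancel_left_pos of_nat_0_less_iff)
  qed
  have "fock_norm q \<alpha> h \<le> 0 + e" if e: "0 < e" for e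
  proof -
    have "1 / p - 1 < 0" using p by (simp add: field_simps)
    then have "(\<lambda>N. real N powr (1 / p - 1)) \<longlonglongrightarrow> 0"
      by (intro tendsto_neg_powr filterlim_real_sequentially)
    then have "(\<lambda>N. 4 * (\<bar>C\<bar> * D * real N powr (1 / p - 1) + e / 4)) \<longlonglongrightarrow> 4 * (\<bar>C\<bar> * D * 0 + e / 4)"
      by (intro tendsto_intros)
    moreover have "eventually (\<lambda>N. fock_norm q \<alpha> h \<le> 4 * (\<bar>C\<bar> * D * real N powr (1 / p - 1) + e / 4)) sequentially"
      using eventually_gt_at_top[of 0] by eventually_elim (rule mean, use e in auto)
    ultimately have "fock_norm q \<alpha> h \<le> 4 * (\<bar>C\<bar> * D * 0 + e / 4)"
      by (intro tendsto_lowerbound) auto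
    then show ?thesis by simp
  qed
  then have "fock_norm q \<alpha> h \<le> 0"
    by (rule field_le_epsilon)
  then have h0: "fock_norm q \<alpha> h = 0"
    using fock_norm_nonneg[of q \<alpha> h] by (rule antisym)
  have "(\<lambda>n. fock_norm q \<alpha> (K (fock_kernel \<alpha> (v n)))) \<longlonglongrightarrow> 0"
  proof (rule tendsto_sandwich[OF _ _ tendsto_const])
    let ?b = "\<lambda>n. 4 * (fock_norm q \<alpha> (\<lambda>z. K (fock_kernel \<alpha> (v n)) z - h z) + 0)"
    show "eventually (\<lambda>n. fock_norm q \<alpha> (K (fock_kernel \<alpha> (v n))) \<le> ?b n) sequentially"
    proof (rule always_eventually, rule allI)
      fix n
      have "(\<lambda>z. K (fock_kernel \<alpha> (v n)) z - h z) \<in> fock_space q \<alpha>"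
        using K_sp h q by (intro fock_space_diff) auto
      from fock_norm_add_le[OF this h q \<alpha>] show "fock_norm q \<alpha> (K (fock_kernel \<alpha> (v n))) \<le> ?b n"
        by (simp add: h0)
    qed
    have "?b \<longlonglongrightarrow> 4 * (0 + 0)"
      using lim unfolding v_def by (intro tendsto_intros)
    then show "?b \<longlonglongrightarrow> 0" by simp
  qed simp
  then show thesis using that[OF s] by (simp add: v_def)
qed

text \<open>The first factors pass from the derivative to the norm; the factor 4 is that of the quasi-triangle
inequality.\<close>
definition essnorm_lower_const :: "real \<Rightarrow> real \<Rightarrow> real \<Rightarrow> real" where
  "essnorm_lower_const p q \<alpha> = disc_const q \<alpha> * pi * (2 * pi / (q * \<alpha>)) * (4 * kernel_norm_bound p \<alpha>) powr q"

lemma essnorm_lower_const_pos: "0 < q \<Longrightarrow> 0 < \<alpha> \<Longrightarrow> 0 < essnorm_lower_const p q \<alpha>"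
  using disc_const_pos[of \<alpha> q] kernel_norm_bound_pos[of p \<alpha>] by (simp add: essnorm_lower_const_def)

text \<open>If the limit superior were larger, some sequence of kernels would have Berezin transforms above a
strictly larger value. On a subsequence K annihilates these kernels in the limit, so
V - K would have to be larger on them than its norm permits.\<close>
lemma Limsup_berezin_le_opnorm:
  assumes V: "fock_bounded p q \<alpha> (volterra_op g \<psi>)" and g: "g holomorphic_on UNIV" and \<psi>: "\<psi> holomorphic_on UNIV"
    and K: "fock_compact p q \<alpha> K" and p: "1 < p" "p \<le> q" and \<alpha>: "0 < \<alpha>"
  shows "Limsup at_infinity (berezin q \<alpha> \<psi> g) \<le>
    ennreal (essnorm_lower_const p q \<alpha> * fock_opnorm p q \<alpha> (\<lambda>f z. volterra_op g \<psi> f z - K f z) powr q)"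
proof (rule ccontr)
  let ?V = "volterra_op g \<psi>" and ?k = "fock_kernel \<alpha>" and ?M = "kernel_norm_bound p \<alpha>"
  let ?t = "fock_opnorm p q \<alpha> (\<lambda>f z. ?V f z - K f z)"
  define X where "X = essnorm_lower_const p q \<alpha> * ?t powr q"
  assume "\<not> Limsup at_infinity (berezin q \<alpha> \<psi> g) \<le> ennreal (essnorm_lower_const p q \<alpha> * ?t powr q)"
  then obtain y where y: "ennreal X < y" and freq: "\<not> eventually (\<lambda>u. berezin q \<alpha> \<psi> g u < y) at_infinity"
    unfolding X_def[symmetric] Limsup_le_iff by blast
  have q: "1 \<le> q" "0 < q" and p0: "0 < p" "1 \<le> p" using p by auto
  have Kb: "fock_bounded p q \<alpha> K" using K by (simp add: fock_compact_def)
  have t0: "0 \<le> ?t" by (rule fock_opnorm_diff_nonneg[OF V Kb q(1) \<alpha>])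
  have M: "0 < ?M" by (rule kernel_norm_bound_pos)
  have "\<exists>u. real n \<le> norm u \<and> y \<le> berezin q \<alpha> \<psi> g u" for n
    using freq by (auto simp: eventually_at_infinity not_less)
  then obtain w where w: "\<And>n. real n \<le> norm (w n)" "\<And>n. y \<le> berezin q \<alpha> \<psi> g (w n)" by metis
  have "filterlim (\<lambda>n. norm (w n)) at_top sequentially"
    by (rule filterlim_at_top_mono[OF filterlim_real_sequentially]) (use w(1) in simp)
  then have wlim: "filterlim w at_infinity sequentially"
    by (rule filterlim_norm_at_top_imp_at_infinity)
  obtain s where s: "strict_mono (s :: nat \<Rightarrow> nat)" and lim: "(\<lambda>n. fock_norm q \<alpha> (K (?k (w (s n))))) \<longlonglongrightarrow> 0"
    by (rule fock_compact_kernel_subsequence[OF K p(1) q(1) \<alpha> wlim])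
  have ker: "?k u \<in> fock_space p \<alpha>" "fock_norm p \<alpha> (?k u) \<le> ?M" for u
    by (rule fock_kernel_in_fock_space[OF p0(1) \<alpha>])+
  have sp: "?V (?k u) \<in> fock_space q \<alpha>" "K (?k u) \<in> fock_space q \<alpha>" for u
    using V Kb ker by (simp_all add: fock_bounded_def fock_linear_def)
  have diff_norm: "fock_norm q \<alpha> (\<lambda>z. ?V (?k u) z - K (?k u) z) \<le> ?M * ?t" for u
  proof -
    \<comment> \<open>The kernels are scaled into the unit ball, on which the operator norm is defined.\<close>
    define c where "c = complex_of_real (1 / ?M)"
    have nc: "norm c = 1 / ?M" using M by (simp only: c_def norm_of_real) simp
    let ?f = "\<lambda>z. c * ?k u z"
    have f: "?f \<in> fock_space p \<alpha>" by (rule fock_space_cmult[OF ker(1)])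
    have "fock_norm p \<alpha> ?f = 1 / ?M * fock_norm p \<alpha> (?k u)"
      by (simp only: fock_norm_cmult[OF ker(1) p0(1) \<alpha>] nc)
    also have "\<dots> \<le> 1 / ?M * ?M" using ker(2)[of u] M by (intro mult_left_mono) auto
    finally have f1: "fock_norm p \<alpha> ?f \<le> 1" using M by simp
    have scale: "T (\<lambda>z. c * ?k u z) = (\<lambda>z. c * T (?k u) z)" if "fock_bounded p q \<alpha> T" for T
      using that ker by (simp add: fock_bounded_def fock_linear_def)
    have "fock_norm q \<alpha> (\<lambda>z. ?V ?f z - K ?f z) \<le> ?t"
      by (rule fock_opnorm_diff_upper[OF V Kb q(1) \<alpha> f f1])
    moreover have "(\<lambda>z. ?V ?f z - K ?f z) = (\<lambda>z. c * (?V (?k u) z - K (?k u) z))"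
      by (simp add: scale[OF V] scale[OF Kb] right_diff_distrib)
    moreover have "fock_norm q \<alpha> (\<lambda>z. c * (?V (?k u) z - K (?k u) z)) = 1 / ?M * fock_norm q \<alpha> (\<lambda>z. ?V (?k u) z - K (?k u) z)"
      unfolding nc[symmetric] using sp q by (intro fock_norm_cmult fock_space_diff \<alpha>) auto
    ultimately have "1 / ?M * fock_norm q \<alpha> (\<lambda>z. ?V (?k u) z - K (?k u) z) \<le> ?t" by simp
    then show ?thesis using M by (simp add: field_simps)
  qed
  define c1 where "c1 = disc_const q \<alpha> * pi * (2 * pi / (q * \<alpha>))"
  have c1: "0 \<le> c1" using disc_const_pos[OF \<alpha>, of q] q \<alpha> by (simp add: c1_def)
  define b where "b n = c1 * (4 * (?M * ?t + fock_norm q \<alpha> (K (?k (w (s n)))))) powr q" for n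
  have y_le: "y \<le> ennreal (b n)" for n
  proof -
    let ?u = "w (s n)"
    have hol: "?V (?k ?u) holomorphic_on UNIV" using sp by (simp add: fock_space_def)
    have "(\<lambda>z. ?V (?k ?u) z - K (?k ?u) z) \<in> fock_space q \<alpha>"
      using sp q by (intro fock_space_diff) auto
    from fock_norm_add_le[OF this sp(2)[of ?u] q(1) \<alpha>]
    have le: "fock_norm q \<alpha> (?V (?k ?u)) \<le> 4 * (?M * ?t + fock_norm q \<alpha> (K (?k ?u)))"
      using diff_norm[of ?u] by simp
    have "y \<le> deriv_mass q \<alpha> (?V (?k ?u))"
      using w(2)[of "s n"] by (simp add: berezin_eq_deriv_mass[OF g \<psi>])
    also have "\<dots> \<le> ennreal (disc_const q \<alpha> * pi) * fock_mass q \<alpha> (?V (?k ?u))"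
      by (rule deriv_mass_le_fock_mass[OF hol q(1) \<alpha>])
    also have "\<dots> = ennreal (disc_const q \<alpha> * pi) * ennreal (2 * pi / (q * \<alpha>) * fock_norm q \<alpha> (?V (?k ?u)) powr q)"
      by (simp only: fock_mass_eq_fock_norm[OF sp(1) q(2) \<alpha>])
    also have "\<dots> = ennreal (disc_const q \<alpha> * pi * (2 * pi / (q * \<alpha>) * fock_norm q \<alpha> (?V (?k ?u)) powr q))"
      using disc_const_pos[OF \<alpha>, of q] q \<alpha> by (intro ennreal_mult[symmetric]) auto
    also have "\<dots> = ennreal (c1 * fock_norm q \<alpha> (?V (?k ?u)) powr q)"
      by (simp add: c1_def mult.assoc)
    also have "\<dots> \<le> ennreal (b n)"
      unfolding b_def using le c1 q by (intro ennreal_leI mult_left_mono powr_mono2) auto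
    finally show ?thesis .
  qed
  have "b \<longlonglongrightarrow> c1 * (4 * (?M * ?t + 0)) powr q"
    unfolding b_def using lim q M t0
    by (intro tendsto_mult tendsto_powr2 tendsto_add tendsto_const) (auto intro!: always_eventually)
  moreover have "c1 * (4 * (?M * ?t + 0)) powr q = X"
    by (simp add: X_def essnorm_lower_const_def c1_def powr_mult)
  ultimately have "(\<lambda>n. ennreal (b n)) \<longlonglongrightarrow> ennreal X" by (intro tendsto_ennrealI) simp
  then have "y \<le> ennreal X"
    by (rule LIMSEQ_le_const) (use y_le in auto)
  with y show False by simp
qed

section \<open>Comparison of the essential norm with the Berezin transform\<close>

theorem theorem3:
  fixes p q \<alpha> :: real
  assumes "1 < p" and "p \<le> q" and "0 < \<alpha>"
  shows "\<exists>c C :: real. 0 < c \<and> 0 < C \<and>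
    (\<forall>g \<psi> :: complex \<Rightarrow> complex.
       g holomorphic_on UNIV \<longrightarrow> \<psi> holomorphic_on UNIV \<longrightarrow>
       fock_bounded p q \<alpha> (volterra_op g \<psi>) \<longrightarrow>
       ennreal (fock_essnorm p q \<alpha> (volterra_op g \<psi>))
         \<le> ennreal C * ennreal_powr (Limsup at_infinity (berezin q \<alpha> \<psi> g)) (1 / q) \<and>
       ennreal_powr (Limsup at_infinity (berezin q \<alpha> \<psi> g)) (1 / q)
         \<le> ennreal c * ennreal (fock_essnorm p q \<alpha> (volterra_op g \<psi>)))"
proof -
  have p: "1 \<le> p" and q: "1 \<le> q" "0 < q" using assms by auto
  define C where "C = essnorm_upper_const p q \<alpha> powr (1 / q)"
  define c where "c = essnorm_lower_const p q \<alpha> powr (1 / q)"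
  have U: "0 < essnorm_upper_const p q \<alpha>" by (rule essnorm_upper_const_pos[OF p q(1) assms(3)])
  have L: "0 < essnorm_lower_const p q \<alpha>" by (rule essnorm_lower_const_pos[OF q(2) assms(3)])
  have C: "0 < C" and c: "0 < c" using U L by (simp_all add: C_def c_def)
  have both: "ennreal (fock_essnorm p q \<alpha> (volterra_op g \<psi>))
         \<le> ennreal C * ennreal_powr (Limsup at_infinity (berezin q \<alpha> \<psi> g)) (1 / q) \<and>
       ennreal_powr (Limsup at_infinity (berezin q \<alpha> \<psi> g)) (1 / q)
         \<le> ennreal c * ennreal (fock_essnorm p q \<alpha> (volterra_op g \<psi>))"
    if g: "g holomorphic_on UNIV" and \<psi>: "\<psi> holomorphic_on UNIV" and V: "fock_bounded p q \<alpha> (volterra_op g \<psi>)"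
    for g \<psi>
  proof -
    let ?V = "volterra_op g \<psi>"
    let ?E = "fock_essnorm p q \<alpha> ?V"
    let ?t = "\<lambda>K. fock_opnorm p q \<alpha> (\<lambda>f z. ?V f z - K f z)"
    note low = Limsup_berezin_le_opnorm[OF V g \<psi> _ assms]
    have K0: "fock_compact p q \<alpha> (\<lambda>f. ?V (dilate (1 / 2) f))"
      by (rule fock_compact_dilate[OF V p assms(3)]) auto
    obtain l where l: "Limsup at_infinity (berezin q \<alpha> \<psi> g) = ennreal l" "0 \<le> l"
      using low[OF K0] by (cases "Limsup at_infinity (berezin q \<alpha> \<psi> g)") (auto simp: top_unique)
    have root: "ennreal_powr (Limsup at_infinity (berezin q \<alpha> \<psi> g)) (1 / q) = ennreal (l powr (1 / q))"
      using l by (simp add: ennreal_powr_def)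
    have upper: "?E \<le> C * l powr (1 / q)"
      unfolding C_def by (rule fock_essnorm_volterra_le[OF V g \<psi> p assms(2,3) l(2,1)])
    have "l powr (1 / q) / c \<le> ?E"
      unfolding fock_essnorm_def
    proof (rule cINF_greatest)
      show "{K. fock_compact p q \<alpha> K} \<noteq> {}" using K0 by blast
      fix K assume "K \<in> {K. fock_compact p q \<alpha> K}"
      then have K: "fock_compact p q \<alpha> K" by simp
      have t: "0 \<le> ?t K"
        using fock_opnorm_diff_nonneg[OF V _ q(1) assms(3)] K by (simp add: fock_compact_def)
      have "ennreal l \<le> ennreal (essnorm_lower_const p q \<alpha> * ?t K powr q)"
        using low[OF K] by (simp add: l(1))
      then have "l \<le> essnorm_lower_const p q \<alpha> * ?t K powr q"
        using L by (subst (asm) ennreal_le_iff) auto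
      then have "l powr (1 / q) \<le> (essnorm_lower_const p q \<alpha> * ?t K powr q) powr (1 / q)"
        using l q by (intro powr_mono2) auto
      also have "\<dots> = c * ?t K"
        using t q by (simp add: c_def powr_mult powr_powr)
      finally show "l powr (1 / q) / c \<le> ?t K"
        using c by (simp add: field_simps)
    qed
    then have lower: "l powr (1 / q) \<le> c * ?E" using c by (simp add: field_simps)
    have E: "0 \<le> ?E"
    proof -
      have "0 \<le> l powr (1 / q)" by simp
      then have "0 \<le> c * ?E" using lower by (rule order_trans)
      then show ?thesis using c by (simp add: zero_le_mult_iff)
    qed
    show ?thesis
      unfolding root using upper lower C c E by (simp add: ennreal_leI flip: ennreal_mult)
  qed
  show ?thesis
    using both C c by (intro exI[of _ c] exI[of _ C] conjI allI impI) auto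
qed

end
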